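(* Let $k\ge1$ be an integer. If $k$ is odd, then the $(k+1)$-dimensional helicoid $H_k\subset\mathbb{R}^{2k+1}$ is not area-minimizing.
   Context: For an integer $k\ge1$, $H_k$ is the image of the proper embedding $\mathbb{R}^k\times\mathbb{R}\to\mathbb{R}^k\times\mathbb{R}^k\times\mathbb{R}$, $(u,s)\mapsto(\cos s\,u,\sin s\,u,s)$, oriented by the coordinates $(u_1,\dots,u_k,s)$; $[\![H_k]\!]$ is the associated integral $(k+1)$-current. $H_k$ is area-minimizing if for every compactly supported integral $(k+1)$-current $S$ in $\mathbb{R}^{2k+1}$ with $\partial S=0$ and every open ball $B$ containing the support of $S$, one has $\mathbb{M}([\![H_k]\!]\llcorner B)\le\mathbb{M}(([\![H_k]\!]+S)\llcorner B)$, where $\mathbb{M}$ denotes mass. *)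

theory Defs
  imports "HOL-Analysis.Analysis"
begin

section \<open>Smooth functions and differential forms\<close>

primrec iterated_deriv :: "'a::euclidean_space list \<Rightarrow> ('a \<Rightarrow> real) \<Rightarrow> 'a \<Rightarrow> real" where
  "iterated_deriv [] f = f"
| "iterated_deriv (v # vs) f = (\<lambda>x. frechet_derivative (iterated_deriv vs f) (at x) v)"

definition smooth :: "('a::euclidean_space \<Rightarrow> real) \<Rightarrow> bool" where
  "smooth f \<longleftrightarrow> (\<forall>vs x. iterated_deriv vs f differentiable (at x))"

text \<open>An \<open>m\<close>-covector takes its \<open>m\<close> arguments as a sequence, of which only the entries with
  index below \<open>m\<close> matter.  This independence is part of \<open>alternating_multilinear\<close>, so that
  equality of functions is equality of covectors.\<close>

type_synonym 'a covector = "(nat \<Rightarrow> 'a) \<Rightarrow> real"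
type_synonym 'a form = "'a \<Rightarrow> 'a covector"
type_synonym 'a current = "'a form \<Rightarrow> real"

definition alternating_multilinear :: "nat \<Rightarrow> 'a::euclidean_space covector \<Rightarrow> bool" where
  "alternating_multilinear m \<phi> \<longleftrightarrow>
     (\<forall>v w. (\<forall>i<m. v i = w i) \<longrightarrow> \<phi> v = \<phi> w) \<and>
     (\<forall>v. \<forall>i<m. linear (\<lambda>w. \<phi> (v(i := w)))) \<and>
     (\<forall>v i j. i < j \<and> j < m \<and> v i = v j \<longrightarrow> \<phi> v = 0)"

definition form_support :: "'a::euclidean_space form \<Rightarrow> 'a set" where
  "form_support \<omega> = closure {x. \<omega> x \<noteq> (\<lambda>_. 0)}"

definition test_forms :: "nat \<Rightarrow> 'a::euclidean_space form set" where
  "test_forms m = {\<omega>. (\<forall>x. alternating_multilinear m (\<omega> x)) \<and>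
                       (\<forall>v. smooth (\<lambda>x. \<omega> x v)) \<and> compact (form_support \<omega>)}"

text \<open>Exterior derivative of a \<open>p\<close>-form:
  \<open>d\<omega>(v\<^sub>0,\<dots>,v\<^sub>p) = \<Sum>\<^sub>i (-1)\<^sup>i D\<^bsub>v\<^sub>i\<^esub> \<omega>(v\<^sub>0,\<dots>,v\<^sub>i\<^sub>-\<^sub>1,v\<^sub>i\<^sub>+\<^sub>1,\<dots>,v\<^sub>p)\<close>.\<close>

definition ext_deriv :: "nat \<Rightarrow> 'a::euclidean_space form \<Rightarrow> 'a form" where
  "ext_deriv p \<omega> = (\<lambda>x v. \<Sum>i\<le>p. (-1) ^ i *
     frechet_derivative (\<lambda>y. \<omega> y (\<lambda>j. if j < i then v j else v (Suc j))) (at x) (v i))"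

text \<open>Every unit simple \<open>m\<close>-vector is the wedge product of an orthonormal \<open>m\<close>-frame, so the
  comass (the supremum over unit simple \<open>m\<close>-vectors) is a supremum over such frames.\<close>

definition comass :: "nat \<Rightarrow> 'a::euclidean_space covector \<Rightarrow> ennreal" where
  "comass m \<phi> =
     (SUP v \<in> {v. \<forall>i<m. \<forall>j<m. v i \<bullet> v j = (if i = j then 1 else 0)}. ennreal \<bar>\<phi> v\<bar>)"


section \<open>Currents\<close>

text \<open>Only the values of a current on test forms are meaningful.  For linear functionals on the
  space of test forms, continuity is the same as sequential continuity at \<open>0\<close>.\<close>

definition is_current :: "nat \<Rightarrow> 'a::euclidean_space current \<Rightarrow> bool" where
  "is_current m T \<longleftrightarrow>
     (\<forall>\<omega>\<in>test_forms m. \<forall>\<eta>\<in>test_forms m. T (\<lambda>x v. \<omega> x v + \<eta> x v) = T \<omega> + T \<eta>) \<and>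
     (\<forall>c. \<forall>\<omega>\<in>test_forms m. T (\<lambda>x v. c * \<omega> x v) = c * T \<omega>) \<and>
     (\<forall>\<omega> :: nat \<Rightarrow> 'a form. \<forall>K.
        (\<forall>n. \<omega> n \<in> test_forms m) \<and> compact K \<and> (\<forall>n. form_support (\<omega> n) \<subseteq> K) \<and>
        (\<forall>vs v. uniform_limit UNIV (\<lambda>n. iterated_deriv vs (\<lambda>y. \<omega> n y v)) (\<lambda>_. 0) sequentially)
        \<longrightarrow> (\<lambda>n. T (\<omega> n)) \<longlonglongrightarrow> 0)"

definition current_support :: "nat \<Rightarrow> 'a::euclidean_space current \<Rightarrow> 'a set" where
  "current_support m T =
     - \<Union>{U. open U \<and> (\<forall>\<omega>\<in>test_forms m. form_support \<omega> \<subseteq> U \<longrightarrow> T \<omega> = 0)}"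

definition boundary :: "nat \<Rightarrow> 'a::euclidean_space current \<Rightarrow> 'a current" where
  "boundary m T = (\<lambda>\<omega>. T (ext_deriv (m - 1) \<omega>))"

definition mass :: "nat \<Rightarrow> 'a::euclidean_space current \<Rightarrow> ennreal" where
  "mass m T = (SUP \<omega> \<in> {\<omega>\<in>test_forms m. \<forall>x. comass m (\<omega> x) \<le> 1}. ennreal \<bar>T \<omega>\<bar>)"

text \<open>Restriction \<open>T \<llcorner> B\<close> of a current representable by integration (that is, of locally finite
  mass) to an open set \<open>B\<close>.  By dominated convergence \<open>(T \<llcorner> B)(\<omega>)\<close>, the integral of \<open>\<omega>\<close> against
  the vector measure \<open>T\<close> over \<open>B\<close>, is the limit of \<open>T(\<phi>\<^sub>n \<omega>)\<close> for every sequence of smooth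
  functions \<open>\<phi>\<^sub>n\<close> with values in \<open>[0,1]\<close> converging pointwise to the indicator function of \<open>B\<close>,
  and such sequences exist.\<close>

definition restrict_current ::
    "'a::euclidean_space current \<Rightarrow> 'a set \<Rightarrow> 'a current" where
  "restrict_current T B = (\<lambda>\<omega>. THE l. \<forall>\<phi> :: nat \<Rightarrow> 'a \<Rightarrow> real.
     (\<forall>n. smooth (\<phi> n)) \<and> (\<forall>n x. 0 \<le> \<phi> n x \<and> \<phi> n x \<le> 1) \<and>
     (\<forall>x. (\<lambda>n. \<phi> n x) \<longlonglongrightarrow> indicat_real B x)
     \<longrightarrow> (\<lambda>n. T (\<lambda>x v. \<phi> n x * \<omega> x v)) \<longlonglongrightarrow> l)"


section \<open>Integral currents\<close>

text \<open>Points of \<open>\<real>\<^sup>m\<close>, for a natural number \<open>m\<close>, are represented by functions in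
  \<open>{..<m} \<rightarrow>\<^sub>E UNIV\<close>, with Lebesgue measure as the product measure.  The current
  \<open>param_current m A f\<close> is \<open>\<omega> \<mapsto> \<integral>\<^sub>A f\<^sup>*\<omega>\<close>, where \<open>A \<subseteq> \<real>\<^sup>m\<close> has the standard orientation.\<close>

definition partial_deriv :: "((nat \<Rightarrow> real) \<Rightarrow> 'a::euclidean_space) \<Rightarrow> (nat \<Rightarrow> real) \<Rightarrow> nat \<Rightarrow> 'a" where
  "partial_deriv f y i = vector_derivative (\<lambda>t. f (y(i := t))) (at (y i))"

definition param_current ::
    "nat \<Rightarrow> (nat \<Rightarrow> real) set \<Rightarrow> ((nat \<Rightarrow> real) \<Rightarrow> 'a::euclidean_space) \<Rightarrow> 'a current" where
  "param_current m A f =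
     (\<lambda>\<omega>. LINT y:A|PiM {..<m} (\<lambda>_. lborel). \<omega> (f y) (partial_deriv f y))"

definition open_cube :: "nat \<Rightarrow> (nat \<Rightarrow> real) set" where
  "open_cube m = {..<m} \<rightarrow>\<^sub>E {0<..<1}"

definition lipschitz_cube :: "nat \<Rightarrow> ((nat \<Rightarrow> real) \<Rightarrow> 'a::euclidean_space) \<Rightarrow> bool" where
  "lipschitz_cube m f \<longleftrightarrow>
     (\<exists>L. \<forall>x\<in>open_cube m. \<forall>y\<in>open_cube m. dist (f x) (f y) \<le> L * (\<Sum>i<m. \<bar>x i - y i\<bar>))"

definition lipschitz_chain ::
    "nat \<Rightarrow> (int \<times> ((nat \<Rightarrow> real) \<Rightarrow> 'a::euclidean_space)) list \<Rightarrow> 'a current" where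
  "lipschitz_chain m c =
     (\<lambda>\<omega>. \<Sum>(a, f)\<leftarrow>c. real_of_int a * param_current m (open_cube m) f \<omega>)"

text \<open>Rectifiable (integer multiplicity) and integral currents with compact support, following
  Federer (Geometric Measure Theory, 4.1.24): the rectifiable currents are the limits in mass of
  Lipschitz images, in a fixed compact set, of integral polyhedral chains.  Lipschitz images of
  polyhedral chains are written as finite integer combinations of Lipschitz cubes: polyhedral
  cells and cubes of the same dimension are Lipschitz images of degree one of each other, and the
  push-forward along a Lipschitz map is given by its almost everywhere defined derivative.  Faces
  of the cube are null sets, so the open cube may be used.\<close>

definition rectifiable_current :: "nat \<Rightarrow> 'a::euclidean_space current \<Rightarrow> bool" where
  "rectifiable_current m T \<longleftrightarrow> is_current m T \<and>
     (\<exists>K. compact K \<and> (\<forall>\<epsilon>>0. \<exists>c.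
        (\<forall>(a, f)\<in>set c. lipschitz_cube m f \<and> f ` open_cube m \<subseteq> K) \<and>
        mass m (\<lambda>\<omega>. T \<omega> - lipschitz_chain m c \<omega>) < \<epsilon>))"

definition integral_current :: "nat \<Rightarrow> 'a::euclidean_space current \<Rightarrow> bool" where
  "integral_current m T \<longleftrightarrow> rectifiable_current m T \<and>
     (0 < m \<longrightarrow> rectifiable_current (m - 1) (boundary m T))"

text \<open>Here \<open>T\<close> is an \<open>m\<close>-dimensional current of locally finite mass, \<open>m \<ge> 1\<close>.\<close>

definition area_minimizing :: "nat \<Rightarrow> 'a::euclidean_space current \<Rightarrow> bool" where
  "area_minimizing m T \<longleftrightarrow>
     (\<forall>S x r. integral_current m S \<and> compact (current_support m S) \<and>
        (\<forall>\<omega>\<in>test_forms (m - 1). boundary m S \<omega> = 0) \<and>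
        0 < r \<and> current_support m S \<subseteq> ball x r \<longrightarrow>
        mass m (restrict_current T (ball x r))
          \<le> mass m (restrict_current (\<lambda>\<omega>. T \<omega> + S \<omega>) (ball x r)))"


section \<open>The helicoid\<close>

definition helicoid_embedding ::
    "(real^'k) \<times> real \<Rightarrow> (real^'k) \<times> (real^'k) \<times> real" where
  "helicoid_embedding = (\<lambda>(u, s). (cos s *\<^sub>R u, sin s *\<^sub>R u, s))"

text \<open>The coordinates \<open>(u\<^sub>1,\<dots>,u\<^sub>k,s)\<close>: the linear order of the index type determines the order of
  the components of \<open>u\<close>, and \<open>s\<close> comes last.\<close>

definition helicoid_coords :: "(nat \<Rightarrow> real) \<Rightarrow> (real^('k::{finite,linorder})) \<times> real" where
  "helicoid_coords y = ((\<chi> i. y (card {j. j < i})), y CARD('k::{finite,linorder}))"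

text \<open>As the embedding is proper, integration over the oriented helicoid is integration of the
  pull-back over the whole parameter space.\<close>

definition helicoid_current ::
    "((real^('k::{finite,linorder})) \<times> (real^('k::{finite,linorder})) \<times> real) current" where
  "helicoid_current = param_current (CARD('k::{finite,linorder}) + 1) ({..<CARD('k::{finite,linorder}) + 1} \<rightarrow>\<^sub>E UNIV)
     (\<lambda>y. helicoid_embedding (helicoid_coords y))"

end

theory Submission
  imports Defs
begin

text \<open>For odd \<open>k\<close> the half turn \<open>(u, s) \<mapsto> (-u, s + \<pi>)\<close> of the parameters is an orientation reversing
  symmetry that covers the vertical translation by \<open>\<pi>\<close>.  So the piece \<open>P\<close> of the helicoid over
  \<open>[-R, R]\<^sup>k \<times> [0, \<pi>]\<close> and the piece above it cancel, up to the boundary of the \<open>(k + 2)\<close>-cube that \<open>P\<close>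
  sweeps out when it is translated by \<open>\<pi>\<close>: replacing both by the side faces of this cube trades area
  of order \<open>R\<^sup>k\<^sup>+\<^sup>1\<close> for area of order \<open>R\<^sup>k\<close>.  The helicoid is orthogonally parametrized with density
  \<open>sqrt (1 + |u|\<^sup>2)\<close>.  This bounds the mass of the competitor from above; the mass of the helicoid is
  bounded from below by pairing it with cut-offs of the unit simple form dual to its tangent
  frame, which extends smoothly to the whole space.\<close>

section \<open>Alternating covectors\<close>

text \<open>The half turn has determinant \<open>(-1) ^ k\<close> on the parameters. For even
  \<open>k\<close> it preserves the orientation, and adding the boundary of the swept cube would
  remove one of the two pieces but double the other, so nothing would be gained. Since side faces
  and pieces grow at different rates in \<open>R\<close>, most constants may be crude: forms on the
  side faces are estimated through their basis coefficients, and the area of the lower piece alone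
  is counted as saved. One quantity must be exact, the area of the helicoid in the ball, because it
  occurs in both bounds and has to cancel. Hence the upper bound evaluates forms on the normalized
  tangent frame itself, and the lower bound uses test forms of comass at most 1 whose values
  converge to that area. The filling is a parametrized cube because its boundary is then literally a
  finite integer chain of Lipschitz cubes, so that the competitor is approximated with error zero;
  that it has no boundary follows from Stokes' theorem on its faces.\<close>

lemma alternating_multilinear_cong:
  assumes "alternating_multilinear m \<phi>" "\<And>i. i < m \<Longrightarrow> v i = w i"
  shows "\<phi> v = \<phi> w"
  using assms unfolding alternating_multilinear_def by blast

lemma alternating_multilinear_linear:
  assumes "alternating_multilinear m \<phi>" "i < m"
  shows "linear (\<lambda>w. \<phi> (v(i := w)))"
  using assms unfolding alternating_multilinear_def by blast

lemma alternating_multilinear_equal_slots: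
  assumes "alternating_multilinear m \<phi>" "i < m" "j < m" "i \<noteq> j" "v i = v j"
  shows "\<phi> v = 0"
proof -
  have *: "\<phi> v = 0" if "i < j \<and> j < m \<and> v i = v j" for i j
    using assms(1) that unfolding alternating_multilinear_def by blast
  show ?thesis
    using *[of i j] *[of j i] assms(2-) by (cases i j rule: linorder_cases) auto
qed

lemma alternating_multilinear_slot_expansion:
  fixes \<phi> :: "'a::euclidean_space covector"
  assumes "alternating_multilinear m \<phi>" "i < m"
  shows "\<phi> v = (\<Sum>b\<in>Basis. (v i \<bullet> b) * \<phi> (v(i := b)))"
proof -
  interpret linear "\<lambda>w. \<phi> (v(i := w))"
    using alternating_multilinear_linear[OF assms] .
  have "\<phi> v = \<phi> (v(i := (\<Sum>b\<in>Basis. (v i \<bullet> b) *\<^sub>R b)))"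
    by (simp add: euclidean_representation)
  also have "\<dots> = (\<Sum>b\<in>Basis. (v i \<bullet> b) * \<phi> (v(i := b)))"
    by (simp add: sum scale)
  finally show ?thesis .
qed

abbreviation basis_tuples :: "nat \<Rightarrow> (nat \<Rightarrow> 'a::euclidean_space) set" where
  "basis_tuples m \<equiv> {..<m} \<rightarrow>\<^sub>E Basis"

lemma finite_basis_tuples [simp]: "finite (basis_tuples m :: (nat \<Rightarrow> 'a::euclidean_space) set)"
  by (intro finite_PiE) auto

lemma card_basis_tuples:
  "card (basis_tuples m :: (nat \<Rightarrow> 'a::euclidean_space) set) = DIM('a) ^ m"
  by (rule card_PiE[THEN trans]) (auto simp: prod_constant)

text \<open>Linearity, used in one slot after the other. A form thereby becomes finitely many
  coefficient functions, and continuity, product rules and size estimates for forms all reduce to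
  these.\<close>

lemma alternating_multilinear_expansion:
  fixes \<phi> :: "'a::euclidean_space covector"
  assumes \<phi>: "alternating_multilinear m \<phi>"
  shows "\<phi> v = (\<Sum>I\<in>basis_tuples m. (\<Prod>i<m. v i \<bullet> I i) * \<phi> I)"
proof -
  \<comment> \<open>The induction replaces the first \<open>n\<close> arguments by basis vectors and
    keeps the later ones.\<close>
  have "\<phi> v = (\<Sum>I\<in>basis_tuples n. (\<Prod>i<n. v i \<bullet> I i) * \<phi> (\<lambda>i. if i < n then I i else v i))"
    if "n \<le> m" for n
    using that
  proof (induction n)
    case 0
    then show ?case by simp
  next
    case (Suc n)
    have ins: "{..<Suc n} = insert n {..<n}" by auto
    have "(\<Sum>I\<in>basis_tuples (Suc n). (\<Prod>i<Suc n. v i \<bullet> I i) * \<phi> (\<lambda>i. if i < Suc n then I i else v i))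
      = (\<Sum>(b, I)\<in>Basis \<times> basis_tuples n. (\<Prod>i<Suc n. v i \<bullet> (I(n := b)) i)
           * \<phi> (\<lambda>i. if i < Suc n then (I(n := b)) i else v i))"
      unfolding ins PiE_insert_eq
      by (subst sum.reindex[OF inj_combinator]) (simp_all add: case_prod_unfold flip: ins)
    also have "\<dots> = (\<Sum>(b, I)\<in>Basis \<times> basis_tuples n. (\<Prod>i<n. v i \<bullet> I i)
           * ((v n \<bullet> b) * \<phi> ((\<lambda>i. if i < n then I i else v i)(n := b))))"
    proof (intro sum.cong refl, clarify)
      fix b :: 'a and I
      have "(\<Prod>i<n. v i \<bullet> (if i = n then b else I i)) = (\<Prod>i<n. v i \<bullet> I i)"
        by (intro prod.cong) auto
      moreover have "(\<lambda>i. if i < Suc n then (I(n := b)) i else v i) =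
          (\<lambda>i. if i < n then I i else v i)(n := b)"
        by (auto simp: fun_eq_iff)
      ultimately show "(\<Prod>i<Suc n. v i \<bullet> (I(n := b)) i) * \<phi> (\<lambda>i. if i < Suc n then (I(n := b)) i else v i) =
          (\<Prod>i<n. v i \<bullet> I i) * ((v n \<bullet> b) * \<phi> ((\<lambda>i. if i < n then I i else v i)(n := b)))"
        by simp
    qed
    also have "\<dots> = (\<Sum>I\<in>basis_tuples n. (\<Prod>i<n. v i \<bullet> I i) *
        (\<Sum>b\<in>Basis. (v n \<bullet> b) * \<phi> ((\<lambda>i. if i < n then I i else v i)(n := b))))"
      by (simp add: sum.cartesian_product[symmetric] sum_distrib_left) (rule sum.swap)
    also have "\<dots> = (\<Sum>I\<in>basis_tuples n. (\<Prod>i<n. v i \<bullet> I i) * \<phi> (\<lambda>i. if i < n then I i else v i))"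
      using Suc.prems
        alternating_multilinear_slot_expansion[OF \<phi>, of n "\<lambda>i. if i < n then _ i else v i"]
      by simp
    finally show ?case using Suc by simp
  qed
  from this[of m] have "\<phi> v = (\<Sum>I\<in>basis_tuples m. (\<Prod>i<m. v i \<bullet> I i) * \<phi> (\<lambda>i. if i < m then I i else v i))"
    by simp
  also have "\<dots> = (\<Sum>I\<in>basis_tuples m. (\<Prod>i<m. v i \<bullet> I i) * \<phi> I)"
    by (intro sum.cong refl arg_cong2[where f="(*)"] alternating_multilinear_cong[OF \<phi>]) auto
  finally show ?thesis .
qed

text \<open>The factor \<open>DIM('a) ^ m\<close> counts the terms of the basis expansion. It is
  wasteful but does not depend on \<open>v\<close>, which suffices where only the order of growth
  matters.\<close>

lemma alternating_multilinear_bound: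
  fixes \<phi> :: "'a::euclidean_space covector"
  assumes \<phi>: "alternating_multilinear m \<phi>" and C: "\<And>I. I \<in> basis_tuples m \<Longrightarrow> \<bar>\<phi> I\<bar> \<le> C"
  shows "\<bar>\<phi> v\<bar> \<le> C * real (DIM('a)) ^ m * (\<Prod>i<m. norm (v i))"
proof -
  have "\<bar>\<phi> v\<bar> \<le> (\<Sum>I\<in>basis_tuples m. \<bar>\<Prod>i<m. v i \<bullet> I i\<bar> * \<bar>\<phi> I\<bar>)"
    unfolding alternating_multilinear_expansion[OF \<phi>, of v]
    by (rule order_trans[OF sum_abs]) (simp add: abs_mult)
  also have "\<dots> \<le> (\<Sum>I\<in>(basis_tuples m :: (nat \<Rightarrow> 'a) set). (\<Prod>i<m. norm (v i)) * C)"
  proof (intro sum_mono mult_mono C)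
    fix I :: "nat \<Rightarrow> 'a" assume I: "I \<in> basis_tuples m"
    show "\<bar>\<Prod>i<m. v i \<bullet> I i\<bar> \<le> (\<Prod>i<m. norm (v i))"
      unfolding abs_prod
    proof (intro prod_mono conjI)
      fix i assume "i \<in> {..<m}"
      then have "I i \<in> Basis" using I by auto
      then show "\<bar>v i \<bullet> I i\<bar> \<le> norm (v i)" by (rule Basis_le_norm)
    qed auto
  qed (simp_all add: prod_nonneg)
  also have "\<dots> = C * real (DIM('a)) ^ m * (\<Prod>i<m. norm (v i))"
    by (simp only: sum_constant card_basis_tuples of_nat_power mult_ac)
  finally show ?thesis .
qed

section \<open>Inserting and omitting one index\<close>

definition insert_at :: "nat \<Rightarrow> 'b \<Rightarrow> (nat \<Rightarrow> 'b) \<Rightarrow> nat \<Rightarrow> 'b" where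
  "insert_at j x g = (\<lambda>i. if i < j then g i else if i = j then x else g (i - 1))"

text \<open>\<open>skip j\<close> enumerates the indices other than \<open>j\<close> in increasing
  order, so it renumbers the coordinates of a face as coordinates of the cube;
  \<open>insert_at j\<close> is the matching inclusion of the face. The same pair serves for lists
  of arguments with one vector inserted.\<close>

definition skip :: "nat \<Rightarrow> nat \<Rightarrow> nat" where
  "skip j i = (if i < j then i else Suc i)"

lemma skip_less: "i < m \<Longrightarrow> skip j i < Suc m"
  by (auto simp: skip_def)

lemma insert_at_skip [simp]: "insert_at j x g (skip j i) = g i"
  by (auto simp: skip_def insert_at_def)

lemma insert_at_same [simp]: "insert_at j x g j = x"
  by (auto simp: insert_at_def)

lemma insert_at_upd: "insert_at j x (g(i := y)) = (insert_at j x g)(skip j i := y)"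
  by (auto simp: skip_def insert_at_def fun_eq_iff)

lemma bij_betw_skip: "j \<le> m \<Longrightarrow> bij_betw (skip j) {..<m} ({..<Suc m} - {j})"
  by (rule bij_betw_byWitness[where f' = "\<lambda>i. if i < j then i else i - 1"])
     (auto simp: skip_def)

text \<open>The cubical identity: two coordinates may be fixed in either order, but once the smaller
  one is fixed, the larger one has its number lowered by one.\<close>

lemma insert_at_insert_at:
  "i < p \<Longrightarrow> insert_at i x (insert_at (p - 1) y g) = insert_at p y (insert_at i x g)"
  by (auto simp: insert_at_def fun_eq_iff)

lemma alternating_multilinear_swap:
  assumes \<phi>: "alternating_multilinear m \<phi>" and ij: "i < m" "j < m" "i \<noteq> j"
  shows "\<phi> (v(i := x, j := y)) = - \<phi> (v(i := y, j := x))"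
proof -
  have add_i: "\<phi> (w(i := a + b)) = \<phi> (w(i := a)) + \<phi> (w(i := b))" for w a b
    using linear_add[OF alternating_multilinear_linear[OF \<phi> ij(1), of w]] .
  have add_j: "\<phi> (w(j := a + b)) = \<phi> (w(j := a)) + \<phi> (w(j := b))" for w a b
    using linear_add[OF alternating_multilinear_linear[OF \<phi> ij(2), of w]] .
  have tw: "w(i := a, j := b) = w(j := b, i := a)" for w and a b :: 'a
    using ij(3) by (rule fun_upd_twist)
  have z: "\<phi> (v(i := a, j := a)) = 0" for a
    by (rule alternating_multilinear_equal_slots[OF \<phi> ij]) (use ij in auto)
  have "0 = \<phi> (v(i := x + y, j := x + y))" using z by simp
  also have "\<dots> = \<phi> (v(i := x, j := x + y)) + \<phi> (v(i := y, j := x + y))"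
    unfolding tw add_i ..
  also have "\<dots> = \<phi> (v(i := x, j := y)) + \<phi> (v(i := y, j := x))"
    by (simp add: add_j z)
  finally show ?thesis by simp
qed

text \<open>Moving \<open>h\<close> from slot \<open>b\<close> to the front passes \<open>b\<close>
  other arguments, and each exchange of neighbours costs a sign.\<close>

lemma alternating_multilinear_insert_at:
  assumes \<phi>: "alternating_multilinear m \<phi>" and "b < m"
  shows "\<phi> (insert_at b h g) = (-1) ^ b * \<phi> (insert_at 0 h g)"
  using assms(2)
proof (induction b)
  case (Suc b)
  have 1: "insert_at (Suc b) h g = (insert_at b h g)(b := g b, Suc b := h)"
    by (auto simp: insert_at_def fun_eq_iff)
  have 2: "insert_at b h g = (insert_at b h g)(b := h, Suc b := g b)"
    by (auto simp: insert_at_def fun_eq_iff)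
  have "\<phi> (insert_at (Suc b) h g) = - \<phi> (insert_at b h g)"
    by (subst 1, subst (2) 2, rule alternating_multilinear_swap[OF \<phi>]) (use Suc in auto)
  with Suc show ?case by simp
qed simp

text \<open>The sign argument shared by two cancellations: that of the second derivatives in a
  pull-back, and that of the faces of codimension two in the boundary of a boundary.\<close>

lemma sum_antisymmetric_eq_0:
  fixes A :: "nat \<Rightarrow> nat \<Rightarrow> real"
  assumes "\<And>i j. i < n \<Longrightarrow> j < n \<Longrightarrow> i < j \<Longrightarrow> A i j = - A j i"
  shows "(\<Sum>i<n. \<Sum>j\<in>{..<n} - {i}. A i j) = 0"
proof -
  define B where "B i j = (if i = j then 0 else A i j)" for i j
  have anti: "B i j = - B j i" if "i < n" "j < n" for i j
    using assms[of i j] assms[of j i] that by (cases i j rule: linorder_cases) (auto simp: B_def)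
  have "(\<Sum>i<n. \<Sum>j\<in>{..<n} - {i}. A i j) = (\<Sum>i<n. \<Sum>j<n. B i j)"
    by (intro sum.cong sum.mono_neutral_cong_left) (auto simp: B_def)
  moreover have "(\<Sum>i<n. \<Sum>j<n. B i j) = (\<Sum>i<n. \<Sum>j<n. - B j i)"
    by (intro sum.cong anti) auto
  moreover have "\<dots> = - (\<Sum>i<n. \<Sum>j<n. B i j)"
    by (simp add: sum_negf) (rule sum.swap)
  ultimately show ?thesis by linarith
qed

section \<open>Linear combinations and comass of covectors\<close>

lemma alternating_multilinear_add:
  assumes "alternating_multilinear m \<phi>" "alternating_multilinear m \<psi>"
  shows "alternating_multilinear m (\<lambda>v. \<phi> v + \<psi> v)"
proof -
  have "linear (\<lambda>w. \<phi> (v(i := w)) + \<psi> (v(i := w)))" if "i < m" for v i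
    using alternating_multilinear_linear[OF assms(1) that] alternating_multilinear_linear[OF assms(2) that]
    by (rule linear_compose_add)
  moreover have "\<phi> v + \<psi> v = \<phi> w + \<psi> w" if "\<forall>i<m. v i = w i" for v w
    using assms[THEN alternating_multilinear_cong, of v w] that by simp
  moreover have "\<phi> v + \<psi> v = 0" if "i < j \<and> j < m \<and> v i = v j" for v i j
    using assms[THEN alternating_multilinear_equal_slots, of i j v] that by auto
  ultimately show ?thesis unfolding alternating_multilinear_def by blast
qed

lemma alternating_multilinear_scale:
  assumes "alternating_multilinear m \<phi>"
  shows "alternating_multilinear m (\<lambda>v. c * \<phi> v)"
proof -
  have "linear (\<lambda>w. c * \<phi> (v(i := w)))" if "i < m" for v i
    using alternating_multilinear_linear[OF assms that]
    by (auto simp: linear_iff algebra_simps)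
  moreover have "c * \<phi> v = c * \<phi> w" if "\<forall>i<m. v i = w i" for v w
    using assms[THEN alternating_multilinear_cong, of v w] that by simp
  moreover have "c * \<phi> v = 0" if "i < j \<and> j < m \<and> v i = v j" for v i j
    using assms[THEN alternating_multilinear_equal_slots, of i j v] that by auto
  ultimately show ?thesis unfolding alternating_multilinear_def by blast
qed

lemma abs_le_comass:
  assumes "\<And>i j. i < m \<Longrightarrow> j < m \<Longrightarrow> v i \<bullet> v j = (if i = j then 1 else 0)" "comass m \<phi> \<le> 1"
  shows "\<bar>\<phi> v\<bar> \<le> 1"
proof -
  have "ennreal \<bar>\<phi> v\<bar> \<le> comass m \<phi>"
    unfolding comass_def by (rule SUP_upper) (use assms in auto)
  also have "\<dots> \<le> 1" by fact
  finally show ?thesis by (simp flip: ennreal_1)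
qed

text \<open>A basis tuple with distinct entries is an orthonormal frame, so the comass controls its
  coefficient; a tuple with a repetition has coefficient zero. Hence all coefficients are at most 1
  in absolute value.\<close>

lemma alternating_multilinear_comass_bound:
  fixes \<phi> :: "'a::euclidean_space covector"
  assumes \<phi>: "alternating_multilinear m \<phi>" "comass m \<phi> \<le> 1"
  shows "\<bar>\<phi> v\<bar> \<le> real (DIM('a)) ^ m * (\<Prod>i<m. norm (v i))"
proof -
  have "\<bar>\<phi> I\<bar> \<le> 1" if I: "I \<in> basis_tuples m" for I
  proof (cases "\<exists>i j. i < m \<and> j < m \<and> i \<noteq> j \<and> I i = I j")
    case True
    then show ?thesis
      using alternating_multilinear_equal_slots[OF \<phi>(1), of _ _ I] by force
  next
    case False
    show ?thesis
    proof (rule abs_le_comass[OF _ \<phi>(2)])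
      fix i j assume "i < m" "j < m"
      then have "I i \<in> Basis" "I j \<in> Basis" "I i = I j \<longrightarrow> i = j"
        using I False by auto
      then show "I i \<bullet> I j = (if i = j then 1 else 0)"
        by (auto simp: inner_Basis)
    qed
  qed
  from alternating_multilinear_bound[OF \<phi>(1) this] show ?thesis by simp
qed

section \<open>Smooth forms\<close>

lemma smooth_differentiable: "smooth f \<Longrightarrow> f differentiable (at x)"
  unfolding smooth_def by (drule spec[of _ "[]"]) simp

lemma iterated_deriv_append: "iterated_deriv (vs @ ws) f = iterated_deriv vs (iterated_deriv ws f)"
  by (induction vs) auto

lemma smooth_frechet_derivative:
  "smooth f \<Longrightarrow> smooth (\<lambda>x. frechet_derivative f (at x) v)"
proof -
  have "iterated_deriv vs (\<lambda>x. frechet_derivative f (at x) v) = iterated_deriv (vs @ [v]) f" for vs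
    by (simp add: iterated_deriv_append)
  then show "smooth f \<Longrightarrow> smooth (\<lambda>x. frechet_derivative f (at x) v)"
    by (simp add: smooth_def)
qed

lemma smooth_continuous_on: "smooth f \<Longrightarrow> continuous_on S f"
  by (meson continuous_at_imp_continuous_on differentiable_imp_continuous_within smooth_differentiable)

definition smooth_form :: "nat \<Rightarrow> 'a::euclidean_space form \<Rightarrow> bool" where
  "smooth_form m \<omega> \<longleftrightarrow> (\<forall>x. alternating_multilinear m (\<omega> x)) \<and> (\<forall>v. smooth (\<lambda>x. \<omega> x v))"

lemma smooth_form_if_test_form: "\<omega> \<in> test_forms m \<Longrightarrow> smooth_form m \<omega>"
  by (simp add: test_forms_def smooth_form_def)

lemma smooth_formD:
  assumes "smooth_form m \<omega>"
  shows "alternating_multilinear m (\<omega> x)" "smooth (\<lambda>x. \<omega> x v)"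
  using assms by (auto simp: smooth_form_def)

lemma smooth_form_frechet_expansion:
  fixes \<omega> :: "'a::euclidean_space form"
  assumes \<omega>: "smooth_form m \<omega>"
  shows "frechet_derivative (\<lambda>x. \<omega> x v) (at x) d =
    (\<Sum>I\<in>basis_tuples m. (\<Prod>i<m. v i \<bullet> I i) * frechet_derivative (\<lambda>x. \<omega> x I) (at x) d)"
proof -
  have "((\<lambda>x. \<Sum>I\<in>basis_tuples m. (\<Prod>i<m. v i \<bullet> I i) * \<omega> x I) has_derivative
     (\<lambda>d. \<Sum>I\<in>basis_tuples m. (\<Prod>i<m. v i \<bullet> I i) * frechet_derivative (\<lambda>x. \<omega> x I) (at x) d)) (at x)"
    by (intro has_derivative_sum has_derivative_mult_right)
       (use smooth_differentiable[OF smooth_formD(2)[OF \<omega>]] frechet_derivative_works in blast)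
  also have "(\<lambda>x. \<Sum>I\<in>basis_tuples m. (\<Prod>i<m. v i \<bullet> I i) * \<omega> x I) = (\<lambda>x. \<omega> x v)"
    by (rule ext, rule alternating_multilinear_expansion[OF smooth_formD(1)[OF \<omega>], symmetric])
  finally show ?thesis
    by (rule frechet_derivative_at[THEN fun_cong, symmetric])
qed

text \<open>In the basis expansion this is the ordinary product rule. The terms in which the
  coefficients of \<open>w l\<close> are differentiated reassemble to the form with slot
  \<open>l\<close> replaced by \<open>w' l\<close>.\<close>

lemma smooth_form_along_curve:
  fixes \<omega> :: "'a::euclidean_space form" and x :: "real \<Rightarrow> 'a"
  assumes \<omega>: "smooth_form m \<omega>"
    and x: "(x has_vector_derivative x') (at t)"
    and w: "\<And>l. l < m \<Longrightarrow> (w l has_vector_derivative w' l) (at t)"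
  shows "((\<lambda>s. \<omega> (x s) (\<lambda>l. w l s)) has_real_derivative
      frechet_derivative (\<lambda>z. \<omega> z (\<lambda>l. w l t)) (at (x t)) x' +
      (\<Sum>l<m. \<omega> (x t) ((\<lambda>l. w l t)(l := w' l)))) (at t)"
proof -
  let ?D = "\<lambda>I. frechet_derivative (\<lambda>z. \<omega> z I) (at (x t)) x'"
  have coeff: "((\<lambda>s. \<omega> (x s) I) has_real_derivative ?D I) (at t)" for I
  proof -
    have lin: "linear (frechet_derivative (\<lambda>z. \<omega> z I) (at (x t)))"
      using smooth_differentiable[OF smooth_formD(2)[OF \<omega>]] by (rule linear_frechet_derivative)
    have "((\<lambda>s. \<omega> (x s) I) has_derivative
        (\<lambda>h. frechet_derivative (\<lambda>z. \<omega> z I) (at (x t)) (h *\<^sub>R x'))) (at t)"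
      by (rule has_derivative_compose[OF x[unfolded has_vector_derivative_def]])
         (use smooth_differentiable[OF smooth_formD(2)[OF \<omega>]] frechet_derivative_works in blast)
    then show ?thesis
      by (simp add: linear_cmul[OF lin] has_field_derivative_def mult.commute[of _ "?D I"])
  qed
  have inner: "((\<lambda>s. w l s \<bullet> b) has_real_derivative w' l \<bullet> b) (at t)" if "l < m" for l b
    using bounded_linear.has_vector_derivative[OF bounded_linear_inner_left w[OF that], of b]
    by (simp add: has_real_derivative_iff_has_vector_derivative)
  have "((\<lambda>s. \<Sum>I\<in>basis_tuples m. (\<Prod>i<m. w i s \<bullet> I i) * \<omega> (x s) I) has_real_derivative
      (\<Sum>I\<in>basis_tuples m. (\<Prod>i<m. w i t \<bullet> I i) * ?D I +
         (\<Sum>l<m. (w' l \<bullet> I l) * (\<Prod>i\<in>{..<m} - {l}. w i t \<bullet> I i)) * \<omega> (x t) I)) (at t)"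
    by (intro DERIV_sum DERIV_mult' has_field_derivative_prod coeff inner) auto
  also have "(\<lambda>s. \<Sum>I\<in>basis_tuples m. (\<Prod>i<m. w i s \<bullet> I i) * \<omega> (x s) I) = (\<lambda>s. \<omega> (x s) (\<lambda>l. w l s))"
    by (rule ext, rule alternating_multilinear_expansion[OF smooth_formD(1)[OF \<omega>], symmetric])
  also have "(\<Sum>I\<in>basis_tuples m. (\<Prod>i<m. w i t \<bullet> I i) * ?D I +
         (\<Sum>l<m. (w' l \<bullet> I l) * (\<Prod>i\<in>{..<m} - {l}. w i t \<bullet> I i)) * \<omega> (x t) I) =
     (\<Sum>I\<in>basis_tuples m. (\<Prod>i<m. w i t \<bullet> I i) * ?D I) +
     (\<Sum>l<m. \<Sum>I\<in>basis_tuples m. (w' l \<bullet> I l) * (\<Prod>i\<in>{..<m} - {l}. w i t \<bullet> I i) * \<omega> (x t) I)"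
    unfolding sum.distrib sum_distrib_right by (subst sum.swap) simp
  also have "(\<Sum>I\<in>basis_tuples m. (\<Prod>i<m. w i t \<bullet> I i) * ?D I) =
      frechet_derivative (\<lambda>z. \<omega> z (\<lambda>l. w l t)) (at (x t)) x'"
    using smooth_form_frechet_expansion[OF \<omega>, of "\<lambda>l. w l t"] by simp
  also have "(\<Sum>l<m. \<Sum>I\<in>basis_tuples m. (w' l \<bullet> I l) * (\<Prod>i\<in>{..<m} - {l}. w i t \<bullet> I i) * \<omega> (x t) I) =
     (\<Sum>l<m. \<omega> (x t) ((\<lambda>l. w l t)(l := w' l)))"
  proof (intro sum.cong refl)
    fix l assume l: "l \<in> {..<m}"
    have "(\<Prod>i<m. ((\<lambda>l. w l t)(l := w' l)) i \<bullet> I i) =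
        (w' l \<bullet> I l) * (\<Prod>i\<in>{..<m} - {l}. w i t \<bullet> I i)" for I
    proof -
      have "(\<Prod>i\<in>{..<m} - {l}. ((\<lambda>l. w l t)(l := w' l)) i \<bullet> I i) = (\<Prod>i\<in>{..<m} - {l}. w i t \<bullet> I i)"
        by (intro prod.cong) auto
      then show ?thesis using l by (subst prod.remove[of _ l]) simp_all
    qed
    then show "(\<Sum>I\<in>basis_tuples m. (w' l \<bullet> I l) * (\<Prod>i\<in>{..<m} - {l}. w i t \<bullet> I i) * \<omega> (x t) I) =
        \<omega> (x t) ((\<lambda>l. w l t)(l := w' l))"
      by (subst alternating_multilinear_expansion[OF smooth_formD(1)[OF \<omega>]]) (simp only:)
  qed
  finally show ?thesis .
qed

lemma continuous_on_smooth_form: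
  fixes \<omega> :: "'a::euclidean_space form" and f :: "'b::topological_space \<Rightarrow> 'a"
  assumes \<omega>: "smooth_form m \<omega>" and f: "continuous_on S f"
    and w: "\<And>l. l < m \<Longrightarrow> continuous_on S (w l)"
  shows "continuous_on S (\<lambda>y. \<omega> (f y) (\<lambda>l. w l y))"
proof -
  have "continuous_on S (\<lambda>y. \<Sum>I\<in>basis_tuples m. (\<Prod>i<m. w i y \<bullet> I i) * \<omega> (f y) I)"
    by (intro continuous_intros w f continuous_on_compose2[OF smooth_continuous_on[OF smooth_formD(2)[OF \<omega>]] f])
       auto
  then show ?thesis
    by (subst alternating_multilinear_expansion[OF smooth_formD(1)[OF \<omega>]]) simp
qed

text \<open>Expanding the direction \<open>d y\<close> as well as the arguments leaves only partial
  derivatives of coefficients, which are again smooth.\<close>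

lemma continuous_on_smooth_form_frechet:
  fixes \<omega> :: "'a::euclidean_space form" and f :: "'b::topological_space \<Rightarrow> 'a"
  assumes \<omega>: "smooth_form m \<omega>" and f: "continuous_on S f"
    and w: "\<And>l. l < m \<Longrightarrow> continuous_on S (w l)" and d: "continuous_on S d"
  shows "continuous_on S (\<lambda>y. frechet_derivative (\<lambda>x. \<omega> x (\<lambda>l. w l y)) (at (f y)) (d y))"
proof -
  have lin: "linear (frechet_derivative (\<lambda>z. \<omega> z I) (at x))" for I x
    using smooth_differentiable[OF smooth_formD(2)[OF \<omega>]] by (rule linear_frechet_derivative)
  have "frechet_derivative (\<lambda>z. \<omega> z I) (at (f y)) (d y) =
      (\<Sum>b\<in>Basis. (d y \<bullet> b) * frechet_derivative (\<lambda>z. \<omega> z I) (at (f y)) b)" for I y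
    by (subst euclidean_representation[of "d y", symmetric])
       (simp only: linear_sum[OF lin] linear_cmul[OF lin] real_scaleR_def)
  then have eq: "frechet_derivative (\<lambda>x. \<omega> x (\<lambda>l. w l y)) (at (f y)) (d y) =
      (\<Sum>I\<in>basis_tuples m. (\<Prod>i<m. w i y \<bullet> I i) *
         (\<Sum>b\<in>Basis. (d y \<bullet> b) * frechet_derivative (\<lambda>z. \<omega> z I) (at (f y)) b))" for y
    by (simp add: smooth_form_frechet_expansion[OF \<omega>, of "\<lambda>l. w l y"])
  show ?thesis
    unfolding eq
    by (intro continuous_intros w f d
        continuous_on_compose2[OF smooth_continuous_on[OF smooth_frechet_derivative[OF smooth_formD(2)[OF \<omega>]]] f])
       auto
qed

section \<open>Twice continuously differentiable maps of finitely many coordinates\<close>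

text \<open>The domain consists of sequences with the product topology, which no norm induces.
  Continuity therefore refers to that topology and differentiability to one coordinate at a time.
  The derivatives are named explicitly, and the symmetry of the second ones is part of the
  definition.\<close>

definition C2_map :: "nat \<Rightarrow> ((nat \<Rightarrow> real) \<Rightarrow> 'a::euclidean_space) \<Rightarrow> (nat \<Rightarrow> (nat \<Rightarrow> real) \<Rightarrow> 'a) \<Rightarrow>
    (nat \<Rightarrow> nat \<Rightarrow> (nat \<Rightarrow> real) \<Rightarrow> 'a) \<Rightarrow> bool" where
  "C2_map m f f1 f2 \<longleftrightarrow> continuous_on UNIV f \<and>
    (\<forall>i<m. continuous_on UNIV (f1 i) \<and>
      (\<forall>y. ((\<lambda>t. f (y(i := t))) has_vector_derivative f1 i y) (at (y i))) \<and>
      (\<forall>j<m. continuous_on UNIV (f2 i j) \<and> f2 i j = f2 j i \<and>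
        (\<forall>y. ((\<lambda>t. f1 i (y(j := t))) has_vector_derivative f2 i j y) (at (y j)))))"

lemma continuous_on_insert_at: "continuous_on UNIV (insert_at j c)"
proof (rule continuous_on_coordinatewise_then_product)
  fix i
  consider "i < j" | "i = j" | "i > j" by linarith
  then show "continuous_on UNIV (\<lambda>z. insert_at j c z i)"
    by cases (auto simp: insert_at_def)
qed

text \<open>Allows Stokes' theorem to be applied to the faces of a cube, and again to the faces of
  those.\<close>

lemma C2_map_face:
  assumes f: "C2_map (Suc m) f f1 f2"
  shows "C2_map m (\<lambda>z. f (insert_at j c z)) (\<lambda>i z. f1 (skip j i) (insert_at j c z))
           (\<lambda>i i' z. f2 (skip j i) (skip j i') (insert_at j c z))"
proof -
  have upd: "(insert_at j c z)(skip j i := t) = insert_at j c (z(i := t))" for z i t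
    by (simp add: insert_at_upd)
  have cont: "continuous_on UNIV (\<lambda>z. g (insert_at j c z))" if "continuous_on UNIV g"
    for g :: "_ \<Rightarrow> 'a"
    using continuous_on_compose2[OF that continuous_on_insert_at] by simp
  show ?thesis
    unfolding C2_map_def
  proof (intro conjI allI impI)
    fix i z assume i: "i < m"
    show "((\<lambda>t. f (insert_at j c (z(i := t)))) has_vector_derivative f1 (skip j i) (insert_at j c z)) (at (z i))"
    proof -
      have "((\<lambda>t. f ((insert_at j c z)(skip j i := t))) has_vector_derivative f1 (skip j i) (insert_at j c z))
          (at (insert_at j c z (skip j i)))"
        using f skip_less[OF i, of j] unfolding C2_map_def by blast
      then show ?thesis by (simp only: upd insert_at_skip)
    qed
    fix i' assume i': "i' < m"
    show "((\<lambda>t. f1 (skip j i) (insert_at j c (z(i' := t)))) has_vector_derivative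
        f2 (skip j i) (skip j i') (insert_at j c z)) (at (z i'))"
    proof -
      have "((\<lambda>t. f1 (skip j i) ((insert_at j c z)(skip j i' := t))) has_vector_derivative
          f2 (skip j i) (skip j i') (insert_at j c z)) (at (insert_at j c z (skip j i')))"
        using f skip_less[OF i, of j] skip_less[OF i', of j] unfolding C2_map_def by blast
      then show ?thesis by (simp only: upd insert_at_skip)
    qed
  next
    show "continuous_on UNIV (\<lambda>z. f (insert_at j c z))"
      using f by (intro cont) (simp add: C2_map_def)
  next
    fix i assume i: "i < m"
    show "continuous_on UNIV (\<lambda>z. f1 (skip j i) (insert_at j c z))"
      using f skip_less[OF i, of j] by (intro cont) (simp add: C2_map_def)
    fix i' assume i': "i' < m"
    show "continuous_on UNIV (\<lambda>z. f2 (skip j i) (skip j i') (insert_at j c z))"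
      using f skip_less[OF i, of j] skip_less[OF i', of j] by (intro cont) (simp add: C2_map_def)
    have "f2 (skip j i) (skip j i') = f2 (skip j i') (skip j i)"
      using f skip_less[OF i, of j] skip_less[OF i', of j] unfolding C2_map_def by blast
    then show "(\<lambda>z. f2 (skip j i) (skip j i') (insert_at j c z)) =
        (\<lambda>z. f2 (skip j i') (skip j i) (insert_at j c z))" by simp
  qed
qed

lemma C2_map_partial_deriv:
  "C2_map m f f1 f2 \<Longrightarrow> i < m \<Longrightarrow> partial_deriv f y i = f1 i y"
  unfolding C2_map_def partial_deriv_def by (blast intro: vector_derivative_at)

text \<open>The terms of the pull-back of \<open>d\<eta>\<close> that contain second derivatives of \<open>f\<close> cancel in
  pairs, because these derivatives are symmetric and \<open>\<eta>\<close> is alternating.\<close>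

lemma ext_deriv_pullback:
  assumes \<eta>: "smooth_form k \<eta>" and f: "C2_map (Suc k) f f1 f2"
  shows "ext_deriv k \<eta> (f y) (\<lambda>i. f1 i y) = (\<Sum>j<Suc k. (-1) ^ j *
      (frechet_derivative (\<lambda>x. \<eta> x (\<lambda>l. f1 (skip j l) y)) (at (f y)) (f1 j y) +
       (\<Sum>l<k. \<eta> (f y) ((\<lambda>l. f1 (skip j l) y)(l := f2 (skip j l) j y)))))"
proof -
  \<comment> \<open>\<open>T j p\<close> is the term in which the derivative in direction
    \<open>j\<close> falls on the argument belonging to direction \<open>p\<close>.\<close>
  define T where "T j p = \<eta> (f y) (\<lambda>l. if skip j l = p then f2 p j y else f1 (skip j l) y)" for j p
  have T: "\<eta> (f y) ((\<lambda>l. f1 (skip j l) y)(l := f2 (skip j l) j y)) = T j (skip j l)" for j l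
  proof -
    have "(skip j l' = skip j l) = (l' = l)" for l' by (auto simp: skip_def)
    then show ?thesis unfolding T_def by (intro arg_cong[where f = "\<eta> (f y)"]) auto
  qed
  have "(\<Sum>j<Suc k. (-1) ^ j * (\<Sum>l<k. T j (skip j l))) =
      (\<Sum>j<Suc k. \<Sum>p\<in>{..<Suc k} - {j}. (-1) ^ j * T j p)"
    unfolding sum_distrib_left
    by (intro sum.cong refl sum.reindex_bij_betw[OF bij_betw_skip]) simp
  also have "\<dots> = 0"
  proof (rule sum_antisymmetric_eq_0)
    fix j p assume jp: "j < Suc k" "p < Suc k" "j < p"
    define g where "g l = f1 (skip p (skip j l)) y" for l
    define h where "h = f2 j p y"
    have h: "f2 p j y = h"
      using f jp unfolding C2_map_def h_def by metis
    have am: "alternating_multilinear k (\<eta> (f y))" using \<eta> by (rule smooth_formD)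
    \<comment> \<open>In the list that omits \<open>j < p\<close>, direction \<open>p\<close>
      occupies slot \<open>p - 1\<close>, whereas in the list that omits \<open>p\<close>, direction
      \<open>j\<close> occupies slot \<open>j\<close>. This shift by one produces the opposite
      signs.\<close>
    have 1: "(\<lambda>l. if skip j l = p then f2 p j y else f1 (skip j l) y) = insert_at (p - 1) h g"
      using jp(3) by (auto simp: fun_eq_iff insert_at_def skip_def h g_def)
    have 2: "(\<lambda>l. if skip p l = j then f2 j p y else f1 (skip p l) y) = insert_at j h g"
      using jp(3) by (auto simp: fun_eq_iff insert_at_def skip_def h_def g_def)
    have "T j p = (-1) ^ (p - 1) * \<eta> (f y) (insert_at 0 h g)"
      unfolding T_def 1 by (rule alternating_multilinear_insert_at[OF am]) (use jp in auto)
    moreover have "T p j = (-1) ^ j * \<eta> (f y) (insert_at 0 h g)"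
      unfolding T_def 2 by (rule alternating_multilinear_insert_at[OF am]) (use jp in auto)
    moreover have "(-1 :: real) ^ p = - ((-1) ^ (p - 1))"
      using jp(3) by (cases p) auto
    ultimately show "(-1) ^ j * T j p = - ((-1) ^ p * T p j)" by simp
  qed
  finally have zero: "(\<Sum>j<Suc k. (-1) ^ j * (\<Sum>l<k. T j (skip j l))) = 0" .
  have "ext_deriv k \<eta> (f y) (\<lambda>i. f1 i y) =
      (\<Sum>j<Suc k. (-1) ^ j * frechet_derivative (\<lambda>x. \<eta> x (\<lambda>l. f1 (skip j l) y)) (at (f y)) (f1 j y))"
    unfolding ext_deriv_def lessThan_Suc_atMost
    by (intro sum.cong refl arg_cong2[where f="(*)"]) (simp add: skip_def if_distrib if_distribR)
  with zero show ?thesis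
    by (simp add: T distrib_left sum.distrib)
qed

section \<open>Integration over cubes\<close>

abbreviation lborel_pow :: "nat \<Rightarrow> (nat \<Rightarrow> real) measure" where
  "lborel_pow m \<equiv> PiM {..<m} (\<lambda>_. lborel)"

interpretation lborel_factors: product_sigma_finite "\<lambda>_::nat. lborel :: real measure"
  by standard

interpretation lborel_pow: finite_product_sigma_finite "\<lambda>_::nat. lborel :: real measure" "{..<m}" for m
  by standard auto

text \<open>The points of \<open>lborel_pow m\<close> are constantly \<open>undefined\<close> from
  coordinate \<open>m\<close> on, so all coordinates are measurable, and with them the inclusion
  into the space of all sequences with its Borel sets.\<close>

lemma borel_measurable_continuous_lborel_pow:
  fixes g :: "(nat \<Rightarrow> real) \<Rightarrow> 'b::topological_space"
  assumes "continuous_on UNIV g"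
  shows "g \<in> borel_measurable (lborel_pow m)"
proof -
  have "(\<lambda>y :: nat \<Rightarrow> real. y) \<in> borel_measurable (lborel_pow m)"
  proof (rule measurable_coordinatewise_then_product)
    fix i
    show "(\<lambda>y :: nat \<Rightarrow> real. y i) \<in> borel_measurable (lborel_pow m)"
    proof (cases "i < m")
      case True
      have "(\<lambda>y :: nat \<Rightarrow> real. y i) \<in> measurable (lborel_pow m) lborel"
        using True by (intro measurable_component_singleton) auto
      then show ?thesis by simp
    next
      case False
      have "(\<lambda>y :: nat \<Rightarrow> real. undefined :: real) \<in> borel_measurable (lborel_pow m)"
        by simp
      then show ?thesis
        by (rule measurable_cong[THEN iffD1, rotated])
           (use False in \<open>auto simp: space_PiM PiE_def extensional_def\<close>)
    qed
  qed
  from measurable_compose[OF this borel_measurable_continuous_onI[OF assms]] show ?thesis .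
qed

lemma sets_lborel_pow_PiE [measurable]:
  "(\<And>i. i < m \<Longrightarrow> A i \<in> sets borel) \<Longrightarrow> Pi\<^sub>E {..<m} A \<in> sets (lborel_pow m)"
  by (intro sets_PiM_I_finite) auto

lemma open_cube_sets [measurable, simp]: "open_cube m \<in> sets (lborel_pow m)"
  unfolding open_cube_def by measurable

lemma emeasure_open_cube: "emeasure (lborel_pow m) (open_cube m) = 1"
  unfolding open_cube_def by (subst lborel_pow.measure_times) auto

text \<open>Tychonoff's theorem: over all indices the box is a product of intervals and of
  singletons \<open>{undefined}\<close>.\<close>

lemma compact_box: "compact ({..<m} \<rightarrow>\<^sub>E {a..b :: real})"
proof -
  have "{..<m} \<rightarrow>\<^sub>E {a..b} = Pi\<^sub>E UNIV (\<lambda>i. if i < m then {a..b} else {undefined})"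
    by (auto simp: PiE_def extensional_def Pi_def split: if_splits)
  moreover have "compactin (product_topology (\<lambda>_. euclidean) UNIV)
      (Pi\<^sub>E UNIV (\<lambda>i. if i < m then {a..b} else {undefined :: real}))"
    unfolding compactin_PiE by auto
  ultimately show ?thesis
    by (simp add: euclidean_product_topology)
qed

lemma continuous_bounded_box:
  fixes g :: "(nat \<Rightarrow> real) \<Rightarrow> 'b::real_normed_vector"
  assumes "continuous_on UNIV g"
  obtains B where "0 < B" "\<And>y. y \<in> {..<m} \<rightarrow>\<^sub>E {a..b} \<Longrightarrow> norm (g y) \<le> B"
proof -
  have "compact (g ` ({..<m} \<rightarrow>\<^sub>E {a..b}))"
    using assms compact_box by (intro compact_continuous_image continuous_on_subset[OF assms]) auto
  from compact_imp_bounded[OF this] show ?thesis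
    using that unfolding bounded_pos by auto
qed

lemma open_cube_subset_box: "open_cube m \<subseteq> {..<m} \<rightarrow>\<^sub>E {0..1}"
  unfolding open_cube_def by (intro PiE_mono) auto

lemma emeasure_box_finite:
  assumes "S \<subseteq> {..<m} \<rightarrow>\<^sub>E {a..b}"
  shows "emeasure (lborel_pow m) S < \<infinity>"
proof -
  have "emeasure (lborel_pow m) S \<le> emeasure (lborel_pow m) ({..<m} \<rightarrow>\<^sub>E {a..b})"
    using assms by (intro emeasure_mono) auto
  also have "\<dots> < \<infinity>"
    by (cases "a \<le> b") (simp_all add: lborel_pow.measure_times power_less_top_ennreal)
  finally show ?thesis .
qed

lemma set_integrable_continuous_box:
  fixes g :: "(nat \<Rightarrow> real) \<Rightarrow> real"
  assumes g: "continuous_on UNIV g" and S: "S \<in> sets (lborel_pow m)" "S \<subseteq> {..<m} \<rightarrow>\<^sub>E {a..b}"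
  shows "set_integrable (lborel_pow m) S g"
proof -
  obtain B where B: "\<And>y. y \<in> {..<m} \<rightarrow>\<^sub>E {a..b} \<Longrightarrow> norm (g y) \<le> B"
    using continuous_bounded_box[OF g] by blast
  show ?thesis
    unfolding set_integrable_def
    by (rule integrableI_bounded_set_indicator[OF S(1) borel_measurable_continuous_lborel_pow[OF g]
          emeasure_box_finite[OF S(2)], of B])
       (use B S in auto)
qed

lemmas set_integrable_open_cube = set_integrable_continuous_box[OF _ open_cube_sets open_cube_subset_box]

lemma abs_cube_integral_le:
  fixes g :: "(nat \<Rightarrow> real) \<Rightarrow> real"
  assumes g: "continuous_on UNIV g" and B: "\<And>y. y \<in> open_cube m \<Longrightarrow> \<bar>g y\<bar> \<le> B"
  shows "\<bar>LINT y:open_cube m|lborel_pow m. g y\<bar> \<le> B"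
proof -
  have "norm (LINT y:open_cube m|lborel_pow m. g y) \<le> (LINT y:open_cube m|lborel_pow m. norm (g y))"
    using set_integrable_open_cube[OF g]
    unfolding set_lebesgue_integral_def set_integrable_def
    by (intro order_trans[OF integral_norm_bound]) (simp add: abs_mult)
  also have "\<dots> \<le> (LINT y:open_cube m|lborel_pow m. B)"
    using B by (intro set_integral_mono set_integrable_open_cube continuous_intros g) auto
  also have "\<dots> = B"
    by (simp add: set_lebesgue_integral_def measure_def emeasure_open_cube)
  finally show ?thesis by simp
qed

section \<open>Fubini's theorem with respect to a chosen coordinate\<close>

lemma measurable_insert_at:
  "j \<le> m \<Longrightarrow> (\<lambda>(z, t). insert_at j t z) \<in> measurable (lborel_pow m \<Otimes>\<^sub>M lborel) (lborel_pow (Suc m))"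
proof (rule measurable_PiM_single')
  assume j: "j \<le> m"
  have comp: "(\<lambda>x. fst x l) \<in> measurable (lborel_pow m \<Otimes>\<^sub>M lborel) lborel" if "l < m" for l
    using that by (intro measurable_compose[OF measurable_fst measurable_component_singleton]) auto
  fix i assume i: "i \<in> {..<Suc m}"
  consider "i < j" | "i = j" | "i > j" by linarith
  then show "(\<lambda>x. (case x of (z, t) \<Rightarrow> insert_at j t z) i) \<in> measurable (lborel_pow m \<Otimes>\<^sub>M lborel) lborel"
  proof cases
    case 1
    then show ?thesis using comp[of i] j i by (simp add: insert_at_def case_prod_unfold)
  next
    case 2
    then show ?thesis by (simp add: insert_at_def case_prod_unfold)
  next
    case 3
    then show ?thesis using comp[of "i - 1"] j i by (simp add: insert_at_def case_prod_unfold)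
  qed
next
  assume "j \<le> m"
  then show "(\<lambda>(z, t). insert_at j t z) \<in> space (lborel_pow m \<Otimes>\<^sub>M lborel) \<rightarrow> {..<Suc m} \<rightarrow>\<^sub>E space lborel"
    by (auto simp: space_pair_measure space_PiM PiE_def extensional_def insert_at_def)
qed

lemma insert_at_in_PiE_iff:
  assumes "j \<le> m"
  shows "insert_at j t z \<in> Pi\<^sub>E {..<Suc m} A \<longleftrightarrow> t \<in> A j \<and> z \<in> Pi\<^sub>E {..<m} (\<lambda>i. A (skip j i))"
proof -
  have "(\<forall>i<Suc m. insert_at j t z i \<in> A i) \<longleftrightarrow> t \<in> A j \<and> (\<forall>i<m. z i \<in> A (skip j i))"
  proof -
    have "{..<Suc m} = insert j (skip j ` {..<m})"
      using bij_betw_imp_surj_on[OF bij_betw_skip[OF assms]] assms by auto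
    then have "(\<forall>i\<in>{..<Suc m}. insert_at j t z i \<in> A i) \<longleftrightarrow>
        t \<in> A j \<and> (\<forall>i\<in>{..<m}. insert_at j t z (skip j i) \<in> A (skip j i))"
      by simp
    then show ?thesis by (simp add: Ball_def)
  qed
  moreover have "(\<forall>i\<ge>Suc m. insert_at j t z i = undefined) \<longleftrightarrow> (\<forall>i\<ge>m. z i = undefined)"
  proof -
    have "(\<forall>i\<ge>Suc m. insert_at j t z i = undefined) \<longleftrightarrow> (\<forall>i\<ge>Suc m. z (i - 1) = undefined)"
      using assms by (auto simp: insert_at_def)
    also have "\<dots> \<longleftrightarrow> (\<forall>i\<ge>m. z i = undefined)"
      by (metis Suc_le_mono Suc_le_D diff_Suc_1)
    finally show ?thesis .
  qed
  ultimately show ?thesis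
    by (auto simp: PiE_def Pi_def extensional_def not_less)
qed

text \<open>It suffices to compare boxes, whose preimages are boxes with factors renumbered by
  \<open>skip\<close>. Any coordinate can thus be split off, not just the last, as the pairs of
  opposite faces require.\<close>

lemma distr_insert_at:
  assumes j: "j \<le> m"
  shows "distr (lborel_pow m \<Otimes>\<^sub>M lborel) (lborel_pow (Suc m)) (\<lambda>(z, t). insert_at j t z) = lborel_pow (Suc m)"
proof (rule lborel_factors.PiM_eqI)
  fix A :: "nat \<Rightarrow> real set" assume A: "\<And>i. i \<in> {..<Suc m} \<Longrightarrow> A i \<in> sets lborel"
  have sk: "A (skip j i) \<in> sets borel" if "i < m" for i
    using A[of "skip j i"] skip_less[OF that, of j] by auto
  have "(\<lambda>(z, t). insert_at j t z) -` Pi\<^sub>E {..<Suc m} A \<inter> space (lborel_pow m \<Otimes>\<^sub>M lborel) =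
      Pi\<^sub>E {..<m} (\<lambda>i. A (skip j i)) \<times> A j"
    by (auto simp: insert_at_in_PiE_iff[OF j] space_pair_measure space_PiM)
  then have "emeasure (distr (lborel_pow m \<Otimes>\<^sub>M lborel) (lborel_pow (Suc m)) (\<lambda>(z, t). insert_at j t z)) (Pi\<^sub>E {..<Suc m} A)
      = emeasure (lborel_pow m \<Otimes>\<^sub>M lborel) (Pi\<^sub>E {..<m} (\<lambda>i. A (skip j i)) \<times> A j)"
    using A by (subst emeasure_distr[OF measurable_insert_at[OF j]]) auto
  also have "\<dots> = emeasure (lborel_pow m) (Pi\<^sub>E {..<m} (\<lambda>i. A (skip j i))) * emeasure lborel (A j)"
    using j A[of j] sk by (intro lborel.emeasure_pair_measure_Times) auto
  also have "\<dots> = (\<Prod>i<m. emeasure lborel (A (skip j i))) * emeasure lborel (A j)"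
    using sk by (subst lborel_pow.measure_times) auto
  also have "(\<Prod>i<m. emeasure lborel (A (skip j i))) = (\<Prod>i\<in>{..<Suc m} - {j}. emeasure lborel (A i))"
    by (rule prod.reindex_bij_betw[OF bij_betw_skip[OF j]])
  also have "\<dots> * emeasure lborel (A j) = (\<Prod>i<Suc m. emeasure lborel (A i))"
    using j by (subst (2) prod.remove[of _ j]) (auto simp: mult.commute)
  finally show "emeasure (distr (lborel_pow m \<Otimes>\<^sub>M lborel) (lborel_pow (Suc m)) (\<lambda>(z, t). insert_at j t z)) (Pi\<^sub>E {..<Suc m} A)
      = (\<Prod>i\<in>{..<Suc m}. emeasure lborel (A i))" .
qed auto

lemma cube_integral_insert_at:
  fixes g :: "(nat \<Rightarrow> real) \<Rightarrow> real"
  assumes j: "j \<le> m" and g: "continuous_on UNIV g"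
  shows "(LINT y:open_cube (Suc m)|lborel_pow (Suc m). g y) =
    (LINT z:open_cube m|lborel_pow m. LINT t:{0<..<1}|lborel. g (insert_at j t z))"
proof -
  interpret pair_sigma_finite "lborel_pow m" lborel by standard
  let ?h = "\<lambda>y. indicator (open_cube (Suc m)) y *\<^sub>R g y"
  have int: "integrable (lborel_pow (Suc m)) ?h"
    using set_integrable_open_cube[OF g] by (simp add: set_integrable_def)
  have eq: "?h (insert_at j t z) = indicator (open_cube m) z *\<^sub>R (indicator {0<..<1} t *\<^sub>R g (insert_at j t z))" for z t
    by (auto simp: open_cube_def insert_at_in_PiE_iff[OF j] indicator_def)
  have "(LINT y:open_cube (Suc m)|lborel_pow (Suc m). g y) =
      (LINT x|(lborel_pow m \<Otimes>\<^sub>M lborel). ?h (case x of (z, t) \<Rightarrow> insert_at j t z))"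
    unfolding set_lebesgue_integral_def
    by (subst distr_insert_at[OF j, symmetric], rule integral_distr[OF measurable_insert_at[OF j]])
       (use int in auto)
  also have "\<dots> = (LINT z|lborel_pow m. LINT t|lborel. ?h (insert_at j t z))"
  proof -
    have "integrable (lborel_pow m \<Otimes>\<^sub>M lborel) (\<lambda>x. ?h (case x of (z, t) \<Rightarrow> insert_at j t z))"
      using integrable_distr[OF measurable_insert_at[OF j], of ?h] int distr_insert_at[OF j] by simp
    from integral_fst'[OF this] show ?thesis by simp
  qed
  finally show ?thesis
    unfolding eq by (simp add: set_lebesgue_integral_def mult.assoc)
qed

text \<open>Fubini's theorem reduces the claim to the fundamental theorem of calculus on the
  segments in direction \<open>j\<close>.\<close>

lemma cube_integral_derivative:
  fixes G G' :: "(nat \<Rightarrow> real) \<Rightarrow> real"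
  assumes j: "j \<le> m" and G: "continuous_on UNIV G" and G': "continuous_on UNIV G'"
    and D: "\<And>y. ((\<lambda>t. G (y(j := t))) has_real_derivative G' y) (at (y j))"
  shows "(LINT y:open_cube (Suc m)|lborel_pow (Suc m). G' y) =
    (LINT z:open_cube m|lborel_pow m. G (insert_at j 1 z)) -
    (LINT z:open_cube m|lborel_pow m. G (insert_at j 0 z))"
proof -
  have ins: "continuous_on UNIV (\<lambda>t. insert_at j t z)" for z :: "nat \<Rightarrow> real"
  proof (rule continuous_on_coordinatewise_then_product)
    fix i
    consider "i < j" | "i = j" | "i > j" by linarith
    then show "continuous_on UNIV (\<lambda>t. insert_at j t z i)"
      by cases (auto simp: insert_at_def)
  qed
  have upd: "(insert_at j s z)(j := t) = insert_at j t z" for s t and z :: "nat \<Rightarrow> real"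
    by (auto simp: insert_at_def)
  have inner: "(LINT t:{0<..<1}|lborel. G' (insert_at j t z)) = G (insert_at j 1 z) - G (insert_at j 0 z)" for z
  proof -
    have "(LBINT t=ereal 0..ereal 1. G' (insert_at j t z)) = G (insert_at j 1 z) - G (insert_at j 0 z)"
    proof (rule interval_integral_FTC_finite)
      show "continuous_on {min 0 1..max 0 1} (\<lambda>t. G' (insert_at j t z))"
        using continuous_on_compose2[OF G' ins] by (auto intro: continuous_on_subset)
      fix t :: real
      have "((\<lambda>s. G (insert_at j s z)) has_vector_derivative G' (insert_at j t z)) (at t)"
        using D[of "insert_at j t z"] by (simp add: upd has_real_derivative_iff_has_vector_derivative)
      then show "((\<lambda>s. G (insert_at j s z)) has_vector_derivative G' (insert_at j t z)) (at t within {min 0 1..max 0 1})"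
        by (rule has_vector_derivative_at_within)
    qed
    then show ?thesis by (simp add: interval_lebesgue_integral_def)
  qed
  have "(LINT y:open_cube (Suc m)|lborel_pow (Suc m). G' y) =
      (LINT z:open_cube m|lborel_pow m. G (insert_at j 1 z) - G (insert_at j 0 z))"
    by (simp add: cube_integral_insert_at[OF j G'] inner)
  also have "\<dots> = (LINT z:open_cube m|lborel_pow m. G (insert_at j 1 z)) -
    (LINT z:open_cube m|lborel_pow m. G (insert_at j 0 z))"
    by (intro set_integral_diff set_integrable_open_cube continuous_on_compose2[OF G continuous_on_insert_at]) auto
  finally show ?thesis .
qed

text \<open>\<open>partial_deriv f\<close> is passed to the form at every index, and nothing is
  known about it from \<open>m\<close> on, so the form has to ignore those entries. Asking for just
  this congruence lets the lemma apply to exterior derivatives and to products with cut-offs, which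
  are not shown to be test forms here.\<close>

lemma param_current_C2:
  assumes f: "C2_map m f f1 f2" and \<omega>: "\<And>x v w. (\<And>i. i < m \<Longrightarrow> v i = w i) \<Longrightarrow> \<omega> x v = \<omega> x w"
  shows "param_current m A f \<omega> = (LINT y:A|lborel_pow m. \<omega> (f y) (\<lambda>i. f1 i y))"
proof -
  have "\<omega> (f y) (partial_deriv f y) = \<omega> (f y) (\<lambda>i. f1 i y)" for y
    by (rule \<omega>) (rule C2_map_partial_deriv[OF f])
  then show ?thesis by (simp add: param_current_def)
qed

section \<open>Stokes' theorem on the cube and on its faces\<close>

lemma smooth_form_cong:
  assumes "smooth_form m \<omega>" "\<And>i. i < m \<Longrightarrow> v i = w i"
  shows "\<omega> x v = \<omega> x w"
  using alternating_multilinear_cong[OF smooth_formD(1)[OF assms(1)] assms(2)] .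

theorem stokes_cube:
  assumes \<eta>: "smooth_form k \<eta>" and f: "C2_map (Suc k) f f1 f2"
  shows "param_current (Suc k) (open_cube (Suc k)) f (ext_deriv k \<eta>) =
    (\<Sum>j<Suc k. (-1) ^ j * (param_current k (open_cube k) (\<lambda>z. f (insert_at j 1 z)) \<eta> -
                           param_current k (open_cube k) (\<lambda>z. f (insert_at j 0 z)) \<eta>))"
proof -
  \<comment> \<open>\<open>G j\<close> is the coefficient of the pulled back form that omits
    direction \<open>j\<close>, and \<open>G' j\<close> its derivative in that direction. The second
    derivatives are kept in \<open>G' j\<close>, because \<open>ext_deriv_pullback\<close> shows
    that they vanish in the alternating sum; each summand is then an exact derivative.\<close>
  define G where "G j y = \<eta> (f y) (\<lambda>l. f1 (skip j l) y)" for j y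
  define G' where "G' j y = frechet_derivative (\<lambda>x. \<eta> x (\<lambda>l. f1 (skip j l) y)) (at (f y)) (f1 j y) +
       (\<Sum>l<k. \<eta> (f y) ((\<lambda>l. f1 (skip j l) y)(l := f2 (skip j l) j y)))" for j y
  have cf: "continuous_on UNIV f" "\<And>i. i < Suc k \<Longrightarrow> continuous_on UNIV (f1 i)"
    "\<And>i j. i < Suc k \<Longrightarrow> j < Suc k \<Longrightarrow> continuous_on UNIV (f2 i j)"
    using f by (auto simp: C2_map_def)
  have contG: "continuous_on UNIV (G j)" for j
    unfolding G_def by (intro continuous_on_smooth_form[OF \<eta>] cf skip_less)
  have contG': "continuous_on UNIV (G' j)" if j: "j < Suc k" for j
  proof -
    have "continuous_on UNIV (\<lambda>y. \<eta> (f y) ((\<lambda>l. f1 (skip j l) y)(l := f2 (skip j l) j y)))" if "l < k" for l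
    proof -
      have "continuous_on UNIV (\<lambda>y. \<eta> (f y) (\<lambda>l'. (if l' = l then f2 (skip j l) j else f1 (skip j l')) y))"
        by (intro continuous_on_smooth_form[OF \<eta>] cf) (auto intro!: cf skip_less that j)
      also have "(\<lambda>y. \<eta> (f y) (\<lambda>l'. (if l' = l then f2 (skip j l) j else f1 (skip j l')) y)) =
          (\<lambda>y. \<eta> (f y) ((\<lambda>l. f1 (skip j l) y)(l := f2 (skip j l) j y)))"
        by (intro ext arg_cong2[where f = \<eta>]) auto
      finally show ?thesis .
    qed
    then show ?thesis
      unfolding G'_def
      by (intro continuous_on_add continuous_on_sum continuous_on_smooth_form_frechet[OF \<eta>] cf skip_less j) auto
  qed
  have D: "((\<lambda>t. G j (y(j := t))) has_real_derivative G' j y) (at (y j))" if j: "j < Suc k" for j y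
  proof -
    have "((\<lambda>s. \<eta> (f (y(j := s))) (\<lambda>l. f1 (skip j l) (y(j := s)))) has_real_derivative
      frechet_derivative (\<lambda>z. \<eta> z (\<lambda>l. f1 (skip j l) (y(j := y j)))) (at (f (y(j := y j)))) (f1 j y) +
      (\<Sum>l<k. \<eta> (f (y(j := y j))) ((\<lambda>l. f1 (skip j l) (y(j := y j)))(l := f2 (skip j l) j y)))) (at (y j))"
    proof (rule smooth_form_along_curve[OF \<eta>])
      show "((\<lambda>s. f (y(j := s))) has_vector_derivative f1 j y) (at (y j))"
        using f j unfolding C2_map_def by blast
      fix l assume "l < k"
      then have "skip j l < Suc k" by (rule skip_less)
      then show "((\<lambda>s. f1 (skip j l) (y(j := s))) has_vector_derivative f2 (skip j l) j y) (at (y j))"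
        using f j unfolding C2_map_def by blast
    qed
    then show ?thesis by (simp add: G_def G'_def)
  qed
  have ext_cong: "ext_deriv k \<eta> x v = ext_deriv k \<eta> x w" if "\<And>i. i < Suc k \<Longrightarrow> v i = w i" for x v w
  proof -
    have "(\<lambda>y. \<eta> y (\<lambda>j. if j < i then v j else v (Suc j))) = (\<lambda>y. \<eta> y (\<lambda>j. if j < i then w j else w (Suc j)))" for i
      using that by (intro ext smooth_form_cong[OF \<eta>]) auto
    then show ?thesis
      unfolding ext_deriv_def using that by (intro sum.cong) auto
  qed
  have "param_current (Suc k) (open_cube (Suc k)) f (ext_deriv k \<eta>) =
      (LINT y:open_cube (Suc k)|lborel_pow (Suc k). ext_deriv k \<eta> (f y) (\<lambda>i. f1 i y))"
    by (rule param_current_C2[OF f]) (rule ext_cong)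
  also have "\<dots> = (LINT y:open_cube (Suc k)|lborel_pow (Suc k). (\<Sum>j<Suc k. (-1) ^ j * G' j y))"
    unfolding ext_deriv_pullback[OF \<eta> f] G'_def ..
  also have "\<dots> = (\<Sum>j<Suc k. (-1) ^ j * (LINT y:open_cube (Suc k)|lborel_pow (Suc k). G' j y))"
  proof -
    have int: "integrable (lborel_pow (Suc k)) (\<lambda>y. (-1) ^ j * (indicator (open_cube (Suc k)) y * G' j y))"
      if "j < Suc k" for j
      using set_integrable_open_cube[OF contG'[OF that], of "Suc k"]
      unfolding set_integrable_def by (intro integrable_mult_right) simp
    have "(LINT y:open_cube (Suc k)|lborel_pow (Suc k). (\<Sum>j<Suc k. (-1) ^ j * G' j y)) =
        (LINT y|lborel_pow (Suc k). (\<Sum>j<Suc k. (-1) ^ j * (indicator (open_cube (Suc k)) y * G' j y)))"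
      unfolding set_lebesgue_integral_def real_scaleR_def sum_distrib_left by (simp only: mult.left_commute)
    also have "\<dots> = (\<Sum>j<Suc k. LINT y|lborel_pow (Suc k). (-1) ^ j * (indicator (open_cube (Suc k)) y * G' j y))"
      by (rule Bochner_Integration.integral_sum) (use int in auto)
    finally show ?thesis
      by (simp add: set_lebesgue_integral_def)
  qed
  also have "\<dots> = (\<Sum>j<Suc k. (-1) ^ j * (param_current k (open_cube k) (\<lambda>z. f (insert_at j 1 z)) \<eta> -
                           param_current k (open_cube k) (\<lambda>z. f (insert_at j 0 z)) \<eta>))"
  proof (intro sum.cong refl arg_cong2[where f = "(*)"])
    fix j assume "j \<in> {..<Suc k}"
    then have j: "j < Suc k" by simp
    have face: "param_current k (open_cube k) (\<lambda>z. f (insert_at j c z)) \<eta> =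
        (LINT z:open_cube k|lborel_pow k. G j (insert_at j c z))" for c
      unfolding G_def by (rule param_current_C2[OF C2_map_face[OF f]]) (rule smooth_form_cong[OF \<eta>])
    show "(LINT y:open_cube (Suc k)|lborel_pow (Suc k). G' j y) =
        param_current k (open_cube k) (\<lambda>z. f (insert_at j 1 z)) \<eta> -
        param_current k (open_cube k) (\<lambda>z. f (insert_at j 0 z)) \<eta>"
      unfolding face using j by (intro cube_integral_derivative contG contG' D) auto
  qed
  finally show ?thesis .
qed

definition cube_boundary :: "nat \<Rightarrow> ((nat \<Rightarrow> real) \<Rightarrow> 'a::euclidean_space) \<Rightarrow> 'a current" where
  "cube_boundary m F = (\<lambda>\<omega>. \<Sum>i<Suc m. (-1) ^ i *
     (param_current m (open_cube m) (\<lambda>z. F (insert_at i 1 z)) \<omega> -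
      param_current m (open_cube m) (\<lambda>z. F (insert_at i 0 z)) \<omega>))"

text \<open>After Stokes' theorem on every face, each face of codimension two occurs twice, once for
  each order of fixing its two coordinates, and with opposite signs.\<close>

theorem cube_boundary_ext_deriv:
  assumes \<eta>: "smooth_form k \<eta>" and F: "C2_map (Suc (Suc k)) F F1 F2"
  shows "cube_boundary (Suc k) F (ext_deriv k \<eta>) = 0"
proof -
  define P where "P i a j b = param_current k (open_cube k) (\<lambda>z. F (insert_at i a (insert_at j b z))) \<eta>"
    for i j and a b :: real
  \<comment> \<open>Here \<open>p\<close> numbers the second fixed coordinate within the whole cube;
    within the face where coordinate \<open>i\<close> is fixed its number is \<open>p\<close> or
    \<open>p - 1\<close>.\<close>
  define A where "A i p = (let j = (if p < i then p else p - 1) in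
      (-1) ^ i * ((-1) ^ j * ((P i 1 j 1 - P i 1 j 0) - (P i 0 j 1 - P i 0 j 0))))" for i p
  have st: "param_current (Suc k) (open_cube (Suc k)) (\<lambda>z. F (insert_at i a z)) (ext_deriv k \<eta>) =
      (\<Sum>j<Suc k. (-1) ^ j * (P i a j 1 - P i a j 0))" for i a
    unfolding P_def by (rule stokes_cube[OF \<eta> C2_map_face[OF F]])
  have "cube_boundary (Suc k) F (ext_deriv k \<eta>) = (\<Sum>i<Suc (Suc k). \<Sum>j<Suc k. A i (skip i j))"
    unfolding cube_boundary_def st sum_subtractf[symmetric] sum_distrib_left
    by (intro sum.cong refl) (auto simp: A_def skip_def Let_def algebra_simps)
  also have "\<dots> = (\<Sum>i<Suc (Suc k). \<Sum>p\<in>{..<Suc (Suc k)} - {i}. A i p)"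
    by (intro sum.cong refl sum.reindex_bij_betw[OF bij_betw_skip]) simp
  also have "\<dots> = 0"
  proof (rule sum_antisymmetric_eq_0)
    fix i p :: nat assume ip: "i < p"
    have "P i a (p - 1) b = P p b i a" for a b
      unfolding P_def insert_at_insert_at[OF ip] ..
    moreover have "(-1 :: real) ^ p = - ((-1) ^ (p - 1))"
      using ip by (cases p) auto
    ultimately show "A i p = - A p i"
      using ip unfolding A_def Let_def by (simp add: algebra_simps)
  qed
  finally show ?thesis .
qed

section \<open>The boundary of a cube is an integral current without boundary\<close>

lemma form_zero_outside_support: "x \<notin> form_support \<omega> \<Longrightarrow> \<omega> x = (\<lambda>_. 0)"
  using closure_subset[of "{x. \<omega> x \<noteq> (\<lambda>_. 0)}"] unfolding form_support_def by blast

lemma smooth_add: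
  assumes f: "smooth f" and g: "smooth g"
  shows "smooth (\<lambda>x. f x + g x)"
proof -
  have D: "(iterated_deriv vs h has_derivative frechet_derivative (iterated_deriv vs h) (at x)) (at x)"
    if "smooth h" for vs h x
    using that frechet_derivative_works unfolding smooth_def by blast
  have eq: "iterated_deriv vs (\<lambda>x. f x + g x) = (\<lambda>x. iterated_deriv vs f x + iterated_deriv vs g x)" for vs
  proof (induction vs)
    case (Cons v vs)
    show ?case
    proof
      fix x
      have "((\<lambda>x. iterated_deriv vs f x + iterated_deriv vs g x) has_derivative
          (\<lambda>v. frechet_derivative (iterated_deriv vs f) (at x) v + frechet_derivative (iterated_deriv vs g) (at x) v)) (at x)"
        by (intro has_derivative_add D f g)
      from frechet_derivative_at[OF this, THEN fun_cong, of v]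
      show "iterated_deriv (v # vs) (\<lambda>x. f x + g x) x = iterated_deriv (v # vs) f x + iterated_deriv (v # vs) g x"
        by (simp add: Cons)
    qed
  qed simp
  show ?thesis
    unfolding smooth_def eq
    by (intro allI differentiable_add) (use f g in \<open>auto simp: smooth_def\<close>)
qed

lemma smooth_cmult:
  assumes f: "smooth f"
  shows "smooth (\<lambda>x. c * f x)"
proof -
  have D: "(iterated_deriv vs f has_derivative frechet_derivative (iterated_deriv vs f) (at x)) (at x)" for vs x
    using f frechet_derivative_works unfolding smooth_def by blast
  have eq: "iterated_deriv vs (\<lambda>x. c * f x) = (\<lambda>x. c * iterated_deriv vs f x)" for vs
  proof (induction vs)
    case (Cons v vs)
    show ?case
    proof
      fix x
      have "((\<lambda>x. c * iterated_deriv vs f x) has_derivative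
          (\<lambda>v. c * frechet_derivative (iterated_deriv vs f) (at x) v)) (at x)"
        by (intro has_derivative_mult_right D)
      from frechet_derivative_at[OF this, THEN fun_cong, of v]
      show "iterated_deriv (v # vs) (\<lambda>x. c * f x) x = c * iterated_deriv (v # vs) f x"
        by (simp add: Cons)
    qed
  qed simp
  show ?thesis
    unfolding smooth_def eq
    by (intro allI differentiable_mult differentiable_const) (use f in \<open>auto simp: smooth_def\<close>)
qed

lemma compact_closed_subset: "compact K \<Longrightarrow> closed S \<Longrightarrow> S \<subseteq> K \<Longrightarrow> compact S"
  using compact_Int_closed[of K S] by (simp add: Int_absorb1)

lemma test_forms_add:
  fixes \<omega> \<eta> :: "'a::euclidean_space form"
  assumes "\<omega> \<in> test_forms m" "\<eta> \<in> test_forms m"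
  shows "(\<lambda>x v. \<omega> x v + \<eta> x v) \<in> test_forms m"
proof -
  have "form_support (\<lambda>x v. \<omega> x v + \<eta> x v) \<subseteq> form_support \<omega> \<union> form_support \<eta>"
    unfolding form_support_def
    by (subst closure_Un[symmetric], rule closure_mono) auto
  moreover have "compact (form_support \<omega> \<union> form_support \<eta>)"
    using assms by (auto simp: test_forms_def)
  moreover have "closed (form_support (\<lambda>x v. \<omega> x v + \<eta> x v))"
    by (simp add: form_support_def)
  ultimately have "compact (form_support (\<lambda>x v. \<omega> x v + \<eta> x v))"
    using compact_closed_subset by blast
  then show ?thesis
    using assms by (simp add: test_forms_def smooth_add alternating_multilinear_add)
qed

lemma test_forms_scale:
  fixes \<omega> :: "'a::euclidean_space form"
  assumes "\<omega> \<in> test_forms m"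
  shows "(\<lambda>x v. c * \<omega> x v) \<in> test_forms m"
proof -
  have "form_support (\<lambda>x v. c * \<omega> x v) \<subseteq> form_support \<omega>"
    unfolding form_support_def by (rule closure_mono) auto
  moreover have "closed (form_support (\<lambda>x v. c * \<omega> x v))"
    by (simp add: form_support_def)
  ultimately have "compact (form_support (\<lambda>x v. c * \<omega> x v))"
    using assms compact_closed_subset[of "form_support \<omega>"] by (simp add: test_forms_def)
  then show ?thesis
    using assms by (simp add: test_forms_def smooth_cmult alternating_multilinear_scale)
qed

lemma mass_eq_0: "(\<And>\<omega>. \<omega> \<in> test_forms m \<Longrightarrow> T \<omega> = 0) \<Longrightarrow> mass m T = 0"
proof -
  assume T: "\<And>\<omega>. \<omega> \<in> test_forms m \<Longrightarrow> T \<omega> = 0"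
  have "mass m T \<le> 0"
    unfolding mass_def by (rule SUP_least) (simp add: T)
  then show ?thesis by simp
qed

text \<open>The empty chain is an approximation with error zero. This covers the boundary of a cube
  boundary, whose rectifiability is required of an integral current.\<close>

lemma rectifiable_current_if_zero:
  assumes "\<And>\<omega>. \<omega> \<in> test_forms m \<Longrightarrow> T \<omega> = 0"
  shows "rectifiable_current m T"
proof -
  have "is_current m T"
    unfolding is_current_def by (simp add: assms test_forms_add test_forms_scale)
  moreover have "\<exists>c. (\<forall>(a, f)\<in>set c. lipschitz_cube m f \<and> f ` open_cube m \<subseteq> {}) \<and>
      mass m (\<lambda>\<omega>. T \<omega> - lipschitz_chain m c \<omega>) < \<epsilon>" if "0 < \<epsilon>" for \<epsilon>
    using mass_eq_0[of m "\<lambda>\<omega>. T \<omega> - lipschitz_chain m [] \<omega>"] assms that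
    by (intro exI[of _ "[]"]) (simp add: lipschitz_chain_def)
  ultimately show ?thesis
    unfolding rectifiable_current_def using compact_empty by blast
qed

lemma continuous_on_C2_pullback:
  assumes "C2_map m f f1 f2" "smooth_form m \<omega>"
  shows "continuous_on UNIV (\<lambda>y. \<omega> (f y) (\<lambda>i. f1 i y))"
  by (rule continuous_on_smooth_form[OF assms(2)]) (use assms(1) in \<open>simp_all add: C2_map_def\<close>)

section \<open>Parametrized cubes as currents\<close>

definition null_sequence :: "nat \<Rightarrow> (nat \<Rightarrow> 'a::euclidean_space form) \<Rightarrow> bool" where
  "null_sequence m \<omega> \<longleftrightarrow> (\<exists>K. (\<forall>n. \<omega> n \<in> test_forms m) \<and> compact K \<and>
     (\<forall>n. form_support (\<omega> n) \<subseteq> K) \<and>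
     (\<forall>vs v. uniform_limit UNIV (\<lambda>n. iterated_deriv vs (\<lambda>y. \<omega> n y v)) (\<lambda>_. 0) sequentially))"

lemma is_current_iff:
  "is_current m T \<longleftrightarrow>
     (\<forall>\<omega>\<in>test_forms m. \<forall>\<eta>\<in>test_forms m. T (\<lambda>x v. \<omega> x v + \<eta> x v) = T \<omega> + T \<eta>) \<and>
     (\<forall>c. \<forall>\<omega>\<in>test_forms m. T (\<lambda>x v. c * \<omega> x v) = c * T \<omega>) \<and>
     (\<forall>\<omega>. null_sequence m \<omega> \<longrightarrow> (\<lambda>n. T (\<omega> n)) \<longlonglongrightarrow> 0)"
  unfolding is_current_def null_sequence_def imp_ex
  by (rule refl)

text \<open>For continuity, uniform convergence of the finitely many basis coefficients is enough,
  because the tangent vectors are bounded on the closed cube.\<close>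

lemma is_current_param_current:
  fixes f :: "(nat \<Rightarrow> real) \<Rightarrow> 'a::euclidean_space"
  assumes f: "C2_map m f f1 f2"
  shows "is_current m (param_current m (open_cube m) f)"
proof -
  let ?P = "param_current m (open_cube m) f"
  have P: "?P \<omega> = (LINT y:open_cube m|lborel_pow m. \<omega> (f y) (\<lambda>i. f1 i y))" if "\<omega> \<in> test_forms m" for \<omega>
    by (rule param_current_C2[OF f]) (rule smooth_form_cong[OF smooth_form_if_test_form[OF that]])
  have cont: "continuous_on UNIV (\<lambda>y. \<omega> (f y) (\<lambda>i. f1 i y))" if "\<omega> \<in> test_forms m" for \<omega>
    by (rule continuous_on_C2_pullback[OF f smooth_form_if_test_form[OF that]])
  have add: "?P (\<lambda>x v. \<omega> x v + \<eta> x v) = ?P \<omega> + ?P \<eta>" if "\<omega> \<in> test_forms m" "\<eta> \<in> test_forms m" for \<omega> \<eta>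
    using that set_integrable_open_cube[OF cont] by (simp add: P test_forms_add set_integral_add)
  have scale: "?P (\<lambda>x v. c * \<omega> x v) = c * ?P \<omega>" for c \<omega>
    by (simp add: param_current_def)
  have lim: "(\<lambda>n. ?P (\<omega> n)) \<longlonglongrightarrow> 0"
    if \<omega>: "\<And>n. \<omega> n \<in> test_forms m"
      and lim: "\<And>vs v. uniform_limit UNIV (\<lambda>n. iterated_deriv vs (\<lambda>y. \<omega> n y v)) (\<lambda>_. 0) sequentially"
    for \<omega> :: "nat \<Rightarrow> 'a form"
  proof (rule tendstoI)
    fix e :: real assume e: "0 < e"
    have "continuous_on UNIV (\<lambda>y. real (DIM('a)) ^ m * (\<Prod>i<m. norm (f1 i y)))"
      using f by (intro continuous_intros) (auto simp: C2_map_def)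
    then obtain B where B: "0 < B" "\<And>y. y \<in> {..<m} \<rightarrow>\<^sub>E {0..1} \<Longrightarrow>
        norm (real (DIM('a)) ^ m * (\<Prod>i<m. norm (f1 i y))) \<le> B"
      using continuous_bounded_box by blast
    define \<epsilon> where "\<epsilon> = e / (2 * B)"
    have "0 < \<epsilon>" using e B by (simp add: \<epsilon>_def)
    have "\<forall>\<^sub>F n in sequentially. \<forall>I\<in>basis_tuples m. \<forall>x. \<bar>\<omega> n x I\<bar> < \<epsilon>"
    proof (rule eventually_ball_finite, simp, rule ballI)
      fix I :: "nat \<Rightarrow> 'a"
      show "\<forall>\<^sub>F n in sequentially. \<forall>x. \<bar>\<omega> n x I\<bar> < \<epsilon>"
        using uniform_limitD[OF lim[of "[]" I] \<open>0 < \<epsilon>\<close>] by simp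
    qed
    then show "\<forall>\<^sub>F n in sequentially. dist (?P (\<omega> n)) 0 < e"
    proof eventually_elim
      case (elim n)
      have "\<bar>?P (\<omega> n)\<bar> \<le> \<epsilon> * B"
        unfolding P[OF \<omega>]
      proof (rule abs_cube_integral_le[OF cont[OF \<omega>]])
        fix y assume y: "y \<in> open_cube m"
        have "\<bar>\<omega> n (f y) (\<lambda>i. f1 i y)\<bar> \<le> \<epsilon> * real DIM('a) ^ m * (\<Prod>i<m. norm (f1 i y))"
          by (rule alternating_multilinear_bound[OF smooth_formD(1)[OF smooth_form_if_test_form[OF \<omega>]]])
             (use elim in \<open>auto simp: less_imp_le\<close>)
        also have "\<dots> \<le> \<epsilon> * B"
          using B(2)[OF subsetD[OF open_cube_subset_box y]] \<open>0 < \<epsilon>\<close>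
          unfolding mult.assoc by (intro mult_left_mono) auto
        finally show "\<bar>\<omega> n (f y) (\<lambda>i. f1 i y)\<bar> \<le> \<epsilon> * B" .
      qed
      also have "\<dots> < e" using B e by (simp add: \<epsilon>_def)
      finally show ?case by simp
    qed
  qed
  show ?thesis
    unfolding is_current_iff
  proof (intro conjI ballI allI impI)
    fix \<omega> :: "nat \<Rightarrow> 'a form" assume "null_sequence m \<omega>"
    note N = this[unfolded null_sequence_def]
    from N have \<omega>1: "\<forall>n. \<omega> n \<in> test_forms m"
      by (elim exE conjE)
    from N have \<omega>2: "\<forall>vs v. uniform_limit UNIV (\<lambda>n. iterated_deriv vs (\<lambda>y. \<omega> n y v)) (\<lambda>_. 0) sequentially"
      by (elim exE conjE)
    show "(\<lambda>n. ?P (\<omega> n)) \<longlonglongrightarrow> 0"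
      by (rule lim[OF \<omega>1[rule_format] \<omega>2[rule_format]])
  qed (rule add, assumption+, rule scale)
qed

lemma is_current_scale: "is_current m T \<Longrightarrow> is_current m (\<lambda>\<omega>. c * T \<omega>)"
  unfolding is_current_iff by (simp add: distrib_left tendsto_mult_right_zero)

lemma is_current_add: "is_current m T \<Longrightarrow> is_current m S \<Longrightarrow> is_current m (\<lambda>\<omega>. T \<omega> + S \<omega>)"
  unfolding is_current_iff by (simp add: distrib_left tendsto_add_zero)

lemma is_current_sum:
  "finite A \<Longrightarrow> (\<And>i. i \<in> A \<Longrightarrow> is_current m (T i)) \<Longrightarrow> is_current m (\<lambda>\<omega>. \<Sum>i\<in>A. T i \<omega>)"
proof (induction A rule: finite_induct)
  case empty
  then show ?case by (simp add: is_current_def)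
next
  case (insert i A)
  then show ?case by (simp add: is_current_add)
qed

lemma is_current_cube_boundary:
  assumes F: "C2_map (Suc m) F F1 F2"
  shows "is_current m (cube_boundary m F)"
proof -
  have "is_current m (\<lambda>\<omega>. (-1) ^ i * (param_current m (open_cube m) (\<lambda>z. F (insert_at i 1 z)) \<omega> +
      (-1) * param_current m (open_cube m) (\<lambda>z. F (insert_at i 0 z)) \<omega>))" for i
    by (intro is_current_scale is_current_add is_current_param_current[OF C2_map_face[OF F]])
  then have "is_current m (\<lambda>\<omega>. \<Sum>i<Suc m. (-1) ^ i * (param_current m (open_cube m) (\<lambda>z. F (insert_at i 1 z)) \<omega> +
      (-1) * param_current m (open_cube m) (\<lambda>z. F (insert_at i 0 z)) \<omega>))"
    by (intro is_current_sum finite_lessThan)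
  then show ?thesis
    by (simp add: cube_boundary_def del: sum.lessThan_Suc)
qed

text \<open>Coordinates are exchanged one at a time, with the mean value inequality at each
  exchange. The intermediate points stay in the closed box, where the partial derivatives are
  bounded.\<close>

lemma lipschitz_cube_C2:
  fixes f :: "(nat \<Rightarrow> real) \<Rightarrow> 'a::euclidean_space"
  assumes f: "C2_map m f f1 f2"
  shows "lipschitz_cube m f"
proof -
  have "continuous_on UNIV (\<lambda>y. \<Sum>i<m. norm (f1 i y))"
    using f by (intro continuous_intros) (auto simp: C2_map_def)
  then obtain B where B: "0 < B" "\<And>y. y \<in> {..<m} \<rightarrow>\<^sub>E {0..1} \<Longrightarrow> norm (\<Sum>i<m. norm (f1 i y)) \<le> B"
    using continuous_bounded_box by blast
  have B1: "norm (f1 i y) \<le> B" if "y \<in> {..<m} \<rightarrow>\<^sub>E {0..1}" "i < m" for i y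
    using B(2)[OF that(1)] member_le_sum[of i "{..<m}" "\<lambda>i. norm (f1 i y)"] that(2) by simp
  have "dist (f x) (f y) \<le> B * (\<Sum>i<m. \<bar>x i - y i\<bar>)" if x: "x \<in> open_cube m" and y: "y \<in> open_cube m" for x y
  proof -
    define h where "h n i = (if i < n then x i else y i)" for n i :: nat
    have "dist (f (h n)) (f y) \<le> B * (\<Sum>i<n. \<bar>x i - y i\<bar>)" if "n \<le> m" for n
      using that
    proof (induction n)
      case 0
      then show ?case by (simp add: h_def)
    next
      case (Suc n)
      then have n: "n < m" by simp
      have box: "(h n)(n := t) \<in> {..<m} \<rightarrow>\<^sub>E {0..1}" if "t \<in> {0..1}" for t
        using x y n that unfolding open_cube_def h_def
        by (auto simp: PiE_def Pi_def extensional_def less_imp_le)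
      have "norm (f ((h n)(n := x n)) - f ((h n)(n := y n))) \<le> B * norm (x n - y n)"
      proof (rule differentiable_bound[where S = "{0..1::real}"])
        fix t :: real assume t: "t \<in> {0..1}"
        have "((\<lambda>s. f (((h n)(n := t))(n := s))) has_vector_derivative f1 n ((h n)(n := t)))
            (at (((h n)(n := t)) n))"
          using f n unfolding C2_map_def by blast
        then have "((\<lambda>s. f ((h n)(n := s))) has_vector_derivative f1 n ((h n)(n := t))) (at t)"
          by simp
        from has_vector_derivative_at_within[OF this]
        show "((\<lambda>s. f ((h n)(n := s))) has_derivative (\<lambda>d. d *\<^sub>R f1 n ((h n)(n := t)))) (at t within {0..1})"
          by (simp add: has_vector_derivative_def)
        show "onorm (\<lambda>d. d *\<^sub>R f1 n ((h n)(n := t))) \<le> B"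
          using B1[OF box[OF t] n] by (intro onorm_le) (simp add: mult.commute[of B] mult_left_mono)
      qed (use x y n in \<open>auto simp: open_cube_def PiE_def Pi_def less_imp_le\<close>)
      moreover have "(h n)(n := x n) = h (Suc n)" "(h n)(n := y n) = h n"
        by (auto simp: h_def fun_eq_iff)
      ultimately have "dist (f (h (Suc n))) (f (h n)) \<le> B * \<bar>x n - y n\<bar>"
        by (simp add: dist_norm)
      then show ?case
        using Suc dist_triangle[of "f (h (Suc n))" "f y" "f (h n)"] by (simp add: algebra_simps)
    qed
    moreover have "h m = x"
      using x y by (auto simp: h_def fun_eq_iff open_cube_def PiE_def extensional_def)
    ultimately show ?thesis by force
  qed
  then show ?thesis unfolding lipschitz_cube_def by blast
qed

lemma insert_at_in_box:
  assumes "z \<in> open_cube m" "c = 0 \<or> c = 1" "i < Suc m"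
  shows "insert_at i c z \<in> {..<Suc m} \<rightarrow>\<^sub>E {0..1}"
  using assms open_cube_subset_box[of m] by (subst insert_at_in_PiE_iff) auto

lemma param_current_zero_outside:
  assumes "f ` open_cube m \<subseteq> K" "form_support \<omega> \<subseteq> - K"
  shows "param_current m (open_cube m) f \<omega> = 0"
proof -
  have "indicator (open_cube m) y * \<omega> (f y) (partial_deriv f y) = 0" for y
  proof (cases "y \<in> open_cube m")
    case True
    then have "f y \<notin> form_support \<omega>" using assms by blast
    from form_zero_outside_support[OF this] show ?thesis by simp
  qed simp
  then show ?thesis by (simp only: param_current_def set_lebesgue_integral_def real_scaleR_def integral_zero)
qed

lemma current_support_cube_boundary:
  assumes K: "closed K" "F ` ({..<Suc m} \<rightarrow>\<^sub>E {0..1}) \<subseteq> K"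
  shows "current_support m (cube_boundary m F) \<subseteq> K"
proof -
  have "cube_boundary m F \<omega> = 0" if "form_support \<omega> \<subseteq> - K" for \<omega>
  proof -
    have "param_current m (open_cube m) (\<lambda>z. F (insert_at i c z)) \<omega> = 0" if "i < Suc m" "c = 0 \<or> c = 1" for i c
      using K(2) insert_at_in_box[OF _ that(2,1)]
      by (intro param_current_zero_outside[OF _ \<open>form_support \<omega> \<subseteq> - K\<close>]) blast
    then show ?thesis by (simp add: cube_boundary_def)
  qed
  moreover have "open (- K)" using K by auto
  ultimately show ?thesis unfolding current_support_def by blast
qed

lemma compact_current_support:
  assumes "compact K" "current_support m T \<subseteq> K"
  shows "compact (current_support m T)"
proof -
  have "closed (current_support m T)"
    unfolding current_support_def by (intro closed_Compl open_Union) auto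
  with assms show ?thesis using compact_closed_subset by blast
qed

text \<open>The faces with their signs, in the list format that \<open>lipschitz_chain\<close>
  expects.\<close>

definition boundary_chain ::
    "nat \<Rightarrow> ((nat \<Rightarrow> real) \<Rightarrow> 'a::euclidean_space) \<Rightarrow> (int \<times> ((nat \<Rightarrow> real) \<Rightarrow> 'a)) list" where
  "boundary_chain n F = map (\<lambda>i. ((-1) ^ i, \<lambda>z. F (insert_at i 1 z))) [0..<n] @
     map (\<lambda>i. (- ((-1) ^ i), \<lambda>z. F (insert_at i 0 z))) [0..<n]"

lemma set_boundary_chain:
  assumes "(a, f) \<in> set (boundary_chain n F)"
  shows "\<exists>i c. i < n \<and> (c = 0 \<or> c = 1) \<and> f = (\<lambda>z. F (insert_at i c z))"
proof -
  from assms obtain i where "i < n" "f = (\<lambda>z. F (insert_at i 1 z)) \<or> f = (\<lambda>z. F (insert_at i 0 z))"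
    unfolding boundary_chain_def by auto
  then show ?thesis by (intro exI[of _ i]) auto
qed

lemma lipschitz_chain_boundary_chain:
  "lipschitz_chain m (boundary_chain (Suc m) F) = cube_boundary m F"
proof
  fix \<omega>
  have "lipschitz_chain m (boundary_chain n F) \<omega> = (\<Sum>i<n. (-1) ^ i *
     (param_current m (open_cube m) (\<lambda>z. F (insert_at i 1 z)) \<omega> -
      param_current m (open_cube m) (\<lambda>z. F (insert_at i 0 z)) \<omega>))" for n
    unfolding lipschitz_chain_def boundary_chain_def
    by (simp add: comp_def interv_sum_list_conv_sum_set_nat atLeast0LessThan right_diff_distrib
        sum_subtractf sum_negf)
  then show "lipschitz_chain m (boundary_chain (Suc m) F) \<omega> = cube_boundary m F \<omega>"
    unfolding cube_boundary_def .
qed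

text \<open>The current equals the chain of its faces, so one chain serves for every
  \<open>\<epsilon>\<close>; the boundary is the zero current on test forms.\<close>

theorem integral_current_cube_boundary:
  assumes F: "C2_map (Suc (Suc k)) F F1 F2"
    and K: "compact K" "F ` ({..<Suc (Suc k)} \<rightarrow>\<^sub>E {0..1}) \<subseteq> K"
  shows "integral_current (Suc k) (cube_boundary (Suc k) F)"
  unfolding integral_current_def
proof (intro conjI impI)
  let ?c = "boundary_chain (Suc (Suc k)) F"
  have lip: "lipschitz_cube (Suc k) f \<and> f ` open_cube (Suc k) \<subseteq> K" if af: "(a, f) \<in> set ?c" for a f
  proof -
    obtain i c where i: "i < Suc (Suc k)" "c = 0 \<or> c = 1" and f: "f = (\<lambda>z. F (insert_at i c z))"
      using set_boundary_chain[OF af] by blast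
    show ?thesis
      unfolding f using lipschitz_cube_C2[OF C2_map_face[OF F]] K(2) insert_at_in_box[OF _ i(2,1)] by blast
  qed
  have mass: "mass (Suc k) (\<lambda>\<omega>. cube_boundary (Suc k) F \<omega> - lipschitz_chain (Suc k) ?c \<omega>) = 0"
    unfolding lipschitz_chain_boundary_chain by (rule mass_eq_0) simp
  show "rectifiable_current (Suc k) (cube_boundary (Suc k) F)"
    unfolding rectifiable_current_def
  proof (intro conjI exI[of _ K] allI impI exI[of _ ?c])
    show "is_current (Suc k) (cube_boundary (Suc k) F)"
      by (rule is_current_cube_boundary[OF F])
    show "\<forall>(a, f)\<in>set ?c. lipschitz_cube (Suc k) f \<and> f ` open_cube (Suc k) \<subseteq> K"
      using lip by blast
    show "mass (Suc k) (\<lambda>\<omega>. cube_boundary (Suc k) F \<omega> - lipschitz_chain (Suc k) ?c \<omega>) < \<epsilon>" if "0 < \<epsilon>" for \<epsilon>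
      using mass that by simp
  qed (rule K(1))
  have "cube_boundary (Suc k) F (ext_deriv k \<omega>) = 0" if "\<omega> \<in> test_forms k" for \<omega>
    by (rule cube_boundary_ext_deriv[OF smooth_form_if_test_form[OF that] F])
  then show "rectifiable_current (Suc k - 1) (boundary (Suc k) (cube_boundary (Suc k) F))"
    by (intro rectifiable_current_if_zero) (simp add: boundary_def)
qed

section \<open>A supply of smooth functions\<close>

text \<open>The sequence \<open>H\<close> lists all derivatives at once. The restriction to
  \<open>U\<close> admits functions such as powers that are smooth on the positive reals
  only.\<close>

definition smooth_real_on :: "real set \<Rightarrow> (real \<Rightarrow> real) \<Rightarrow> bool" where
  "smooth_real_on U h \<longleftrightarrow> (\<exists>H :: nat \<Rightarrow> real \<Rightarrow> real. H 0 = h \<and>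
     (\<forall>n. \<forall>t\<in>U. (H n has_real_derivative H (Suc n) t) (at t)))"

lemma smooth_real_onE:
  assumes "smooth_real_on U h"
  obtains h' where "smooth_real_on U h'" "\<And>t. t \<in> U \<Longrightarrow> (h has_real_derivative h' t) (at t)"
proof -
  from assms obtain H where H: "H 0 = h" "\<And>n t. t \<in> U \<Longrightarrow> (H n has_real_derivative H (Suc n) t) (at t)"
    unfolding smooth_real_on_def by blast
  have "smooth_real_on U (H (Suc 0))"
    unfolding smooth_real_on_def by (rule exI[of _ "\<lambda>n. H (Suc n)"]) (simp add: H(2))
  then show ?thesis using that H(1) H(2)[of _ 0] by blast
qed

text \<open>A class built to be closed under directional derivatives. Smoothness of products and
  compositions then follows without formulas for their higher derivatives.\<close>

inductive smooth_term :: "('a::euclidean_space \<Rightarrow> real) \<Rightarrow> bool" where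
  const: "smooth_term (\<lambda>_. c)"
| inner: "smooth_term (\<lambda>x. x \<bullet> b)"
| add: "smooth_term f \<Longrightarrow> smooth_term g \<Longrightarrow> smooth_term (\<lambda>x. f x + g x)"
| mult: "smooth_term f \<Longrightarrow> smooth_term g \<Longrightarrow> smooth_term (\<lambda>x. f x * g x)"
| compose: "smooth_real_on U h \<Longrightarrow> smooth_term f \<Longrightarrow> (\<And>x. f x \<in> U) \<Longrightarrow> smooth_term (\<lambda>x. h (f x))"

text \<open>The sum, product and chain rules express the derivative of a term in a fixed direction
  by terms again; \<open>smooth_real_onE\<close> supplies the derivative of the outer
  function.\<close>

lemma smooth_term_has_derivative:
  assumes "smooth_term f"
  shows "\<exists>D. (\<forall>x. (f has_derivative D x) (at x)) \<and> (\<forall>v. smooth_term (\<lambda>x. D x v))"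
  using assms
proof induction
  case (const c)
  show ?case by (rule exI[of _ "\<lambda>_ _. 0"]) (simp add: smooth_term.const)
next
  case (inner b)
  show ?case
    by (rule exI[of _ "\<lambda>_ v. v \<bullet> b"]) (auto intro!: derivative_eq_intros smooth_term.const)
next
  case (add f g)
  then obtain D E where
    "\<And>x. (f has_derivative D x) (at x)" "\<And>v. smooth_term (\<lambda>x. D x v)"
    "\<And>x. (g has_derivative E x) (at x)" "\<And>v. smooth_term (\<lambda>x. E x v)"
    by blast
  then show ?case
    by (intro exI[of _ "\<lambda>x v. D x v + E x v"]) (auto intro!: has_derivative_add smooth_term.add)
next
  case (mult f g)
  then obtain D E where
    "\<And>x. (f has_derivative D x) (at x)" "\<And>v. smooth_term (\<lambda>x. D x v)"
    "\<And>x. (g has_derivative E x) (at x)" "\<And>v. smooth_term (\<lambda>x. E x v)"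
    by blast
  with mult show ?case
    by (intro exI[of _ "\<lambda>x v. f x * E x v + D x v * g x"])
       (auto intro!: has_derivative_mult smooth_term.add smooth_term.mult)
next
  case (compose U h f)
  then obtain D where D: "\<And>x. (f has_derivative D x) (at x)" "\<And>v. smooth_term (\<lambda>x. D x v)"
    by blast
  obtain h' where h': "smooth_real_on U h'" "\<And>t. t \<in> U \<Longrightarrow> (h has_real_derivative h' t) (at t)"
    using smooth_real_onE[OF compose(1)] by blast
  have "((\<lambda>x. h (f x)) has_derivative (\<lambda>v. h' (f x) * D x v)) (at x)" for x
    using has_derivative_compose[OF D(1) h'(2)[OF compose(3), unfolded has_field_derivative_def]] .
  moreover have "smooth_term (\<lambda>x. h' (f x) * D x v)" for v
    by (intro smooth_term.mult smooth_term.compose[OF h'(1)] compose D)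
  ultimately show ?case
    by (intro exI[of _ "\<lambda>x v. h' (f x) * D x v"] conjI allI)
qed

lemma smooth_if_smooth_term:
  assumes "smooth_term f"
  shows "smooth f"
proof -
  have "smooth_term (iterated_deriv vs f)" for vs
  proof (induction vs)
    case (Cons v vs)
    from smooth_term_has_derivative[OF this] obtain D where
      D: "\<And>x. (iterated_deriv vs f has_derivative D x) (at x)" "\<And>v. smooth_term (\<lambda>x. D x v)"
      by blast
    have "iterated_deriv (v # vs) f = (\<lambda>x. D x v)"
      using frechet_derivative_at[OF D(1)] by simp
    then show ?case using D(2) by simp
  qed (use assms in simp)
  then show ?thesis
    unfolding smooth_def differentiable_def using smooth_term_has_derivative by blast
qed

lemma smooth_term_minus: "smooth_term f \<Longrightarrow> smooth_term g \<Longrightarrow> smooth_term (\<lambda>x. f x - g x)"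
  using smooth_term.add[of f "\<lambda>x. (-1) * g x"] smooth_term.mult[OF smooth_term.const[of "-1"], of g] by simp

lemma smooth_term_power: "smooth_term f \<Longrightarrow> smooth_term (\<lambda>x. f x ^ n)"
  by (induction n) (auto intro: smooth_term.const smooth_term.mult)

lemma smooth_term_sum:
  "(\<And>i. i \<in> A \<Longrightarrow> smooth_term (f i)) \<Longrightarrow> smooth_term (\<lambda>x. \<Sum>i\<in>A. f i x)"
  by (induction A rule: infinite_finite_induct) (auto intro: smooth_term.const smooth_term.add)

lemma smooth_term_prod:
  "(\<And>i. i \<in> A \<Longrightarrow> smooth_term (f i)) \<Longrightarrow> smooth_term (\<lambda>x. \<Prod>i\<in>A. f i x)"
  by (induction A rule: infinite_finite_induct) (auto intro: smooth_term.const smooth_term.mult)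

lemma smooth_term_norm_square: "smooth_term (\<lambda>x. (norm x)\<^sup>2)"
proof -
  have "smooth_term (\<lambda>x :: 'a. \<Sum>b\<in>Basis. (x \<bullet> b) ^ 2)"
    by (intro smooth_term_sum smooth_term_power smooth_term.inner)
  moreover have "(norm x)\<^sup>2 = (\<Sum>b\<in>Basis. (x \<bullet> b) ^ 2)" for x :: 'a
    unfolding power2_norm_eq_inner by (subst euclidean_inner) (simp add: power2_eq_square)
  ultimately show ?thesis by simp
qed

text \<open>Each derivative of the sine is a shift by a further quarter period.\<close>

lemma smooth_real_on_sin: "smooth_real_on UNIV sin"
  unfolding smooth_real_on_def
proof (intro exI[of _ "\<lambda>n t. sin (t + real n * (pi / 2))"] conjI allI ballI)
  fix n :: nat and t :: real
  have "sin (t + real (Suc n) * (pi / 2)) = cos (t + real n * (pi / 2))"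
  proof -
    have "t + real (Suc n) * (pi / 2) = (t + real n * (pi / 2)) + pi / 2"
      by (simp add: algebra_simps add_divide_distrib)
    then show ?thesis by (simp only: sin_add cos_pi_half sin_pi_half mult_zero_right mult_1_right add_0)
  qed
  then show "((\<lambda>t. sin (t + real n * (pi / 2))) has_real_derivative sin (t + real (Suc n) * (pi / 2))) (at t)"
    by (auto intro!: derivative_eq_intros)
qed simp

lemma smooth_term_sin: "smooth_term f \<Longrightarrow> smooth_term (\<lambda>x. sin (f x))"
  by (rule smooth_term.compose[OF smooth_real_on_sin]) auto

lemma smooth_term_cos: "smooth_term f \<Longrightarrow> smooth_term (\<lambda>x. cos (f x))"
  using smooth_term_sin[OF smooth_term_minus[OF smooth_term.const[of "pi / 2"]], of f] by (simp add: cos_sin_eq)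

lemma smooth_real_on_powr: "smooth_real_on {0<..} (\<lambda>t. t powr a)"
  unfolding smooth_real_on_def
proof (intro exI[of _ "\<lambda>n t. (\<Prod>i<n. a - real i) * t powr (a - real n)"] conjI allI ballI)
  fix n :: nat and t :: real assume "t \<in> {0<..}"
  then have "((\<lambda>t. (\<Prod>i<n. a - real i) * t powr (a - real n)) has_real_derivative
      (\<Prod>i<n. a - real i) * ((a - real n) * t powr (a - real n - 1))) (at t)"
    by (intro DERIV_cmult has_real_derivative_powr) simp
  moreover have "a - real n - 1 = a - real (Suc n)" by simp
  ultimately show "((\<lambda>t. (\<Prod>i<n. a - real i) * t powr (a - real n)) has_real_derivative
      (\<Prod>i<Suc n. a - real i) * t powr (a - real (Suc n))) (at t)"
    by (simp only: prod.lessThan_Suc mult.assoc)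
qed simp

lemma smooth_term_inverse_sqrt:
  assumes "smooth_term f" "\<And>x. 0 < f x"
  shows "smooth_term (\<lambda>x. 1 / sqrt (f x))"
proof -
  have "smooth_term (\<lambda>x. f x powr (- 1 / 2))"
    by (rule smooth_term.compose[OF smooth_real_on_powr assms(1)]) (simp add: assms(2))
  also have "(\<lambda>x. f x powr (- 1 / 2)) = (\<lambda>x. 1 / sqrt (f x))"
    using assms(2) by (simp add: fun_eq_iff powr_minus_divide powr_half_sqrt less_imp_le)
  finally show ?thesis .
qed

text \<open>The classical smooth function that is flat at 0; it tends to 1 at infinity.\<close>

definition plateau :: "real \<Rightarrow> real" where
  "plateau t = (if 0 < t then exp (- (1 / t)) else 0)"

text \<open>For positive \<open>t\<close> and \<open>s = 1 / t\<close>, the derivative of order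
  \<open>n\<close> of \<open>plateau\<close> is \<open>poly (plateau_poly n) s * exp (- s)\<close>.
  The recursion is the product rule together with \<open>d/dt = - s^2 d/ds\<close>.\<close>

primrec plateau_poly :: "nat \<Rightarrow> real poly" where
  "plateau_poly 0 = 1"
| "plateau_poly (Suc n) = [:0, 0, 1:] * (plateau_poly n - pderiv (plateau_poly n))"

lemma poly_times_exp_minus_tendsto_0: "((\<lambda>s. poly p s * exp (- s)) \<longlongrightarrow> (0::real)) at_top"
proof -
  have "((\<lambda>s. \<Sum>i\<le>degree p. coeff p i * (s ^ i / exp s)) \<longlongrightarrow> (\<Sum>i\<le>degree p. coeff p i * 0)) at_top"
    by (intro tendsto_intros tendsto_power_div_exp_0)
  then show ?thesis
    by (simp add: poly_altdef sum_distrib_right exp_minus divide_inverse mult.assoc)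
qed

lemma smooth_real_on_plateau: "smooth_real_on UNIV plateau"
proof -
  define H where "H n t = (if 0 < t then poly (plateau_poly n) (1 / t) * exp (- (1 / t)) else 0)"
    for n and t :: real
  have "(H n has_real_derivative H (Suc n) t) (at t)" for n t
  proof (cases t "0::real" rule: linorder_cases)
    case less
    have "((\<lambda>_. 0) has_real_derivative H (Suc n) t) (at t)"
      using less by (simp add: H_def)
    then show ?thesis
      by (rule has_field_derivative_transform_within_open[where S = "{..<0}"])
         (use less in \<open>auto simp: H_def\<close>)
  next
    case greater
    have "((\<lambda>t. poly (plateau_poly n) (1 / t) * exp (- (1 / t))) has_real_derivative H (Suc n) t) (at t)"
      using greater
      by (auto intro!: derivative_eq_intros poly_DERIV[THEN DERIV_chain2] simp: H_def)
         (simp add: field_simps power2_eq_square)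
    then show ?thesis
      by (rule has_field_derivative_transform_within_open[where S = "{0<..}"])
         (use greater in \<open>auto simp: H_def\<close>)
  next
    \<comment> \<open>Every \<open>H n\<close> vanishes at 0, so the difference quotient is
      \<open>H n h / h\<close>. It is zero for negative \<open>h\<close>; for positive
      \<open>h\<close> it is a polynomial in \<open>1 / h\<close> times
      \<open>exp (- 1 / h)\<close>.\<close>
    case equal
    have "((\<lambda>h. H n h / h) \<longlongrightarrow> 0) (at_left 0)"
    proof (rule Lim_transform_eventually[OF tendsto_const])
      show "\<forall>\<^sub>F h in at_left 0. 0 = H n h / h"
        by (auto simp: eventually_at_left_field H_def intro!: exI[of _ "-1"])
    qed
    moreover have "((\<lambda>h. H n h / h) \<longlongrightarrow> 0) (at_right 0)"
    proof (rule Lim_transform_eventually)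
      show "((\<lambda>h. poly ([:0, 1:] * plateau_poly n) (inverse h) * exp (- inverse h)) \<longlongrightarrow> 0) (at_right 0)"
        by (rule filterlim_compose[OF poly_times_exp_minus_tendsto_0 filterlim_inverse_at_top_right])
      show "\<forall>\<^sub>F h in at_right 0. poly ([:0, 1:] * plateau_poly n) (inverse h) * exp (- inverse h) = H n h / h"
        by (auto simp: eventually_at_right_field H_def field_simps intro!: exI[of _ "1"])
    qed
    ultimately have "((\<lambda>h. H n h / h) \<longlongrightarrow> 0) (at 0)"
      by (rule filterlim_split_at)
    then show ?thesis
      using equal by (simp add: has_field_derivative_iff H_def)
  qed
  moreover have "H 0 = plateau"
    by (auto simp: H_def plateau_def fun_eq_iff)
  ultimately show ?thesis
    unfolding smooth_real_on_def by blast
qed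

lemma plateau_bounds: "0 \<le> plateau t" "plateau t \<le> 1"
  by (auto simp: plateau_def)

lemma plateau_tendsto_1:
  assumes "0 < d"
  shows "(\<lambda>n. plateau (real n * d)) \<longlonglongrightarrow> 1"
proof (rule Lim_transform_eventually)
  have "(\<lambda>n. exp (- (1 / d) * inverse (real n))) \<longlonglongrightarrow> exp (- (1 / d) * 0)"
    by (intro tendsto_intros lim_inverse_n)
  then show "(\<lambda>n. exp (- (1 / d) * inverse (real n))) \<longlonglongrightarrow> 1" by simp
  show "\<forall>\<^sub>F n in sequentially. exp (- (1 / d) * inverse (real n)) = plateau (real n * d)"
    using eventually_gt_at_top[of 0]
    by eventually_elim (use assms in \<open>simp add: plateau_def field_simps\<close>)
qed

text \<open>The squared norm keeps the function smooth at the origin. The cut-off vanishes exactly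
  outside the open ball when \<open>n > 0\<close>, so the limit as \<open>n\<close> grows is the
  indicator of the open ball.\<close>

definition ball_cutoff :: "real \<Rightarrow> nat \<Rightarrow> 'a::euclidean_space \<Rightarrow> real" where
  "ball_cutoff r n x = plateau (real n * (r\<^sup>2 - (norm x)\<^sup>2))"

lemma smooth_term_ball_cutoff: "smooth_term (ball_cutoff r n)"
proof -
  have "smooth_term (\<lambda>x :: 'a. plateau (real n * (r\<^sup>2 - (norm x)\<^sup>2)))"
    by (rule smooth_term.compose[OF smooth_real_on_plateau])
       (auto intro!: smooth_term.mult smooth_term.const smooth_term_minus smooth_term_norm_square)
  then show ?thesis by (simp add: ball_cutoff_def[abs_def])
qed

lemma ball_cutoff_bounds: "0 \<le> ball_cutoff r n x" "ball_cutoff r n x \<le> 1"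
  by (auto simp: ball_cutoff_def plateau_bounds)

lemma ball_cutoff_outside: "0 < r \<Longrightarrow> x \<notin> ball 0 r \<Longrightarrow> ball_cutoff r n x = 0"
proof -
  assume "0 < r" "x \<notin> ball 0 r"
  then have "r\<^sup>2 \<le> (norm x)\<^sup>2" by (intro power_mono) auto
  then have "real n * (r\<^sup>2 - (norm x)\<^sup>2) \<le> 0" by (intro mult_nonneg_nonpos) auto
  then show ?thesis by (simp add: ball_cutoff_def plateau_def)
qed

lemma ball_cutoff_tendsto:
  assumes "0 < r"
  shows "(\<lambda>n. ball_cutoff r n x) \<longlonglongrightarrow> indicat_real (ball 0 r) x"
proof (cases "x \<in> ball 0 r")
  case True
  then have "(norm x)\<^sup>2 < r\<^sup>2" by (intro power_strict_mono) auto
  then show ?thesis using True plateau_tendsto_1[of "r\<^sup>2 - (norm x)\<^sup>2"] by (simp add: ball_cutoff_def)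
next
  case False
  then show ?thesis by (simp add: ball_cutoff_outside[OF assms])
qed

section \<open>The helicoid and its affine reparametrizations\<close>

definition position :: "'k::{finite,linorder} \<Rightarrow> nat" where
  "position i = card {j. j < i}"

lemma position_less [simp]: "position (i :: 'k::{finite,linorder}) < CARD('k)"
  unfolding position_def by (rule psubset_card_mono) auto

lemma position_strict_mono: "i < j \<Longrightarrow> position i < position j"
  unfolding position_def by (rule psubset_card_mono) auto

lemma inj_position: "inj position"
  by (rule linorder_injI) (use position_strict_mono in fastforce)

lemma range_position: "range (position :: 'k::{finite,linorder} \<Rightarrow> nat) = {..<CARD('k)}"
  by (rule card_subset_eq) (auto simp: card_image[OF inj_position])

definition at_position :: "nat \<Rightarrow> 'k::{finite,linorder}" where
  "at_position = inv position"

lemma at_position_position [simp]: "at_position (position i) = i"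
  unfolding at_position_def by (rule inv_f_f[OF inj_position])

lemma position_at_position [simp]: "n < CARD('k) \<Longrightarrow> position (at_position n :: 'k::{finite,linorder}) = n"
  unfolding at_position_def using range_position[where 'k = 'k] by (intro f_inv_into_f) auto

type_synonym 'k ambient = "(real^'k) \<times> (real^'k) \<times> real"

definition affine_vec :: "(nat \<Rightarrow> real) \<Rightarrow> (nat \<Rightarrow> real) \<Rightarrow> (nat \<Rightarrow> real) \<Rightarrow> real^('k::{finite,linorder})" where
  "affine_vec a c y = (\<chi> i. a (position i) + c (position i) * y (position i))"

text \<open>The tangent vectors of the helicoid along its rulings, at height
  \<open>s\<close>.\<close>

definition rotated_axis :: "nat \<Rightarrow> real \<Rightarrow> ('k::{finite,linorder}) ambient" where
  "rotated_axis i s = (cos s *\<^sub>R axis (at_position i) 1, sin s *\<^sub>R axis (at_position i) 1, 0)"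

text \<open>With \<open>v = u\<close> and \<open>h = 1\<close> this is the tangent vector of the
  helicoid in direction \<open>s\<close>; with an axis vector and \<open>h = 0\<close> it is the
  derivative of a ruling direction with respect to \<open>s\<close>.\<close>

definition rotation_field :: "real \<Rightarrow> real^('k::{finite,linorder}) \<Rightarrow> real \<Rightarrow> 'k ambient" where
  "rotation_field s v h = (- sin s *\<^sub>R v, cos s *\<^sub>R v, h)"

text \<open>The helicoid in the affine coordinates \<open>a + c y\<close>, moved vertically with speed \<open>\<tau>\<close> by an
  additional last coordinate.\<close>

definition moving_helicoid ::
    "(nat \<Rightarrow> real) \<Rightarrow> (nat \<Rightarrow> real) \<Rightarrow> real \<Rightarrow> (nat \<Rightarrow> real) \<Rightarrow> ('k::{finite,linorder}) ambient" where
  "moving_helicoid a c \<tau> y = (let n = CARD('k); s = a n + c n * y n in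
     (cos s *\<^sub>R affine_vec a c y, sin s *\<^sub>R affine_vec a c y, s + \<tau> * y (Suc n)))"

definition moving_helicoid_d1 ::
    "(nat \<Rightarrow> real) \<Rightarrow> (nat \<Rightarrow> real) \<Rightarrow> real \<Rightarrow> nat \<Rightarrow> (nat \<Rightarrow> real) \<Rightarrow> ('k::{finite,linorder}) ambient" where
  "moving_helicoid_d1 a c \<tau> i y = (let n = CARD('k); s = a n + c n * y n in
     if i < n then c i *\<^sub>R rotated_axis i s
     else if i = n then c n *\<^sub>R rotation_field s (affine_vec a c y) 1
     else (0, 0, \<tau>))"

text \<open>The speed \<open>\<tau>\<close> is absent: the vertical motion is linear in its own
  coordinate and does not mix with the others.\<close>

definition moving_helicoid_d2 ::
    "(nat \<Rightarrow> real) \<Rightarrow> (nat \<Rightarrow> real) \<Rightarrow> nat \<Rightarrow> nat \<Rightarrow> (nat \<Rightarrow> real) \<Rightarrow> ('k::{finite,linorder}) ambient" where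
  "moving_helicoid_d2 a c i j y = (let n = CARD('k); s = a n + c n * y n in
     if i < n \<and> j = n then (c i * c n) *\<^sub>R rotation_field s (axis (at_position i) 1) 0
     else if i = n \<and> j < n then (c j * c n) *\<^sub>R rotation_field s (axis (at_position j) 1) 0
     else if i = n \<and> j = n then (c n * c n) *\<^sub>R (- cos s *\<^sub>R affine_vec a c y, - sin s *\<^sub>R affine_vec a c y, 0)
     else 0)"

lemma affine_vec_upd:
  "i < CARD('k) \<Longrightarrow> affine_vec a c (y(i := t)) =
     (affine_vec a c y :: real^('k::{finite,linorder})) + (c i * (t - y i)) *\<^sub>R axis (at_position i) 1"
  by (auto simp: affine_vec_def vec_eq_iff axis_def algebra_simps)

lemma affine_vec_upd_ge:
  assumes "CARD('k) \<le> i"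
  shows "affine_vec a c (y(i := t)) = (affine_vec a c y :: real^('k::{finite,linorder}))"
proof -
  have "position j \<noteq> i" for j :: 'k using position_less[of j] assms by linarith
  then show ?thesis by (simp add: affine_vec_def)
qed

lemma continuous_on_affine_vec [continuous_intros]: "continuous_on S (affine_vec a c)"
  unfolding affine_vec_def[abs_def]
  by (intro continuous_intros continuous_on_subset[OF continuous_on_product_coordinates]) auto

lemma continuous_on_coordinate [continuous_intros]: "continuous_on S (\<lambda>y :: nat \<Rightarrow> real. y i)"
  by (intro continuous_on_subset[OF continuous_on_product_coordinates]) auto

lemma C2_map_moving_helicoid:
  "C2_map (Suc (Suc CARD('k::{finite,linorder}))) (moving_helicoid a c \<tau> :: _ \<Rightarrow> 'k ambient)
     (moving_helicoid_d1 a c \<tau>) (moving_helicoid_d2 a c)"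
  unfolding C2_map_def
proof (intro conjI allI impI)
  let ?n = "CARD('k)"
  show "continuous_on UNIV (moving_helicoid a c \<tau> :: _ \<Rightarrow> 'k ambient)"
    unfolding moving_helicoid_def[abs_def] Let_def by (intro continuous_intros)
  fix i assume i: "i < Suc (Suc ?n)"
  consider "i < ?n" | "i = ?n" | "i = Suc ?n" using i by linarith
  note i_cases = this
  show "continuous_on UNIV (moving_helicoid_d1 a c \<tau> i :: _ \<Rightarrow> 'k ambient)"
    using i_cases
    by cases (simp_all add: moving_helicoid_d1_def[abs_def] Let_def rotated_axis_def rotation_field_def, (intro continuous_intros)+)
  show "((\<lambda>t. moving_helicoid a c \<tau> (y(i := t)) :: 'k ambient) has_vector_derivative moving_helicoid_d1 a c \<tau> i y) (at (y i))" for y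
    using i_cases
  proof cases
    case 1
    then show ?thesis
      unfolding moving_helicoid_def moving_helicoid_d1_def Let_def
      by (auto simp: affine_vec_upd rotated_axis_def intro!: derivative_eq_intros has_vector_derivative_Pair)
  next
    case 2
    then show ?thesis
      unfolding moving_helicoid_def moving_helicoid_d1_def Let_def
      by (auto simp: affine_vec_upd_ge rotation_field_def intro!: derivative_eq_intros has_vector_derivative_Pair)
  next
    case 3
    then show ?thesis
      unfolding moving_helicoid_def moving_helicoid_d1_def Let_def
      by (auto simp: affine_vec_upd_ge intro!: derivative_eq_intros has_vector_derivative_Pair)
  qed
  fix j assume j: "j < Suc (Suc ?n)"
  consider "j < ?n" | "j = ?n" | "j = Suc ?n" using j by linarith
  note j_cases = this
  show "continuous_on UNIV (moving_helicoid_d2 a c i j :: _ \<Rightarrow> 'k ambient)"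
  proof -
    consider "i < ?n \<and> j = ?n" | "i = ?n \<and> j < ?n" | "i = ?n \<and> j = ?n"
      | "\<not> (i < ?n \<and> j = ?n)" "\<not> (i = ?n \<and> j < ?n)" "\<not> (i = ?n \<and> j = ?n)" by blast
    then show ?thesis
    proof cases
      case 1
      then show ?thesis
        unfolding moving_helicoid_d2_def[abs_def] Let_def rotation_field_def
        by (simp, intro continuous_intros)
    next
      case 2
      then show ?thesis
        unfolding moving_helicoid_d2_def[abs_def] Let_def rotation_field_def
        by (simp, intro continuous_intros)
    next
      case 3
      then show ?thesis
        unfolding moving_helicoid_d2_def[abs_def] Let_def rotation_field_def
        by (simp, intro continuous_intros)
    next
      case 4
      then show ?thesis
        unfolding moving_helicoid_d2_def[abs_def] Let_def by (simp only: if_False continuous_on_const)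
    qed
  qed
  show "(moving_helicoid_d2 a c i j :: _ \<Rightarrow> 'k ambient) = moving_helicoid_d2 a c j i"
  proof
    fix y
    show "(moving_helicoid_d2 a c i j y :: 'k ambient) = moving_helicoid_d2 a c j i y"
      unfolding moving_helicoid_d2_def Let_def
      by (cases i ?n rule: linorder_cases; cases j ?n rule: linorder_cases) simp_all
  qed
  show "((\<lambda>t. moving_helicoid_d1 a c \<tau> i (y(j := t)) :: 'k ambient) has_vector_derivative moving_helicoid_d2 a c i j y) (at (y j))" for y
    using i_cases
  proof cases
    case I: 1
    show ?thesis
      using j_cases
    proof cases
      case 2
      have "((\<lambda>t. (c i * cos (a ?n + c ?n * t)) *\<^sub>R axis (at_position i) 1 :: real^('k::{finite,linorder})) has_vector_derivative
          (c i * (- sin (a ?n + c ?n * y ?n) * c ?n)) *\<^sub>R axis (at_position i) 1) (at (y ?n))"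
        "((\<lambda>t. (c i * sin (a ?n + c ?n * t)) *\<^sub>R axis (at_position i) 1 :: real^('k::{finite,linorder})) has_vector_derivative
          (c i * (cos (a ?n + c ?n * y ?n) * c ?n)) *\<^sub>R axis (at_position i) 1) (at (y ?n))"
        by (auto intro!: derivative_eq_intros)
      from has_vector_derivative_Pair[OF this(1) has_vector_derivative_Pair[OF this(2) has_vector_derivative_const[of 0]]]
      show ?thesis
        using I 2 by (simp add: moving_helicoid_d1_def moving_helicoid_d2_def Let_def rotated_axis_def
            rotation_field_def mult_ac)
    qed (use I in \<open>simp_all add: moving_helicoid_d1_def moving_helicoid_d2_def Let_def\<close>)
  next
    case 2
    show ?thesis
      using j_cases
    proof cases
      case 1
      with 2 show ?thesis
        unfolding moving_helicoid_d1_def moving_helicoid_d2_def Let_def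
        by (auto simp: affine_vec_upd rotation_field_def intro!: derivative_eq_intros has_vector_derivative_Pair)
    next
      case J: 2
      with 2 show ?thesis
        unfolding moving_helicoid_d1_def moving_helicoid_d2_def Let_def
        by (auto simp: affine_vec_upd_ge rotation_field_def intro!: derivative_eq_intros has_vector_derivative_Pair)
    next
      case 3
      with 2 show ?thesis
        unfolding moving_helicoid_d1_def moving_helicoid_d2_def Let_def
        by (auto simp: affine_vec_upd_ge)
    qed
  next
    case 3
    then show ?thesis
      unfolding moving_helicoid_d1_def moving_helicoid_d2_def Let_def by auto
  qed
qed

section \<open>Calibrating the helicoid\<close>

lemma inner_rotated_axis:
  assumes "i < CARD('k)" "j < CARD('k)"
  shows "(rotated_axis i s :: ('k::{finite,linorder}) ambient) \<bullet> rotated_axis j s = (if i = j then 1 else 0)"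
proof -
  have "(at_position i :: 'k) = at_position j \<longleftrightarrow> i = j"
    using assms by (metis position_at_position)
  then show ?thesis
    by (auto simp: rotated_axis_def inner_axis_axis sin_cos_squared_add3)
qed

lemma inner_rotated_axis_rotation_field:
  "(rotated_axis i s :: ('k::{finite,linorder}) ambient) \<bullet> rotation_field s v h = 0"
  by (simp add: rotated_axis_def rotation_field_def)

lemma inner_rotation_field:
  "(rotation_field s v h :: ('k::{finite,linorder}) ambient) \<bullet> rotation_field s v h = (norm v)\<^sup>2 + h\<^sup>2"
proof -
  have "sin s * (sin s * (v \<bullet> v)) + cos s * (cos s * (v \<bullet> v)) = (cos s * cos s + sin s * sin s) * (v \<bullet> v)"
    by (simp only: distrib_right mult.assoc add.commute)
  then have eq: "sin s * (sin s * (v \<bullet> v)) + cos s * (cos s * (v \<bullet> v)) = v \<bullet> v"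
    by (simp only: sin_cos_squared_add3 mult_1)
  have "(rotation_field s v h :: 'k ambient) \<bullet> rotation_field s v h =
      (sin s * (sin s * (v \<bullet> v)) + cos s * (cos s * (v \<bullet> v))) + h * h"
    by (simp add: rotation_field_def)
  then show ?thesis
    by (simp only: eq power2_norm_eq_inner power2_eq_square[of h])
qed

lemma norm_rotated_axis: "i < CARD('k) \<Longrightarrow> norm (rotated_axis i s :: ('k::{finite,linorder}) ambient) = 1"
  by (simp add: norm_eq_sqrt_inner inner_rotated_axis)

lemma norm_rotation_field:
  "norm (rotation_field s v h :: ('k::{finite,linorder}) ambient) = sqrt ((norm v)\<^sup>2 + h\<^sup>2)"
  by (simp only: norm_eq_sqrt_inner inner_rotation_field)

abbreviation helicoid :: "(nat \<Rightarrow> real) \<Rightarrow> ('k::{finite,linorder}) ambient" where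
  "helicoid \<equiv> moving_helicoid (\<lambda>_. 0) (\<lambda>_. 1) 0"

abbreviation helicoid_d1 :: "nat \<Rightarrow> (nat \<Rightarrow> real) \<Rightarrow> ('k::{finite,linorder}) ambient" where
  "helicoid_d1 \<equiv> moving_helicoid_d1 (\<lambda>_. 0) (\<lambda>_. 1) 0"

abbreviation coord_vec :: "(nat \<Rightarrow> real) \<Rightarrow> real^('k::{finite,linorder})" where
  "coord_vec \<equiv> affine_vec (\<lambda>_. 0) (\<lambda>_. 1)"

lemma helicoid_eq: "helicoid_embedding (helicoid_coords y) = helicoid y"
  by (simp add: helicoid_embedding_def helicoid_coords_def moving_helicoid_def affine_vec_def position_def Let_def)

definition helicoid_density :: "('k::{finite,linorder}) itself \<Rightarrow> (nat \<Rightarrow> real) \<Rightarrow> real" where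
  "helicoid_density _ y = sqrt (1 + (norm (coord_vec y :: real^('k::{finite,linorder})))\<^sup>2)"

lemma helicoid_density_pos: "0 < helicoid_density TYPE('k::{finite,linorder}) y"
  unfolding helicoid_density_def by (simp add: add_pos_nonneg)

lemma helicoid_d1_less:
  "i < CARD('k) \<Longrightarrow> helicoid_d1 i y = (rotated_axis i (y CARD('k)) :: ('k::{finite,linorder}) ambient)"
  by (simp add: moving_helicoid_d1_def Let_def)

lemma helicoid_d1_last:
  "helicoid_d1 CARD('k) y = (rotation_field (y CARD('k)) (coord_vec y) 1 :: ('k::{finite,linorder}) ambient)"
  by (simp add: moving_helicoid_d1_def Let_def)

text \<open>The tangent vectors are orthogonal and all but the last are unit vectors. Dividing the
  last one by the density gives an orthonormal frame, to which the comass bound applies with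
  constant 1.\<close>

lemma comass_bound_helicoid:
  fixes \<phi> :: "('k::{finite,linorder}) ambient covector"
  assumes \<phi>: "alternating_multilinear (Suc CARD('k)) \<phi>" "comass (Suc CARD('k)) \<phi> \<le> 1"
  shows "\<bar>\<phi> (\<lambda>i. helicoid_d1 i y)\<bar> \<le> helicoid_density TYPE('k) y"
proof -
  let ?n = "CARD('k)"
  define J where "J = helicoid_density TYPE('k) y"
  have J: "0 < J" "J * J = 1 + (norm (coord_vec y :: real^('k::{finite,linorder})))\<^sup>2"
    using helicoid_density_pos[where 'k = 'k, of y]
    by (simp_all add: J_def helicoid_density_def real_sqrt_mult_self add_nonneg_nonneg del: real_sqrt_mult)
  let ?v = "\<lambda>i. helicoid_d1 i y :: 'k ambient"
  let ?w = "?v(?n := (1 / J) *\<^sub>R ?v ?n)"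
  have "\<phi> ?v = \<phi> (?w(?n := J *\<^sub>R ?w ?n))"
    using J by (intro arg_cong[where f = \<phi>]) auto
  also have "\<dots> = J * \<phi> (?w(?n := ?w ?n))"
    using linear_cmul[OF alternating_multilinear_linear[OF \<phi>(1), of ?n ?w], of J "?w ?n"] by simp
  also have "?w(?n := ?w ?n) = ?w" by simp
  finally have eq: "\<phi> ?v = J * \<phi> ?w" .
  have "\<bar>\<phi> ?w\<bar> \<le> 1"
  proof (rule abs_le_comass[OF _ \<phi>(2)])
    fix i j assume ij: "i < Suc ?n" "j < Suc ?n"
    have "(1 / J) * ((1 / J) * (1 + (norm (coord_vec y :: real^('k::{finite,linorder})))\<^sup>2)) = 1"
      using J(1) unfolding J(2)[symmetric] by simp
    then show "?w i \<bullet> ?w j = (if i = j then 1 else 0)"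
      using ij inner_rotated_axis_rotation_field[where 'k = 'k]
      by (cases "i = ?n"; cases "j = ?n")
         (auto simp: helicoid_d1_less helicoid_d1_last inner_rotated_axis inner_rotation_field inner_commute add.commute)
  qed
  then show ?thesis
    using J(1) by (simp add: eq abs_mult mult_left_le flip: J_def)
qed

section \<open>Determinants of pairings of orthonormal frames\<close>

lemma bessel_inequality:
  fixes f :: "'p::finite \<Rightarrow> 'a::real_inner"
  assumes f: "\<And>p q. f p \<bullet> f q = (if p = q then 1 else 0)"
  shows "(\<Sum>p\<in>UNIV. (f p \<bullet> w)\<^sup>2) \<le> (norm w)\<^sup>2"
proof -
  define z where "z = (\<Sum>p\<in>UNIV. (f p \<bullet> w) *\<^sub>R f p)"
  have "w \<bullet> z = (\<Sum>p\<in>UNIV. (f p \<bullet> w)\<^sup>2)"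
    by (simp add: z_def inner_sum_right power2_eq_square inner_commute)
  moreover have "z \<bullet> z = (\<Sum>p\<in>UNIV. (f p \<bullet> w)\<^sup>2)"
    by (simp add: z_def inner_sum_right inner_sum_left f power2_eq_square if_distrib cong: if_cong)
  moreover have "0 \<le> (w - z) \<bullet> (w - z)" by simp
  ultimately show ?thesis
    by (simp add: inner_diff_left inner_diff_right inner_commute power2_norm_eq_inner)
qed

text \<open>The powers of a contraction \<open>A\<close> are contractions, so that their determinants, the powers of
  the determinant of \<open>A\<close>, are bounded.\<close>

lemma det_contraction_le_1:
  fixes A :: "real^'p^'p"
  assumes A: "\<And>x. norm (A *v x) \<le> norm x"
  shows "\<bar>det A\<bar> \<le> 1"
proof (rule ccontr)
  assume "\<not> \<bar>det A\<bar> \<le> 1"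
  \<comment> \<open>The number \<open>fact CARD('p)\<close> of terms in the Leibniz formula bounds
    the determinant of any matrix whose entries have absolute value at most 1.\<close>
  then obtain N where N: "fact CARD('p) < \<bar>det A\<bar> ^ N"
    using real_arch_pow[of "\<bar>det A\<bar>" "fact CARD('p)"] by auto
  define P where "P N = ((\<lambda>M. A ** M) ^^ N) (mat 1)" for N
  have contr: "norm (P N *v x) \<le> norm x" for N x
  proof (induction N)
    case (Suc N)
    have "P (Suc N) *v x = A *v (P N *v x)"
      by (simp add: P_def matrix_vector_mul_assoc)
    then show ?case using A[of "P N *v x"] Suc by simp
  qed (simp add: P_def)
  have det: "det (P N) = det A ^ N" for N
    by (induction N) (simp_all add: P_def det_mul)
  have entry: "\<bar>P N $ i $ j\<bar> \<le> 1" for i j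
  proof -
    have "P N $ i $ j = (P N *v axis j 1) $ i"
      by (simp add: matrix_vector_mul_component inner_axis)
    also have "\<bar>\<dots>\<bar> \<le> 1"
      using component_le_norm_cart[of "P N *v axis j 1" i] contr[of N "axis j 1"] by simp
    finally show ?thesis .
  qed
  have "\<bar>det (P N)\<bar> \<le> (\<Sum>p\<in>{p. p permutes (UNIV :: 'p set)}. \<bar>of_int (sign p) * (\<Prod>i\<in>UNIV. P N $ i $ p i)\<bar>)"
    unfolding det_def by (rule sum_abs)
  also have "\<dots> \<le> (\<Sum>p\<in>{p. p permutes (UNIV :: 'p set)}. 1)"
  proof (rule sum_mono)
    fix p :: "'p \<Rightarrow> 'p"
    have "(\<Prod>i\<in>UNIV. \<bar>P N $ i $ p i\<bar>) \<le> 1"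
      by (rule prod_le_1) (simp add: entry)
    then show "\<bar>of_int (sign p) * (\<Prod>i\<in>UNIV. P N $ i $ p i)\<bar> \<le> 1"
      by (simp add: abs_mult sign_def abs_prod)
  qed
  also have "\<dots> = fact CARD('p)"
    by (simp add: card_permutations)
  finally show False
    using N by (simp add: det power_abs)
qed

text \<open>Up to transposition the matrix represents the orthogonal projection from the span of
  \<open>v\<close> to the span of \<open>f\<close> in orthonormal coordinates, which is a
  contraction by Bessel's inequality.\<close>

lemma det_orthonormal_frames_le_1:
  fixes f v :: "'p::finite \<Rightarrow> 'a::euclidean_space"
  assumes f: "\<And>p q. f p \<bullet> f q = (if p = q then 1 else 0)"
    and v: "\<And>p q. v p \<bullet> v q = (if p = q then 1 else 0)"
  shows "\<bar>det (\<chi> q p. f p \<bullet> v q)\<bar> \<le> 1"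
proof -
  define A :: "real^'p^'p" where "A = (\<chi> p q. f p \<bullet> v q)"
  have "norm (A *v x) \<le> norm x" for x
  proof -
    define w where "w = (\<Sum>q\<in>UNIV. (x $ q) *\<^sub>R v q)"
    have "A *v x = (\<chi> p. f p \<bullet> w)"
      by (simp add: A_def matrix_vector_mult_def w_def inner_sum_right mult.commute)
    then have "(norm (A *v x))\<^sup>2 = (\<Sum>p\<in>UNIV. (f p \<bullet> w)\<^sup>2)"
      by (simp only: power2_norm_eq_inner inner_vec_def vec_lambda_beta) (simp add: power2_eq_square)
    also have "\<dots> \<le> (norm w)\<^sup>2" by (rule bessel_inequality[OF f])
    also have "\<dots> = (norm x)\<^sup>2"
      by (simp add: w_def power2_norm_eq_inner inner_sum_right inner_sum_left v inner_vec_def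
          if_distrib cong: if_cong)
    finally show ?thesis by (rule power2_le_imp_le) simp
  qed
  then have "\<bar>det A\<bar> \<le> 1" by (rule det_contraction_le_1)
  moreover have "(\<chi> q p. f p \<bullet> v q) = transpose A"
    by (simp add: A_def transpose_def)
  ultimately show ?thesis by (simp add: det_transpose)
qed

text \<open>At the helicoid point with parameters \<open>(u, s)\<close> the vector
  \<open>cos s *\<^sub>R a + sin s *\<^sub>R b\<close> equals \<open>u\<close>, so this is the
  normalized tangent frame there. The expression makes sense at every \<open>(a, b, s)\<close>, and
  the frame stays orthonormal off the helicoid.\<close>

definition helicoid_frame :: "('k::{finite,linorder}) ambient \<Rightarrow> 'k option \<Rightarrow> 'k ambient" where
  "helicoid_frame x p = (case x of (a, b, s) \<Rightarrow> case p of
      Some i \<Rightarrow> rotated_axis (position i) s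
    | None \<Rightarrow> (1 / sqrt (1 + (norm (cos s *\<^sub>R a + sin s *\<^sub>R b))\<^sup>2)) *\<^sub>R rotation_field s (cos s *\<^sub>R a + sin s *\<^sub>R b) 1)"

text \<open>Determinants are indexed by a finite type, arguments of a covector by numbers;
  \<open>None\<close> stands for the direction \<open>s\<close>, which comes last.\<close>

definition slot :: "('k::{finite,linorder}) option \<Rightarrow> nat" where
  "slot q = (case q of Some i \<Rightarrow> position i | None \<Rightarrow> CARD('k))"

text \<open>The wedge product of the covectors dual to the frame, evaluated as a determinant of
  inner products and cut off to the ball. Closedness is not asserted: the form serves to detect the
  area of the helicoid.\<close>

definition calibration :: "real \<Rightarrow> nat \<Rightarrow> ('k::{finite,linorder}) ambient form" where
  "calibration r N x v = ball_cutoff r N x * det (\<chi> q p. helicoid_frame x p \<bullet> v (slot q))"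

lemma slot_less: "slot (q :: ('k::{finite,linorder}) option) < Suc CARD('k)"
  by (cases q) (simp_all add: slot_def less_Suc_eq)

lemma inj_slot: "inj (slot :: ('k::{finite,linorder}) option \<Rightarrow> nat)"
proof (rule injI)
  fix p q :: "'k option" assume "slot p = slot q"
  moreover have "position i \<noteq> CARD('k)" "CARD('k) \<noteq> position i" for i :: 'k
    using position_less[of i] by linarith+
  ultimately show "p = q"
    by (cases p; cases q) (simp_all add: slot_def inj_eq[OF inj_position])
qed

lemma slot_surj: "n < Suc CARD('k) \<Longrightarrow> \<exists>q :: ('k::{finite,linorder}) option. slot q = n"
  by (cases "n = CARD('k)")
     (auto simp: slot_def intro: exI[of _ None] exI[of _ "Some (at_position n)"])

lemma helicoid_frame_orthonormal:
  "helicoid_frame x p \<bullet> helicoid_frame x q = (if p = q then 1 else 0)"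
proof -
  obtain a b s where x: "x = (a, b, s)" by (cases x)
  define w where "w = cos s *\<^sub>R a + sin s *\<^sub>R b"
  have "0 < 1 + (norm w)\<^sup>2" by (simp add: add_pos_nonneg)
  then have "1 / sqrt (1 + (norm w)\<^sup>2) * (1 / sqrt (1 + (norm w)\<^sup>2) * ((norm w)\<^sup>2 + 1)) = 1"
    by (simp add: add.commute)
  then show ?thesis
    by (cases p; cases q)
       (auto simp: helicoid_frame_def x inner_rotated_axis inner_rotated_axis_rotation_field
          inner_rotation_field inj_eq[OF inj_position] inner_commute[of "rotation_field _ _ _" "rotated_axis _ _"]
        simp flip: w_def)
qed

lemma comass_calibration: "comass (Suc CARD('k)) (calibration r N (x :: ('k::{finite,linorder}) ambient)) \<le> 1"
  unfolding comass_def
proof (rule SUP_least)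
  fix v :: "nat \<Rightarrow> 'k ambient"
  assume v: "v \<in> {v. \<forall>i<Suc CARD('k). \<forall>j<Suc CARD('k). v i \<bullet> v j = (if i = j then 1 else 0)}"
  have "v (slot p) \<bullet> v (slot q) = (if p = q then 1 else 0)" for p q :: "'k option"
    using v slot_less[of p] slot_less[of q] by (simp add: inj_eq[OF inj_slot])
  then have "\<bar>det (\<chi> q p. helicoid_frame x p \<bullet> v (slot q))\<bar> \<le> 1"
    by (rule det_orthonormal_frames_le_1[OF helicoid_frame_orthonormal])
  then have "\<bar>calibration r N x v\<bar> \<le> 1 * 1"
    unfolding calibration_def abs_mult
    by (intro mult_mono) (auto simp: ball_cutoff_bounds)
  then show "ennreal \<bar>calibration r N x v\<bar> \<le> 1"
    by (simp flip: ennreal_1 add: ennreal_leI)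
qed

lemma alternating_multilinear_calibration:
  "alternating_multilinear (Suc CARD('k)) (calibration r N (x :: ('k::{finite,linorder}) ambient))"
  unfolding alternating_multilinear_def
proof (intro conjI allI impI)
  fix v w :: "nat \<Rightarrow> 'k ambient" assume "\<forall>i<Suc CARD('k). v i = w i"
  moreover have "slot q < Suc CARD('k)" for q :: "'k option"
    by (rule slot_less)
  ultimately show "calibration r N x v = calibration r N x w"
    by (simp add: calibration_def)
next
  fix v :: "nat \<Rightarrow> 'k ambient" and i assume "i < Suc CARD('k)"
  then obtain q0 where q0: "slot (q0 :: 'k option) = i" using slot_surj by blast
  have eq: "(\<chi> q p. helicoid_frame x p \<bullet> (v(i := w)) (slot q)) =
      (\<chi> q. if q = q0 then (\<chi> p. helicoid_frame x p \<bullet> w) else (\<chi> p. helicoid_frame x p \<bullet> v (slot q)))" for w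
    using inj_eq[OF inj_slot] by (auto simp: vec_eq_iff simp flip: q0)
  have add: "(\<chi> p. helicoid_frame x p \<bullet> (w + w')) = (\<chi> p. helicoid_frame x p \<bullet> w) + (\<chi> p. helicoid_frame x p \<bullet> w')" for w w'
    by (simp add: vec_eq_iff inner_add_right)
  have scale: "(\<chi> p. helicoid_frame x p \<bullet> (d *\<^sub>R w)) = d *s (\<chi> p. helicoid_frame x p \<bullet> w)" for d w
    by (simp add: vec_eq_iff)
  show "linear (\<lambda>w. calibration r N x (v(i := w)))"
    by (rule linearI)
       (simp_all only: calibration_def eq add scale det_row_add det_row_mul real_scaleR_def distrib_left mult.left_commute)
next
  fix v :: "nat \<Rightarrow> 'k ambient" and i j assume ij: "i < j \<and> j < Suc CARD('k) \<and> v i = v j"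
  then obtain p q where pq: "slot (p :: 'k option) = i" "slot (q :: 'k option) = j"
    using slot_surj by (meson less_trans)
  with ij have "p \<noteq> q" by auto
  then have "det (\<chi> q p. helicoid_frame x p \<bullet> v (slot q)) = 0"
    by (rule det_identical_rows) (use ij pq in \<open>simp add: row_def\<close>)
  then show "calibration r N x v = 0" by (simp add: calibration_def)
qed

text \<open>All components are built from coordinates, sines and cosines, and the inverse square
  root of a function that is at least 1, so no singularity arises.\<close>

lemma smooth_term_helicoid_frame: "smooth_term (\<lambda>x. helicoid_frame x p \<bullet> (w :: ('k::{finite,linorder}) ambient))"
proof -
  obtain w1 w2 w3 where w: "w = (w1, w2, w3)" by (cases w)
  have s: "smooth_term (\<lambda>x :: 'k ambient. snd (snd x))"
    using smooth_term.inner[of "(0, 0, 1) :: 'k ambient"] by (simp add: inner_prod_def)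
  have a: "smooth_term (\<lambda>x :: 'k ambient. fst x \<bullet> u)" for u
    using smooth_term.inner[of "(u, 0, 0) :: 'k ambient"] by (simp add: inner_prod_def)
  have b: "smooth_term (\<lambda>x :: 'k ambient. fst (snd x) \<bullet> u)" for u
    using smooth_term.inner[of "(0, u, 0) :: 'k ambient"] by (simp add: inner_prod_def)
  note rules = smooth_term.add smooth_term_minus smooth_term.mult smooth_term_sin smooth_term_cos s
  define W :: "'k ambient \<Rightarrow> _" where
    "W x = cos (snd (snd x)) *\<^sub>R fst x + sin (snd (snd x)) *\<^sub>R fst (snd x)" for x
  have W: "smooth_term (\<lambda>x. W x \<bullet> u)" for u
    unfolding W_def inner_add_left inner_scaleR_left by (intro rules a b)
  have "smooth_term (\<lambda>x. \<Sum>i\<in>Basis. (W x \<bullet> i) ^ 2)"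
    by (intro smooth_term_sum smooth_term_power W)
  moreover have "(\<Sum>i\<in>Basis. (W x \<bullet> i) ^ 2) = (norm (W x))\<^sup>2" for x
    unfolding power2_norm_eq_inner by (subst (2) euclidean_inner) (simp add: power2_eq_square)
  ultimately have W2: "smooth_term (\<lambda>x. (norm (W x))\<^sup>2)" by simp
  show ?thesis
  proof (cases p)
    case None
    have "smooth_term (\<lambda>x. (1 / sqrt (1 + (norm (W x))\<^sup>2)) *
        ((- 1) * (sin (snd (snd x)) * (W x \<bullet> w1)) + cos (snd (snd x)) * (W x \<bullet> w2) + w3))"
      by (intro rules smooth_term_inverse_sqrt W2 W smooth_term.const) (simp add: add_pos_nonneg)
    also have "(\<lambda>x. (1 / sqrt (1 + (norm (W x))\<^sup>2)) *
        ((- 1) * (sin (snd (snd x)) * (W x \<bullet> w1)) + cos (snd (snd x)) * (W x \<bullet> w2) + w3)) =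
        (\<lambda>x. helicoid_frame x p \<bullet> w)"
      by (auto simp: fun_eq_iff helicoid_frame_def None w W_def rotation_field_def
          add_divide_distrib diff_divide_distrib)
    finally show ?thesis .
  next
    case (Some i)
    have "smooth_term (\<lambda>x :: 'k ambient. cos (snd (snd x)) * (axis i 1 \<bullet> w1) + sin (snd (snd x)) * (axis i 1 \<bullet> w2))"
      by (intro rules smooth_term.const)
    also have "(\<lambda>x :: 'k ambient. cos (snd (snd x)) * (axis i 1 \<bullet> w1) + sin (snd (snd x)) * (axis i 1 \<bullet> w2)) =
        (\<lambda>x. helicoid_frame x p \<bullet> w)"
      by (auto simp: fun_eq_iff helicoid_frame_def Some w rotated_axis_def)
    finally show ?thesis .
  qed
qed

lemma calibration_test_form:
  assumes "0 < r"
  shows "(calibration r N :: ('k::{finite,linorder}) ambient form) \<in> test_forms (Suc CARD('k))"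
proof -
  have "smooth (\<lambda>x. calibration r N x v)" for v :: "nat \<Rightarrow> 'k ambient"
    unfolding calibration_def det_def
    by (intro smooth_if_smooth_term smooth_term.mult smooth_term_sum smooth_term_prod smooth_term.const
        smooth_term_ball_cutoff) (simp add: smooth_term_helicoid_frame)
  moreover have "form_support (calibration r N :: 'k ambient form) \<subseteq> cball 0 r"
    unfolding form_support_def
  proof (rule closure_minimal)
    show "{x. calibration r N (x :: 'k ambient) \<noteq> (\<lambda>_. 0)} \<subseteq> cball 0 r"
    proof (intro subsetI, rule ccontr)
      fix x :: "'k ambient" assume x: "x \<in> {x. calibration r N x \<noteq> (\<lambda>_. 0)}" "x \<notin> cball 0 r"
      then have "ball_cutoff r N x = 0" using assms by (intro ball_cutoff_outside) auto
      then show False using x(1) by (simp add: calibration_def fun_eq_iff)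
    qed
  qed simp
  moreover have "closed (form_support (calibration r N :: 'k ambient form))"
    by (simp add: form_support_def)
  ultimately have "\<forall>v. smooth (\<lambda>x :: 'k ambient. calibration r N x v)"
    "compact (form_support (calibration r N :: 'k ambient form))"
    using compact_closed_subset[OF compact_cball] by blast+
  then show ?thesis
    unfolding test_forms_def mem_Collect_eq
    by (intro conjI allI alternating_multilinear_calibration) auto
qed

text \<open>On the helicoid the frame is the normalized tangent frame, so the matrix is diagonal:
  its entries are 1 except for the length of the last tangent vector.\<close>

lemma calibration_helicoid:
  "calibration r N (helicoid y) (\<lambda>i. helicoid_d1 i y :: ('k::{finite,linorder}) ambient) =
     ball_cutoff r N (helicoid y :: 'k ambient) * helicoid_density TYPE('k) y"
proof -
  let ?s = "y CARD('k)" and ?u = "coord_vec y :: real^('k::{finite,linorder})"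
  let ?M = "(\<chi> q p. helicoid_frame (helicoid y :: 'k ambient) p \<bullet> helicoid_d1 (slot q) y) :: real^('k option)^('k option)"
  have "cos ?s *\<^sub>R cos ?s *\<^sub>R ?u + sin ?s *\<^sub>R sin ?s *\<^sub>R ?u = (cos ?s * cos ?s + sin ?s * sin ?s) *\<^sub>R ?u"
    by (simp only: scaleR_scaleR scaleR_add_left)
  then have w: "cos ?s *\<^sub>R cos ?s *\<^sub>R ?u + sin ?s *\<^sub>R sin ?s *\<^sub>R ?u = ?u"
    by (simp only: sin_cos_squared_add3 scaleR_one)
  have frame: "helicoid_frame (helicoid y :: 'k ambient) (Some i) = rotated_axis (position i) ?s"
    "helicoid_frame (helicoid y :: 'k ambient) None = (1 / helicoid_density TYPE('k) y) *\<^sub>R rotation_field ?s ?u 1" for i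
    using w by (simp_all add: helicoid_frame_def moving_helicoid_def Let_def helicoid_density_def)
  have d1: "helicoid_d1 (slot (Some i)) y = (rotated_axis (position i) ?s :: 'k ambient)"
    "helicoid_d1 (slot (None :: 'k option)) y = (rotation_field ?s ?u 1 :: 'k ambient)" for i :: 'k
    by (simp_all add: slot_def helicoid_d1_less helicoid_d1_last)
  have J: "(1 + (norm ?u)\<^sup>2) = helicoid_density TYPE('k) y * helicoid_density TYPE('k) y"
    by (simp add: helicoid_density_def add_nonneg_nonneg)
  have entries: "?M $ q $ p = (if p = q then (case q of None \<Rightarrow> helicoid_density TYPE('k) y | Some _ \<Rightarrow> 1) else 0)" for p q
    using helicoid_density_pos[where 'k = 'k, of y] J
    by (cases p; cases q)
       (auto simp: frame d1 inner_rotated_axis inner_rotated_axis_rotation_field inner_rotation_field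
          inj_eq[OF inj_position] inner_commute[of "rotation_field _ _ _" "rotated_axis _ _"] add.commute)
  have "det ?M = (\<Prod>q\<in>UNIV. ?M $ q $ q)"
    by (rule det_diagonal) (simp only: entries, simp)
  also have "\<dots> = helicoid_density TYPE('k) y"
    unfolding entries by (simp add: UNIV_option_conv prod.reindex)
  finally show ?thesis by (simp add: calibration_def)
qed

section \<open>Restricting the helicoid to a ball\<close>

lemma C2_map_mono: "C2_map m f f1 f2 \<Longrightarrow> m' \<le> m \<Longrightarrow> C2_map m' f f1 f2"
  unfolding C2_map_def by (meson order_less_le_trans)

lemma C2_map_helicoid:
  "C2_map (Suc CARD('k::{finite,linorder})) (moving_helicoid a c \<tau> :: _ \<Rightarrow> 'k ambient)
     (moving_helicoid_d1 a c \<tau>) (moving_helicoid_d2 a c)"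
  by (rule C2_map_mono[OF C2_map_moving_helicoid]) simp

text \<open>The cut-offs of the ball are an admissible sequence, so the limit that defines the
  restriction is unique once all admissible sequences have the same limit.\<close>

lemma restrict_current_eqI:
  fixes T :: "'a::euclidean_space current"
  assumes "0 < r" and lim: "\<And>\<phi> :: nat \<Rightarrow> 'a \<Rightarrow> real.
     (\<And>n. smooth (\<phi> n)) \<Longrightarrow> (\<And>n x. 0 \<le> \<phi> n x) \<Longrightarrow> (\<And>n x. \<phi> n x \<le> 1) \<Longrightarrow>
     (\<And>x. (\<lambda>n. \<phi> n x) \<longlonglongrightarrow> indicat_real (ball 0 r) x) \<Longrightarrow>
     (\<lambda>n. T (\<lambda>x v. \<phi> n x * \<omega> x v)) \<longlonglongrightarrow> l"
  shows "restrict_current T (ball 0 r) \<omega> = l"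
  unfolding restrict_current_def
proof (rule the_equality)
  let ?P = "\<lambda>l. \<forall>\<phi> :: nat \<Rightarrow> 'a \<Rightarrow> real.
     (\<forall>n. smooth (\<phi> n)) \<and> (\<forall>n x. 0 \<le> \<phi> n x \<and> \<phi> n x \<le> 1) \<and>
     (\<forall>x. (\<lambda>n. \<phi> n x) \<longlonglongrightarrow> indicat_real (ball 0 r) x)
     \<longrightarrow> (\<lambda>n. T (\<lambda>x v. \<phi> n x * \<omega> x v)) \<longlonglongrightarrow> l"
  show "?P l"
    by (intro allI impI) (rule lim; simp)
  fix l' assume l': "?P l'"
  have "(\<lambda>n. T (\<lambda>x v. ball_cutoff r n x * \<omega> x v)) \<longlonglongrightarrow> l'"
    by (rule l'[rule_format, of "ball_cutoff r"])
       (simp add: smooth_if_smooth_term[OF smooth_term_ball_cutoff] ball_cutoff_bounds ball_cutoff_tendsto[OF assms(1)])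
  moreover have "(\<lambda>n. T (\<lambda>x v. ball_cutoff r n x * \<omega> x v)) \<longlonglongrightarrow> l"
    by (rule lim) (auto simp: smooth_if_smooth_term[OF smooth_term_ball_cutoff]
        ball_cutoff_bounds ball_cutoff_tendsto[OF assms(1)])
  ultimately show "l' = l" by (rule LIMSEQ_unique)
qed

lemma cutoff_integral_tendsto:
  fixes f :: "(nat \<Rightarrow> real) \<Rightarrow> 'a::euclidean_space"
  assumes \<phi>: "\<And>n. smooth (\<phi> n)" "\<And>n x. 0 \<le> \<phi> n x" "\<And>n x. \<phi> n x \<le> 1"
      "\<And>x. (\<lambda>n. \<phi> n x) \<longlonglongrightarrow> indicat_real (ball 0 r) x"
    and f: "continuous_on UNIV f" and h: "integrable (lborel_pow m) h"
  shows "(\<lambda>n. LINT y|lborel_pow m. \<phi> n (f y) * h y) \<longlonglongrightarrow>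
     (LINT y|lborel_pow m. indicat_real (ball 0 r) (f y) * h y)"
proof (rule integral_dominated_convergence[where w = "\<lambda>y. \<bar>h y\<bar>"])
  have "f \<in> borel_measurable (lborel_pow m)"
    by (rule borel_measurable_continuous_lborel_pow[OF f])
  then show "(\<lambda>y. indicat_real (ball 0 r) (f y) * h y) \<in> borel_measurable (lborel_pow m)"
    by (intro borel_measurable_times measurable_compose[OF _ borel_measurable_indicator]
        borel_measurable_integrable[OF h]) auto
  show "(\<lambda>y. \<phi> n (f y) * h y) \<in> borel_measurable (lborel_pow m)" for n
    by (intro borel_measurable_times borel_measurable_integrable[OF h] borel_measurable_continuous_lborel_pow
        continuous_on_compose2[OF smooth_continuous_on[OF \<phi>(1)] f]) auto
  show "integrable (lborel_pow m) (\<lambda>y. \<bar>h y\<bar>)" using h by simp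
  show "AE y in lborel_pow m. (\<lambda>n. \<phi> n (f y) * h y) \<longlonglongrightarrow> indicat_real (ball 0 r) (f y) * h y"
    by (intro AE_I2 tendsto_mult_right \<phi>)
  show "AE y in lborel_pow m. norm (\<phi> n (f y) * h y) \<le> \<bar>h y\<bar>" for n
    using \<phi>(2,3) by (intro AE_I2) (simp add: abs_mult mult_left_le_one_le)
qed

text \<open>Dominated convergence; the cube is mapped into the ball, where the limit of the cut-offs
  is 1, so restricting changes nothing.\<close>

lemma param_current_cutoff_tendsto:
  fixes f :: "(nat \<Rightarrow> real) \<Rightarrow> 'a::euclidean_space"
  assumes \<phi>: "\<And>n. smooth (\<phi> n)" "\<And>n x. 0 \<le> \<phi> n x" "\<And>n x. \<phi> n x \<le> 1"
      "\<And>x. (\<lambda>n. \<phi> n x) \<longlonglongrightarrow> indicat_real (ball 0 r) x"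
    and f: "C2_map m f f1 f2" "f ` open_cube m \<subseteq> ball 0 r" and \<omega>: "smooth_form m \<omega>"
  shows "(\<lambda>n. param_current m (open_cube m) f (\<lambda>x v. \<phi> n x * \<omega> x v)) \<longlonglongrightarrow> param_current m (open_cube m) f \<omega>"
proof -
  let ?h = "\<lambda>y. indicator (open_cube m) y * \<omega> (f y) (\<lambda>i. f1 i y)"
  have "integrable (lborel_pow m) ?h"
    using set_integrable_open_cube[OF continuous_on_C2_pullback[OF f(1) \<omega>]] by (simp add: set_integrable_def)
  then have "(\<lambda>n. LINT y|lborel_pow m. \<phi> n (f y) * ?h y) \<longlonglongrightarrow>
     (LINT y|lborel_pow m. indicat_real (ball 0 r) (f y) * ?h y)"
    using f(1) by (intro cutoff_integral_tendsto[OF \<phi>]) (auto simp: C2_map_def)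
  moreover have "(\<lambda>y. indicat_real (ball 0 r) (f y) * ?h y) = ?h"
    using f(2) by (auto simp: indicator_def fun_eq_iff)
  moreover have "param_current m (open_cube m) f (\<lambda>x v. \<phi> n x * \<omega> x v) = (LINT y|lborel_pow m. \<phi> n (f y) * ?h y)" for n
  proof -
    have "param_current m (open_cube m) f (\<lambda>x v. \<phi> n x * \<omega> x v) =
        (LINT y:open_cube m|lborel_pow m. \<phi> n (f y) * \<omega> (f y) (\<lambda>i. f1 i y))"
    proof (rule param_current_C2[OF f(1)])
      fix x and v w :: "nat \<Rightarrow> 'a" assume "\<And>i. i < m \<Longrightarrow> v i = w i"
      from smooth_form_cong[OF \<omega> this] show "\<phi> n x * \<omega> x v = \<phi> n x * \<omega> x w" by simp
    qed
    then show ?thesis by (simp add: set_lebesgue_integral_def mult.left_commute)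
  qed
  moreover have "param_current m (open_cube m) f \<omega> = (LINT y|lborel_pow m. ?h y)"
    by (subst param_current_C2[OF f(1)]) (auto simp: set_lebesgue_integral_def intro: smooth_form_cong[OF \<omega>])
  ultimately show ?thesis by simp
qed

lemma cube_boundary_cutoff_tendsto:
  fixes F :: "(nat \<Rightarrow> real) \<Rightarrow> 'a::euclidean_space"
  assumes \<phi>: "\<And>n. smooth (\<phi> n)" "\<And>n x. 0 \<le> \<phi> n x" "\<And>n x. \<phi> n x \<le> 1"
      "\<And>x. (\<lambda>n. \<phi> n x) \<longlonglongrightarrow> indicat_real (ball 0 r) x"
    and F: "C2_map (Suc m) F F1 F2" "F ` ({..<Suc m} \<rightarrow>\<^sub>E {0..1}) \<subseteq> ball 0 r" and \<omega>: "smooth_form m \<omega>"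
  shows "(\<lambda>n. cube_boundary m F (\<lambda>x v. \<phi> n x * \<omega> x v)) \<longlonglongrightarrow> cube_boundary m F \<omega>"
  unfolding cube_boundary_def
proof (intro tendsto_sum tendsto_mult_left tendsto_diff)
  fix i assume i: "i \<in> {..<Suc m}"
  have "(\<lambda>n. param_current m (open_cube m) (\<lambda>z. F (insert_at i c z)) (\<lambda>x v. \<phi> n x * \<omega> x v)) \<longlonglongrightarrow>
      param_current m (open_cube m) (\<lambda>z. F (insert_at i c z)) \<omega>" if "c = 0 \<or> c = 1" for c
    using i that F(2) insert_at_in_box
    by (intro param_current_cutoff_tendsto[OF \<phi> C2_map_face[OF F(1)] _ \<omega>]) blast
  then show "(\<lambda>n. param_current m (open_cube m) (\<lambda>z. F (insert_at i 1 z)) (\<lambda>x v. \<phi> n x * \<omega> x v)) \<longlonglongrightarrow>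
      param_current m (open_cube m) (\<lambda>z. F (insert_at i 1 z)) \<omega>"
    "(\<lambda>n. param_current m (open_cube m) (\<lambda>z. F (insert_at i 0 z)) (\<lambda>x v. \<phi> n x * \<omega> x v)) \<longlonglongrightarrow>
      param_current m (open_cube m) (\<lambda>z. F (insert_at i 0 z)) \<omega>"
    by auto
qed

section \<open>Properness of the helicoid and integrals over its part in a ball\<close>

lemma norm_moving_helicoid:
  "(norm (moving_helicoid a c \<tau> y :: ('k::{finite,linorder}) ambient))\<^sup>2 =
     (norm (affine_vec a c y :: real^('k::{finite,linorder})))\<^sup>2 +
     (a CARD('k) + c CARD('k) * y CARD('k) + \<tau> * y (Suc CARD('k)))\<^sup>2"
proof -
  let ?s = "a CARD('k) + c CARD('k) * y CARD('k)" and ?V = "affine_vec a c y :: real^('k::{finite,linorder})"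
  have "cos ?s * (cos ?s * (?V \<bullet> ?V)) + sin ?s * (sin ?s * (?V \<bullet> ?V)) =
      (cos ?s * cos ?s + sin ?s * sin ?s) * (?V \<bullet> ?V)"
    by (simp only: distrib_right mult.assoc)
  then have eq: "cos ?s * (cos ?s * (?V \<bullet> ?V)) + sin ?s * (sin ?s * (?V \<bullet> ?V)) = ?V \<bullet> ?V"
    by (simp only: sin_cos_squared_add3 mult_1)
  have "(moving_helicoid a c \<tau> y :: 'k ambient) \<bullet> moving_helicoid a c \<tau> y =
      (cos ?s * (cos ?s * (?V \<bullet> ?V)) + sin ?s * (sin ?s * (?V \<bullet> ?V))) +
      (?s + \<tau> * y (Suc CARD('k))) * (?s + \<tau> * y (Suc CARD('k)))"
    by (simp add: moving_helicoid_def Let_def)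
  then show ?thesis
    by (simp only: eq power2_norm_eq_inner power2_eq_square[of "?s + \<tau> * y (Suc CARD('k))"])
qed

text \<open>The point with parameters \<open>(u, s)\<close> has squared norm
  \<open>(norm u)^2 + s^2\<close>, because the rotation by \<open>s\<close> preserves
  length.\<close>

lemma helicoid_proper:
  assumes "norm (helicoid y :: ('k::{finite,linorder}) ambient) \<le> \<rho>" "i < Suc CARD('k)"
  shows "\<bar>y i\<bar> \<le> \<rho>"
proof -
  have sq: "(norm (helicoid y :: 'k ambient))\<^sup>2 = (norm (coord_vec y :: real^('k::{finite,linorder})))\<^sup>2 + (y CARD('k))\<^sup>2"
    using norm_moving_helicoid[where 'k = 'k, of "\<lambda>_. 0" "\<lambda>_. 1" 0 y] by simp
  have "\<bar>y i\<bar> \<le> norm (helicoid y :: 'k ambient)"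
  proof (cases "i = CARD('k)")
    case True
    then show ?thesis by (intro power2_le_imp_le[of "\<bar>y i\<bar>"] norm_ge_zero) (simp add: sq)
  next
    case False
    then have "i < CARD('k)" using assms by simp
    then have "y i = (coord_vec y :: real^('k::{finite,linorder})) $ at_position i"
      by (simp add: affine_vec_def)
    then have "\<bar>y i\<bar> \<le> norm (coord_vec y :: real^('k::{finite,linorder}))"
      by (simp add: component_le_norm_cart)
    also have "\<dots> \<le> norm (helicoid y :: 'k ambient)"
      by (rule power2_le_imp_le) (simp_all add: sq)
    finally show ?thesis .
  qed
  with assms show ?thesis by linarith
qed

definition helicoid_ball :: "('k::{finite,linorder}) itself \<Rightarrow> real \<Rightarrow> (nat \<Rightarrow> real) set" where
  "helicoid_ball _ r = {y \<in> space (lborel_pow (Suc CARD('k))). (helicoid y :: 'k ambient) \<in> ball 0 r}"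

lemma helicoid_measurable: "(helicoid :: _ \<Rightarrow> ('k::{finite,linorder}) ambient) \<in> borel_measurable (lborel_pow m)"
  using C2_map_helicoid[where 'k = 'k] by (intro borel_measurable_continuous_lborel_pow) (auto simp: C2_map_def)

lemma helicoid_ball_sets [measurable]: "helicoid_ball TYPE('k::{finite,linorder}) r \<in> sets (lborel_pow (Suc CARD('k)))"
proof -
  have "helicoid_ball TYPE('k) r = helicoid -` (ball 0 r :: 'k ambient set) \<inter> space (lborel_pow (Suc CARD('k)))"
    by (auto simp: helicoid_ball_def)
  also have "\<dots> \<in> sets (lborel_pow (Suc CARD('k)))"
    by (rule measurable_sets[OF helicoid_measurable]) simp
  finally show ?thesis .
qed

lemma helicoid_ball_subset_box:
  "helicoid_ball TYPE('k::{finite,linorder}) r \<subseteq> {..<Suc CARD('k)} \<rightarrow>\<^sub>E {- r..r}"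
proof
  fix y assume y: "y \<in> helicoid_ball TYPE('k) r"
  then have n: "norm (helicoid y :: 'k ambient) \<le> r" and sp: "y \<in> extensional {..<Suc CARD('k)}"
    by (auto simp: helicoid_ball_def space_PiM PiE_def)
  have "y i \<in> {- r..r}" if "i < Suc CARD('k)" for i
    using helicoid_proper[OF n that] by auto
  with sp show "y \<in> {..<Suc CARD('k)} \<rightarrow>\<^sub>E {- r..r}"
    by (simp add: PiE_def Pi_def)
qed

text \<open>The support of the form lies in a ball, whose preimage under the helicoid lies in a box
  by properness.\<close>

lemma integrable_helicoid_pullback:
  fixes \<omega> :: "('k::{finite,linorder}) ambient form"
  assumes \<omega>: "\<omega> \<in> test_forms (Suc CARD('k))"
  shows "integrable (lborel_pow (Suc CARD('k))) (\<lambda>y. \<omega> (helicoid y) (\<lambda>i. helicoid_d1 i y))"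
proof -
  have "bounded (form_support \<omega>)"
    using \<omega> by (auto simp: test_forms_def compact_imp_bounded)
  then obtain \<rho> where \<rho>: "form_support \<omega> \<subseteq> ball 0 \<rho>"
    using bounded_subset_ballD by blast
  have "set_integrable (lborel_pow (Suc CARD('k))) (helicoid_ball TYPE('k) \<rho>)
      (\<lambda>y. \<omega> (helicoid y) (\<lambda>i. helicoid_d1 i y))"
    by (rule set_integrable_continuous_box[OF
          continuous_on_C2_pullback[OF C2_map_helicoid smooth_form_if_test_form[OF \<omega>]]
          helicoid_ball_sets helicoid_ball_subset_box])
  from this[unfolded set_integrable_def] have int: "integrable (lborel_pow (Suc CARD('k)))
      (\<lambda>y. indicat_real (helicoid_ball TYPE('k) \<rho>) y *\<^sub>R \<omega> (helicoid y) (\<lambda>i. helicoid_d1 i y))" .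
  have eq: "indicat_real (helicoid_ball TYPE('k) \<rho>) y *\<^sub>R \<omega> (helicoid y) (\<lambda>i. helicoid_d1 i y) =
        \<omega> (helicoid y) (\<lambda>i. helicoid_d1 i y)" if y: "y \<in> space (lborel_pow (Suc CARD('k)))" for y
  proof (cases "y \<in> helicoid_ball TYPE('k) \<rho>")
    case False
    then have "(helicoid y :: 'k ambient) \<notin> form_support \<omega>"
      using \<rho> y by (auto simp: helicoid_ball_def)
    from form_zero_outside_support[OF this] show ?thesis by simp
  qed simp
  show ?thesis
    by (rule Bochner_Integration.integrable_cong[OF refl eq, THEN iffD1, OF _ int])
qed

lemma helicoid_current_eq:
  fixes \<omega> :: "('k::{finite,linorder}) ambient form"
  assumes "\<And>x v w. (\<And>i. i < Suc CARD('k) \<Longrightarrow> v i = w i) \<Longrightarrow> \<omega> x v = \<omega> x w"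
  shows "helicoid_current \<omega> = (LINT y|lborel_pow (Suc CARD('k)). \<omega> (helicoid y) (\<lambda>i. helicoid_d1 i y))"
proof -
  have "helicoid_current \<omega> = (LINT y:{..<Suc CARD('k)} \<rightarrow>\<^sub>E UNIV|lborel_pow (Suc CARD('k)).
      \<omega> (helicoid y) (\<lambda>i. helicoid_d1 i y))"
    unfolding helicoid_current_def helicoid_eq Suc_eq_plus1[symmetric]
    by (rule param_current_C2[OF C2_map_helicoid assms])
  also have "\<dots> = (LINT y|lborel_pow (Suc CARD('k)). \<omega> (helicoid y) (\<lambda>i. helicoid_d1 i y))"
    unfolding set_lebesgue_integral_def
    by (rule Bochner_Integration.integral_cong) (auto simp: space_PiM)
  finally show ?thesis .
qed

lemma helicoid_current_cutoff_tendsto: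
  fixes \<omega> :: "('k::{finite,linorder}) ambient form"
  assumes \<phi>: "\<And>n. smooth (\<phi> n)" "\<And>n x. 0 \<le> \<phi> n x" "\<And>n x. \<phi> n x \<le> 1"
      "\<And>x. (\<lambda>n. \<phi> n x) \<longlonglongrightarrow> indicat_real (ball 0 r) x"
    and \<omega>: "\<omega> \<in> test_forms (Suc CARD('k))"
  shows "(\<lambda>n. helicoid_current (\<lambda>x v. \<phi> n x * \<omega> x v)) \<longlonglongrightarrow>
    (LINT y:helicoid_ball TYPE('k) r|lborel_pow (Suc CARD('k)). \<omega> (helicoid y) (\<lambda>i. helicoid_d1 i y))"
proof -
  have "(\<lambda>n. LINT y|lborel_pow (Suc CARD('k)). \<phi> n (helicoid y) * \<omega> (helicoid y) (\<lambda>i. helicoid_d1 i y)) \<longlonglongrightarrow>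
     (LINT y|lborel_pow (Suc CARD('k)). indicat_real (ball 0 r) (helicoid y :: 'k ambient) * \<omega> (helicoid y) (\<lambda>i. helicoid_d1 i y))"
    using C2_map_helicoid[where 'k = 'k]
    by (intro cutoff_integral_tendsto[OF \<phi>] integrable_helicoid_pullback[OF \<omega>]) (auto simp: C2_map_def)
  moreover have "helicoid_current (\<lambda>x v. \<phi> n x * \<omega> x v) =
      (LINT y|lborel_pow (Suc CARD('k)). \<phi> n (helicoid y) * \<omega> (helicoid y) (\<lambda>i. helicoid_d1 i y))" for n
  proof (rule helicoid_current_eq)
    fix x and v w :: "nat \<Rightarrow> 'k ambient" assume "\<And>i. i < Suc CARD('k) \<Longrightarrow> v i = w i"
    from smooth_form_cong[OF smooth_form_if_test_form[OF \<omega>] this]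
    show "\<phi> n x * \<omega> x v = \<phi> n x * \<omega> x w" by simp
  qed
  moreover have "(LINT y|lborel_pow (Suc CARD('k)). indicat_real (ball 0 r) (helicoid y :: 'k ambient) * \<omega> (helicoid y) (\<lambda>i. helicoid_d1 i y)) =
      (LINT y:helicoid_ball TYPE('k) r|lborel_pow (Suc CARD('k)). \<omega> (helicoid y) (\<lambda>i. helicoid_d1 i y))"
    unfolding set_lebesgue_integral_def
    by (rule Bochner_Integration.integral_cong) (auto simp: helicoid_ball_def indicator_def)
  ultimately show ?thesis by simp
qed

lemma restrict_helicoid_current:
  fixes \<omega> :: "('k::{finite,linorder}) ambient form"
  assumes "0 < r" "\<omega> \<in> test_forms (Suc CARD('k))"
  shows "restrict_current helicoid_current (ball 0 r) \<omega> =
    (LINT y:helicoid_ball TYPE('k) r|lborel_pow (Suc CARD('k)). \<omega> (helicoid y) (\<lambda>i. helicoid_d1 i y))"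
  by (rule restrict_current_eqI[OF assms(1)]) (rule helicoid_current_cutoff_tendsto[OF _ _ _ _ assms(2)])

lemma restrict_helicoid_current_plus:
  fixes \<omega> :: "('k::{finite,linorder}) ambient form"
  assumes "0 < r" "\<omega> \<in> test_forms (Suc CARD('k))"
    and F: "C2_map (Suc (Suc CARD('k))) F F1 F2" "F ` ({..<Suc (Suc CARD('k))} \<rightarrow>\<^sub>E {0..1}) \<subseteq> ball 0 r"
  shows "restrict_current (\<lambda>\<omega>. helicoid_current \<omega> + cube_boundary (Suc CARD('k)) F \<omega>) (ball 0 r) \<omega> =
    (LINT y:helicoid_ball TYPE('k) r|lborel_pow (Suc CARD('k)). \<omega> (helicoid y) (\<lambda>i. helicoid_d1 i y)) +
    cube_boundary (Suc CARD('k)) F \<omega>"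
  by (rule restrict_current_eqI[OF assms(1)], rule tendsto_add)
     (rule helicoid_current_cutoff_tendsto[OF _ _ _ _ assms(2)]
           cube_boundary_cutoff_tendsto[OF _ _ _ _ F smooth_form_if_test_form[OF assms(2)]], assumption+)+

lemma continuous_on_helicoid_density: "continuous_on UNIV (helicoid_density TYPE('k::{finite,linorder}))"
  unfolding helicoid_density_def[abs_def] by (intro continuous_intros)

lemma set_integrable_helicoid_density:
  assumes "A \<in> sets (lborel_pow (Suc CARD('k)))" "A \<subseteq> helicoid_ball TYPE('k::{finite,linorder}) r"
  shows "set_integrable (lborel_pow (Suc CARD('k))) A (helicoid_density TYPE('k))"
  by (rule set_integrable_continuous_box[OF continuous_on_helicoid_density assms(1)
        order_trans[OF assms(2) helicoid_ball_subset_box]])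

text \<open>Each \<open>calibration r N\<close> is admissible in the supremum that defines the mass,
  and its value is the area weighted by the cut-off, which converges to the full area as
  \<open>N\<close> grows.\<close>

theorem mass_restrict_helicoid_ge:
  assumes "0 < r"
  shows "ennreal (LINT y:helicoid_ball TYPE('k) r|lborel_pow (Suc CARD('k)). helicoid_density TYPE('k) y) \<le>
    mass (Suc CARD('k)) (restrict_current (helicoid_current :: ('k::{finite,linorder}) ambient current) (ball 0 r))"
proof (rule LIMSEQ_le_const2)
  let ?A = "helicoid_ball TYPE('k) r" and ?L = "lborel_pow (Suc CARD('k))"
  let ?h = "\<lambda>y. indicator ?A y * helicoid_density TYPE('k) y"
  let ?c = "calibration r :: nat \<Rightarrow> 'k ambient form"
  have "(\<lambda>N. LINT y|?L. ball_cutoff r N (helicoid y :: 'k ambient) * ?h y) \<longlonglongrightarrow>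
      (LINT y|?L. indicat_real (ball 0 r) (helicoid y :: 'k ambient) * ?h y)"
  proof (rule cutoff_integral_tendsto)
    show "continuous_on UNIV (helicoid :: _ \<Rightarrow> 'k ambient)"
      using C2_map_helicoid[where 'k = 'k] by (auto simp: C2_map_def)
    show "integrable ?L ?h"
      using set_integrable_helicoid_density[OF helicoid_ball_sets order_refl, of r]
      by (simp add: set_integrable_def)
  qed (auto simp: smooth_if_smooth_term[OF smooth_term_ball_cutoff] ball_cutoff_bounds ball_cutoff_tendsto[OF assms])
  also have "(\<lambda>y. indicat_real (ball 0 r) (helicoid y :: 'k ambient) * ?h y) = ?h"
    by (auto simp: fun_eq_iff indicator_def helicoid_ball_def)
  also have "(\<lambda>N. LINT y|?L. ball_cutoff r N (helicoid y :: 'k ambient) * ?h y) =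
      (\<lambda>N. restrict_current helicoid_current (ball 0 r) (?c N))"
    by (simp add: restrict_helicoid_current[OF assms calibration_test_form[OF assms]] calibration_helicoid
        set_lebesgue_integral_def mult.left_commute)
  finally have lim: "(\<lambda>N. restrict_current helicoid_current (ball 0 r) (?c N)) \<longlonglongrightarrow>
      (LINT y:?A|?L. helicoid_density TYPE('k) y)"
    by (simp add: set_lebesgue_integral_def)
  then show "(\<lambda>N. ennreal (restrict_current helicoid_current (ball 0 r) (?c N))) \<longlonglongrightarrow>
      ennreal (LINT y:?A|?L. helicoid_density TYPE('k) y)"
    by (rule tendsto_ennrealI)
  have "ennreal (restrict_current helicoid_current (ball 0 r) (?c N)) \<le>
      mass (Suc CARD('k)) (restrict_current (helicoid_current :: 'k ambient current) (ball 0 r))" for N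
  proof -
    have "ennreal (restrict_current helicoid_current (ball 0 r) (?c N)) \<le>
        ennreal \<bar>restrict_current helicoid_current (ball 0 r) (?c N)\<bar>"
      by (rule ennreal_leI) simp
    also have "\<dots> \<le> mass (Suc CARD('k)) (restrict_current (helicoid_current :: 'k ambient current) (ball 0 r))"
      unfolding mass_def
      by (rule SUP_upper) (use calibration_test_form[OF assms] comass_calibration in blast)
    finally show ?thesis .
  qed
  then show "\<exists>N0. \<forall>N\<ge>N0. ennreal (restrict_current helicoid_current (ball 0 r) (?c N)) \<le>
      mass (Suc CARD('k)) (restrict_current (helicoid_current :: 'k ambient current) (ball 0 r))"
    by blast
qed

section \<open>Affine changes of variables\<close>

abbreviation affine_map :: "nat \<Rightarrow> (nat \<Rightarrow> real) \<Rightarrow> (nat \<Rightarrow> real) \<Rightarrow> (nat \<Rightarrow> real) \<Rightarrow> nat \<Rightarrow> real" where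
  "affine_map m a b z \<equiv> (\<lambda>i\<in>{..<m}. a i + b i * z i)"

lemma measurable_affine_map: "affine_map m a b \<in> measurable (lborel_pow m) (lborel_pow m)"
  by measurable

text \<open>Each coordinate is scaled separately, so on boxes the one-dimensional statements
  multiply.\<close>

lemma lborel_pow_affine:
  assumes b: "\<And>i. i < m \<Longrightarrow> b i \<noteq> 0"
  shows "density (distr (lborel_pow m) (lborel_pow m) (affine_map m a b)) (\<lambda>_. ennreal (\<Prod>i<m. \<bar>b i\<bar>)) = lborel_pow m"
proof (rule lborel_factors.PiM_eqI)
  fix A :: "nat \<Rightarrow> real set" assume "\<And>i. i \<in> {..<m} \<Longrightarrow> A i \<in> sets lborel"
  then have A: "A i \<in> sets borel" if "i < m" for i using that by simp
  let ?B = "\<lambda>i. (\<lambda>x. a i + b i * x) -` A i"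
  have B: "?B i \<in> sets borel" if "i < m" for i
  proof -
    have "(\<lambda>x. a i + b i * x) -` A i \<inter> space borel \<in> sets borel"
      by (rule measurable_sets[OF _ A[OF that]]) simp
    then show ?thesis by simp
  qed
  have one: "ennreal \<bar>b i\<bar> * emeasure lborel (?B i) = emeasure lborel (A i)" if "i < m" for i
  proof -
    have "emeasure lborel (A i) = emeasure (density (distr lborel borel (\<lambda>x. a i + b i * x)) (\<lambda>_. ennreal \<bar>b i\<bar>)) (A i)"
      using lborel_real_affine[OF b[OF that], of "a i"] by simp
    also have "\<dots> = ennreal \<bar>b i\<bar> * emeasure lborel (?B i)"
      using A[OF that] by (subst emeasure_density_const) (simp_all add: emeasure_distr)
    finally show ?thesis by simp
  qed
  have "affine_map m a b -` Pi\<^sub>E {..<m} A \<inter> space (lborel_pow m) = Pi\<^sub>E {..<m} ?B"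
    by (auto simp: space_PiM PiE_def Pi_def)
  then have "emeasure (density (distr (lborel_pow m) (lborel_pow m) (affine_map m a b)) (\<lambda>_. ennreal (\<Prod>i<m. \<bar>b i\<bar>))) (Pi\<^sub>E {..<m} A)
      = ennreal (\<Prod>i<m. \<bar>b i\<bar>) * emeasure (lborel_pow m) (Pi\<^sub>E {..<m} ?B)"
    using A by (subst emeasure_density_const) (auto simp: emeasure_distr[OF measurable_affine_map])
  also have "\<dots> = (\<Prod>i<m. ennreal \<bar>b i\<bar>) * (\<Prod>i<m. emeasure lborel (?B i))"
    using B by (subst lborel_pow.measure_times) (auto simp: prod_ennreal)
  also have "\<dots> = (\<Prod>i<m. emeasure lborel (A i))"
    unfolding prod.distrib[symmetric] by (intro prod.cong one) auto
  finally show "emeasure (density (distr (lborel_pow m) (lborel_pow m) (affine_map m a b)) (\<lambda>_. ennreal (\<Prod>i<m. \<bar>b i\<bar>))) (Pi\<^sub>E {..<m} A)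
      = (\<Prod>i\<in>{..<m}. emeasure lborel (A i))" .
qed auto

lemma integral_lborel_pow_affine:
  fixes g :: "(nat \<Rightarrow> real) \<Rightarrow> real"
  assumes b: "\<And>i. i < m \<Longrightarrow> b i \<noteq> 0" and g: "g \<in> borel_measurable (lborel_pow m)"
  shows "(LINT y|lborel_pow m. g y) = (\<Prod>i<m. \<bar>b i\<bar>) * (LINT z|lborel_pow m. g (affine_map m a b z))"
proof -
  let ?D = "distr (lborel_pow m) (lborel_pow m) (affine_map m a b)"
  have "(LINT y|lborel_pow m. g y) = (LINT y|density ?D (\<lambda>_. ennreal (\<Prod>i<m. \<bar>b i\<bar>)). g y)"
    by (simp only: lborel_pow_affine[OF b])
  also have "\<dots> = (LINT y|?D. (\<Prod>i<m. \<bar>b i\<bar>) *\<^sub>R g y)"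
    by (rule integral_density) (use g in \<open>auto intro!: prod_nonneg\<close>)
  also have "\<dots> = (\<Prod>i<m. \<bar>b i\<bar>) * (LINT z|lborel_pow m. g (affine_map m a b z))"
    by (simp add: integral_distr[OF measurable_affine_map g])
  finally show ?thesis .
qed

lemma alternating_multilinear_scale_slots:
  assumes "alternating_multilinear m \<phi>"
  shows "\<phi> (\<lambda>i. b i *\<^sub>R v i) = (\<Prod>i<m. b i) * \<phi> v"
  by (subst (1 2) alternating_multilinear_expansion[OF assms])
     (simp add: prod.distrib sum_distrib_left mult.assoc)

lemma helicoid_affine_map:
  "helicoid (affine_map (Suc CARD('k)) a b z) = (moving_helicoid a b 0 z :: ('k::{finite,linorder}) ambient)"
  by (simp add: moving_helicoid_def affine_vec_def Let_def less_Suc_eq)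

lemma helicoid_d1_affine_map:
  assumes "i < Suc CARD('k)"
  shows "moving_helicoid_d1 a b 0 i z = b i *\<^sub>R (helicoid_d1 i (affine_map (Suc CARD('k)) a b z) :: ('k::{finite,linorder}) ambient)"
  using assms by (simp add: moving_helicoid_d1_def affine_vec_def Let_def less_Suc_eq)

text \<open>The pull-back contributes the signed product of the scales and the change of variables
  its absolute value; what remains is the sign, that is, the effect of the affine map on the
  orientation.\<close>

lemma param_current_affine_helicoid:
  fixes \<omega> :: "('k::{finite,linorder}) ambient form"
  assumes \<omega>: "smooth_form (Suc CARD('k)) \<omega>" and b: "\<And>i. i < Suc CARD('k) \<Longrightarrow> b i \<noteq> 0"
    and A: "\<And>i t. i < Suc CARD('k) \<Longrightarrow> a i + b i * t \<in> A i \<longleftrightarrow> t \<in> {0<..<1}"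
      "\<And>i. i < Suc CARD('k) \<Longrightarrow> A i \<in> sets borel"
  shows "param_current (Suc CARD('k)) (open_cube (Suc CARD('k))) (moving_helicoid a b 0) \<omega> =
    sgn (\<Prod>i<Suc CARD('k). b i) *
      (LINT y:Pi\<^sub>E {..<Suc CARD('k)} A|lborel_pow (Suc CARD('k)). \<omega> (helicoid y) (\<lambda>i. helicoid_d1 i y))"
proof -
  let ?m = "Suc CARD('k)"
  let ?L = "lborel_pow ?m" and ?P = "\<Prod>i<?m. b i"
  let ?g = "\<lambda>y. \<omega> (helicoid y) (\<lambda>i. helicoid_d1 i y)" and ?\<Phi> = "affine_map ?m a b"
  have ind: "indicat_real (Pi\<^sub>E {..<?m} A) (?\<Phi> z) = indicat_real (open_cube ?m) z" if "z \<in> space ?L" for z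
  proof -
    have "?\<Phi> z \<in> Pi\<^sub>E {..<?m} A \<longleftrightarrow> z \<in> open_cube ?m"
      using that A(1) by (auto simp: open_cube_def space_PiM PiE_def Pi_def)
    then show ?thesis by (simp add: indicator_def)
  qed
  have val: "\<omega> (moving_helicoid a b 0 z) (\<lambda>i. moving_helicoid_d1 a b 0 i z) = ?P * ?g (?\<Phi> z)" for z
  proof -
    have "\<omega> (moving_helicoid a b 0 z) (\<lambda>i. moving_helicoid_d1 a b 0 i z) =
        \<omega> (helicoid (?\<Phi> z)) (\<lambda>i. b i *\<^sub>R helicoid_d1 i (?\<Phi> z))"
      unfolding helicoid_affine_map by (rule smooth_form_cong[OF \<omega> helicoid_d1_affine_map])
    also have "\<dots> = ?P * ?g (?\<Phi> z)"
      by (rule alternating_multilinear_scale_slots[OF smooth_formD(1)[OF \<omega>]])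
    finally show ?thesis .
  qed
  have meas: "(\<lambda>y. indicat_real (Pi\<^sub>E {..<?m} A) y * ?g y) \<in> borel_measurable ?L"
    by (intro borel_measurable_times borel_measurable_indicator sets_lborel_pow_PiE A(2)
        borel_measurable_continuous_lborel_pow continuous_on_C2_pullback[OF C2_map_helicoid \<omega>])
  have "param_current ?m (open_cube ?m) (moving_helicoid a b 0) \<omega> =
      (LINT z:open_cube ?m|?L. ?P * ?g (?\<Phi> z))"
    unfolding val[symmetric] by (rule param_current_C2[OF C2_map_helicoid smooth_form_cong[OF \<omega>]])
  also have "\<dots> = ?P * (LINT z:open_cube ?m|?L. ?g (?\<Phi> z))"
    by (rule set_integral_mult_right)
  also have "(LINT z:open_cube ?m|?L. ?g (?\<Phi> z)) =
      (LINT z|?L. indicat_real (Pi\<^sub>E {..<?m} A) (?\<Phi> z) * ?g (?\<Phi> z))"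
    unfolding set_lebesgue_integral_def real_scaleR_def
    by (rule Bochner_Integration.integral_cong) (simp_all only: ind)
  also have "?P * \<dots> = sgn ?P * (\<bar>?P\<bar> * \<dots>)"
    by (simp only: mult.assoc[symmetric] sgn_mult_abs)
  also have "\<bar>?P\<bar> * (LINT z|?L. indicat_real (Pi\<^sub>E {..<?m} A) (?\<Phi> z) * ?g (?\<Phi> z)) =
      (LINT y|?L. indicat_real (Pi\<^sub>E {..<?m} A) y * ?g y)"
    unfolding abs_prod by (rule integral_lborel_pow_affine[OF b meas, symmetric])
  finally show ?thesis
    by (simp only: set_lebesgue_integral_def real_scaleR_def)
qed

section \<open>A competitor of smaller mass\<close>

text \<open>Together with \<open>cell_scale\<close> this maps the unit cube onto the parameters in
  \<open>[-R, R]^k\<close> and \<open>[0, pi]\<close>.\<close>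

definition cell_offset :: "nat \<Rightarrow> real \<Rightarrow> nat \<Rightarrow> real" where
  "cell_offset n R i = (if i < n then - R else 0)"

definition cell_scale :: "nat \<Rightarrow> real \<Rightarrow> nat \<Rightarrow> real" where
  "cell_scale n R i = (if i < n then 2 * R else pi)"

text \<open>The speed \<open>pi\<close> over unit time makes the final position exactly one half
  turn higher.\<close>

abbreviation sweep :: "real \<Rightarrow> (nat \<Rightarrow> real) \<Rightarrow> ('k::{finite,linorder}) ambient" where
  "sweep R \<equiv> moving_helicoid (cell_offset CARD('k) R) (cell_scale CARD('k) R) pi"

abbreviation sweep_d1 :: "real \<Rightarrow> nat \<Rightarrow> (nat \<Rightarrow> real) \<Rightarrow> ('k::{finite,linorder}) ambient" where
  "sweep_d1 R \<equiv> moving_helicoid_d1 (cell_offset CARD('k) R) (cell_scale CARD('k) R) pi"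

definition cell :: "nat \<Rightarrow> real \<Rightarrow> real \<Rightarrow> (nat \<Rightarrow> real) set" where
  "cell n R h = Pi\<^sub>E {..<Suc n} (\<lambda>i. if i < n then {- R<..<R} else {h<..<h + pi})"

lemma cell_sets [measurable, simp]: "cell n R h \<in> sets (lborel_pow (Suc n))"
  unfolding cell_def by (intro sets_lborel_pow_PiE) auto

lemma sweep_bottom:
  "(\<lambda>z. sweep R (insert_at (Suc CARD('k)) 0 z) :: ('k::{finite,linorder}) ambient) =
     moving_helicoid (cell_offset CARD('k) R) (cell_scale CARD('k) R) 0"
proof
  fix z :: "nat \<Rightarrow> real"
  have "insert_at (Suc CARD('k)) 0 z (position i) = z (position i)" for i :: 'k
    using less_SucI[OF position_less[of i]] by (simp add: insert_at_def)
  moreover have "insert_at (Suc CARD('k)) 0 z CARD('k) = z CARD('k)"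
    by (simp add: insert_at_def)
  ultimately show "(sweep R (insert_at (Suc CARD('k)) 0 z) :: 'k ambient) =
     moving_helicoid (cell_offset CARD('k) R) (cell_scale CARD('k) R) 0 z"
    by (simp add: moving_helicoid_def affine_vec_def Let_def)
qed

text \<open>Moving the helicoid up by \<open>\<pi>\<close> is the same as replacing \<open>(u, s)\<close> by \<open>(-u, s + \<pi>)\<close>.\<close>

lemma sweep_top:
  "(\<lambda>z. sweep R (insert_at (Suc CARD('k)) 1 z) :: ('k::{finite,linorder}) ambient) =
     moving_helicoid (\<lambda>i. if i < CARD('k) then R else pi) (\<lambda>i. if i < CARD('k) then - 2 * R else pi) 0"
proof
  fix z :: "nat \<Rightarrow> real"
  have "insert_at (Suc CARD('k)) 1 z (position i) = z (position i)" for i :: 'k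
    using less_SucI[OF position_less[of i]] by (simp add: insert_at_def)
  moreover have "insert_at (Suc CARD('k)) 1 z CARD('k) = z CARD('k)"
    by (simp add: insert_at_def)
  moreover have "cos (pi + pi * t) = - cos (pi * t)" "sin (pi + pi * t) = - sin (pi * t)" for t
    by (simp_all add: cos_add sin_add)
  ultimately show "(sweep R (insert_at (Suc CARD('k)) 1 z) :: 'k ambient) =
     moving_helicoid (\<lambda>i. if i < CARD('k) then R else pi) (\<lambda>i. if i < CARD('k) then - 2 * R else pi) 0 z"
    by (simp add: moving_helicoid_def affine_vec_def Let_def cell_offset_def cell_scale_def vec_eq_iff algebra_simps)
qed

lemma sweep_bottom_current:
  fixes \<omega> :: "('k::{finite,linorder}) ambient form"
  assumes \<omega>: "smooth_form (Suc CARD('k)) \<omega>" and R: "0 < R"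
  shows "param_current (Suc CARD('k)) (open_cube (Suc CARD('k))) (\<lambda>z. sweep R (insert_at (Suc CARD('k)) 0 z)) \<omega> =
    (LINT y:cell CARD('k) R 0|lborel_pow (Suc CARD('k)). \<omega> (helicoid y) (\<lambda>i. helicoid_d1 i y))"
proof -
  have pos: "0 < (\<Prod>i<Suc CARD('k). cell_scale CARD('k) R i)"
    by (rule prod_pos) (use R in \<open>simp add: cell_scale_def\<close>)
  show ?thesis
    unfolding sweep_bottom cell_def
    by (subst param_current_affine_helicoid[OF \<omega>, of _ _ "\<lambda>i. if i < CARD('k) then {- R<..<R} else {0<..<0 + pi}"])
       (use R pos in \<open>auto simp: cell_offset_def cell_scale_def zero_less_mult_iff\<close>)
qed

lemma sweep_top_current:
  fixes \<omega> :: "('k::{finite,linorder}) ambient form"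
  assumes \<omega>: "smooth_form (Suc CARD('k)) \<omega>" and R: "0 < R" and odd: "odd CARD('k)"
  shows "param_current (Suc CARD('k)) (open_cube (Suc CARD('k))) (\<lambda>z. sweep R (insert_at (Suc CARD('k)) 1 z)) \<omega> =
    - (LINT y:cell CARD('k) R pi|lborel_pow (Suc CARD('k)). \<omega> (helicoid y) (\<lambda>i. helicoid_d1 i y))"
proof -
  \<comment> \<open>The half turn reverses each of the \<open>k\<close> ruling coordinates, so for
    odd \<open>k\<close> the product of the scales is negative and the upper piece appears with
    reversed orientation.\<close>
  have "(\<Prod>i<Suc CARD('k). if i < CARD('k) then - 2 * R else pi) = (- 2 * R) ^ CARD('k) * pi"
    by simp
  also have "\<dots> < 0"
    using R odd by (intro mult_neg_pos) (auto simp: power_less_zero_eq)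
  finally have neg: "sgn (\<Prod>i<Suc CARD('k). if i < CARD('k) then - 2 * R else pi) = -1"
    by (rule sgn_neg)
  have box: "(if i < CARD('k) then R else pi) + (if i < CARD('k) then - 2 * R else pi) * t
      \<in> (if i < CARD('k) then {- R<..<R} else {pi<..<pi + pi}) \<longleftrightarrow> t \<in> {0<..<1}" for i t
  proof (cases "i < CARD('k)")
    case True
    have "R + - 2 * R * t \<in> {- R<..<R} \<longleftrightarrow> 0 < R * t \<and> R * t < R * 1"
      by auto
    then show ?thesis using R True by (simp only: mult_less_cancel_left_pos zero_less_mult_iff) auto
  next
    case False
    then show ?thesis by (auto simp: zero_less_mult_iff)
  qed
  show ?thesis
    unfolding sweep_top cell_def
    by (subst param_current_affine_helicoid[OF \<omega> _ box]) (use R neg in auto)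
qed

section \<open>Size of the side faces of the swept cube\<close>

lemma norm_affine_vec_le:
  assumes "\<And>i. i < CARD('k) \<Longrightarrow> \<bar>a i + c i * y i\<bar> \<le> R"
  shows "norm (affine_vec a c y :: real^('k::{finite,linorder})) \<le> real CARD('k) * R"
proof -
  have "norm (affine_vec a c y :: real^('k::{finite,linorder})) \<le> (\<Sum>i\<in>UNIV. \<bar>(affine_vec a c y :: real^('k::{finite,linorder})) $ i\<bar>)"
    by (rule norm_le_l1_cart)
  also have "\<dots> \<le> (\<Sum>i\<in>(UNIV :: 'k set). R)"
    by (rule sum_mono) (simp add: affine_vec_def assms)
  finally show ?thesis by simp
qed

lemma norm_moving_helicoid_le:
  "norm (moving_helicoid a c \<tau> y :: ('k::{finite,linorder}) ambient) \<le>
     norm (affine_vec a c y :: real^('k::{finite,linorder})) +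
     \<bar>a CARD('k) + c CARD('k) * y CARD('k) + \<tau> * y (Suc CARD('k))\<bar>" (is "_ \<le> ?V + \<bar>?s\<bar>")
proof (rule power2_le_imp_le)
  have "v\<^sup>2 + s\<^sup>2 \<le> (v + \<bar>s\<bar>)\<^sup>2" if "0 \<le> v" for v s :: real
    using that by (simp add: power2_sum)
  then show "(norm (moving_helicoid a c \<tau> y :: 'k ambient))\<^sup>2 \<le> (?V + \<bar>?s\<bar>)\<^sup>2"
    unfolding norm_moving_helicoid by simp
qed simp

lemma sweep_cell_bounds:
  fixes y :: "nat \<Rightarrow> real"
  assumes "y \<in> {..<Suc (Suc CARD('k))} \<rightarrow>\<^sub>E {0..1}" "0 < R"
  shows "norm (affine_vec (cell_offset CARD('k) R) (cell_scale CARD('k) R) y :: real^('k::{finite,linorder})) \<le> real CARD('k) * R"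
    and "norm (sweep R y :: 'k ambient) \<le> real CARD('k) * R + 2 * pi"
proof -
  have y: "0 \<le> y i" "y i \<le> 1" if "i < Suc (Suc CARD('k))" for i
    using assms(1) that by (auto simp: PiE_def Pi_def)
  show V: "norm (affine_vec (cell_offset CARD('k) R) (cell_scale CARD('k) R) y :: real^('k::{finite,linorder})) \<le> real CARD('k) * R"
  proof (rule norm_affine_vec_le)
    fix i assume i: "i < CARD('k)"
    then have "0 \<le> R * y i" "R * y i \<le> R * 1"
      using y[of i] assms(2) by (auto intro!: mult_left_mono)
    then show "\<bar>cell_offset CARD('k) R i + cell_scale CARD('k) R i * y i\<bar> \<le> R"
      using i by (simp add: cell_offset_def cell_scale_def)
  qed
  have "0 \<le> pi * y CARD('k)" "pi * y CARD('k) \<le> pi * 1" "0 \<le> pi * y (Suc CARD('k))" "pi * y (Suc CARD('k)) \<le> pi * 1"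
    using y by (auto intro!: mult_left_mono)
  then have "\<bar>pi * y CARD('k) + pi * y (Suc CARD('k))\<bar> \<le> 2 * pi" by linarith
  moreover have "cell_offset CARD('k) R CARD('k) + cell_scale CARD('k) R CARD('k) * y CARD('k) + pi * y (Suc CARD('k)) =
      pi * y CARD('k) + pi * y (Suc CARD('k))"
    by (simp add: cell_offset_def cell_scale_def)
  ultimately show "norm (sweep R y :: 'k ambient) \<le> real CARD('k) * R + 2 * pi"
    using V norm_moving_helicoid_le[where 'k = 'k, of "cell_offset CARD('k) R" "cell_scale CARD('k) R" pi y]
    by linarith
qed

text \<open>Bounds for the edge vectors: \<open>2 * R\<close> along a ruling coordinate,
  \<open>pi\<close> for the vertical motion, and \<open>pi * (n + 1) * R\<close> for the rotation.
  The latter comes from \<open>norm u + 1 \<le> n * R + 1\<close>, where \<open>1 \<le> R\<close>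
  absorbs the last summand.\<close>

definition sweep_speed :: "nat \<Rightarrow> real \<Rightarrow> nat \<Rightarrow> real" where
  "sweep_speed n R i = (if i < n then 2 * R else if i = n then pi * (real (Suc n) * R) else pi)"

lemma norm_sweep_d1_le:
  assumes y: "y \<in> {..<Suc (Suc CARD('k))} \<rightarrow>\<^sub>E {0..1}" and R: "1 \<le> R"
  shows "norm (sweep_d1 R i y :: ('k::{finite,linorder}) ambient) \<le> sweep_speed CARD('k) R i"
proof -
  consider "i < CARD('k)" | "i = CARD('k)" | "CARD('k) < i" by linarith
  then show ?thesis
  proof cases
    case 1
    then show ?thesis
      using R by (simp add: moving_helicoid_d1_def Let_def norm_rotated_axis sweep_speed_def cell_scale_def)
  next
    case 2
    let ?V = "affine_vec (cell_offset CARD('k) R) (cell_scale CARD('k) R) y :: real^('k::{finite,linorder})"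
    have "sqrt ((norm ?V)\<^sup>2 + 1\<^sup>2) \<le> norm ?V + 1"
      by (rule order_trans[OF sqrt_sum_squares_le_sum_abs]) simp
    also have "\<dots> \<le> real (Suc CARD('k)) * R"
      using sweep_cell_bounds(1)[where 'k = 'k, OF y, of R] R by (simp add: algebra_simps)
    finally show ?thesis
      using 2 by (simp add: moving_helicoid_d1_def Let_def norm_rotation_field sweep_speed_def cell_scale_def)
  next
    case 3
    then show ?thesis
      by (simp add: moving_helicoid_d1_def Let_def sweep_speed_def norm_Pair)
  qed
qed

text \<open>All speeds together have a product of order \<open>R ^ (n + 1)\<close>. A side face
  omits a direction of speed at least \<open>R\<close>, which lowers the order by one; the vertical
  direction of constant speed is kept.\<close>

lemma prod_sweep_speed_le:
  assumes R: "1 \<le> R" and i: "i \<le> n"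
  shows "(\<Prod>j\<in>{..<Suc (Suc n)} - {i}. sweep_speed n R j) \<le> (2 * R) ^ n * (pi\<^sup>2 * real (Suc n))" (is "?P \<le> ?B")
proof -
  have B: "0 \<le> ?B" using R by simp
  have "(\<Prod>j<n. sweep_speed n R j) = (2 * R) ^ n"
    by (simp add: sweep_speed_def)
  then have "(\<Prod>j<Suc (Suc n). sweep_speed n R j) = ?B * R"
    by (simp add: sweep_speed_def power2_eq_square)
  then have eq: "sweep_speed n R i * ?P = ?B * R"
    using i by (subst (asm) prod.remove[of _ i]) auto
  have "R \<le> sweep_speed n R i"
  proof (cases "i < n")
    case True
    then show ?thesis using R by (simp add: sweep_speed_def)
  next
    case False
    have "1 * R \<le> pi * (real (Suc n) * R)"
      using R pi_ge_two by (intro mult_mono) (auto simp: mult_le_cancel_right1)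
    then show ?thesis using False i by (simp add: sweep_speed_def)
  qed
  moreover have "0 \<le> ?P"
    by (rule prod_nonneg) (use R in \<open>simp add: sweep_speed_def\<close>)
  ultimately have "R * ?P \<le> ?B * R"
    using mult_right_mono[of R "sweep_speed n R i" ?P] eq by simp
  then show ?thesis using R by (simp add: mult.commute[of ?B])
qed

lemma sweep_side_bound:
  fixes \<omega> :: "('k::{finite,linorder}) ambient form"
  assumes \<omega>: "\<omega> \<in> test_forms (Suc CARD('k))" "\<And>x. comass (Suc CARD('k)) (\<omega> x) \<le> 1"
    and R: "1 \<le> R" and i: "i \<le> CARD('k)" and c: "c = 0 \<or> c = 1"
  shows "\<bar>param_current (Suc CARD('k)) (open_cube (Suc CARD('k))) (\<lambda>z. sweep R (insert_at i c z)) \<omega>\<bar> \<le>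
    real (DIM('k ambient)) ^ Suc CARD('k) * ((2 * R) ^ CARD('k) * (pi\<^sup>2 * real (Suc CARD('k))))"
proof -
  note F = C2_map_face[OF C2_map_moving_helicoid[where 'k = 'k, of "cell_offset CARD('k) R" "cell_scale CARD('k) R" pi], of i c]
  note sf = smooth_form_if_test_form[OF \<omega>(1)]
  show ?thesis
  proof (subst param_current_C2[OF F smooth_form_cong[OF sf]], assumption,
      rule abs_cube_integral_le[OF continuous_on_C2_pullback[OF F sf]])
    fix z assume z: "z \<in> open_cube (Suc CARD('k))"
    let ?y = "insert_at i c z"
    have y: "?y \<in> {..<Suc (Suc CARD('k))} \<rightarrow>\<^sub>E {0..1}"
      using insert_at_in_box[OF z c] i by simp
    have "\<bar>\<omega> (sweep R ?y) (\<lambda>l. sweep_d1 R (skip i l) ?y)\<bar> \<le>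
        real DIM('k ambient) ^ Suc CARD('k) * (\<Prod>l<Suc CARD('k). norm (sweep_d1 R (skip i l) ?y :: 'k ambient))"
      by (rule alternating_multilinear_comass_bound[OF smooth_formD(1)[OF sf] \<omega>(2)])
    also have "(\<Prod>l<Suc CARD('k). norm (sweep_d1 R (skip i l) ?y :: 'k ambient)) \<le>
        (\<Prod>l<Suc CARD('k). sweep_speed CARD('k) R (skip i l))"
      by (rule prod_mono) (simp add: norm_sweep_d1_le[OF y R])
    also have "\<dots> = (\<Prod>j\<in>{..<Suc (Suc CARD('k))} - {i}. sweep_speed CARD('k) R j)"
      by (rule prod.reindex_bij_betw[OF bij_betw_skip]) (use i in simp)
    also have "\<dots> \<le> (2 * R) ^ CARD('k) * (pi\<^sup>2 * real (Suc CARD('k)))"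
      by (rule prod_sweep_speed_le[OF R i])
    finally show "\<bar>\<omega> (sweep R ?y) (\<lambda>l. sweep_d1 R (skip i l) ?y)\<bar> \<le>
        real DIM('k ambient) ^ Suc CARD('k) * ((2 * R) ^ CARD('k) * (pi\<^sup>2 * real (Suc CARD('k))))"
      by (simp add: mult_left_mono)
  qed
qed

text \<open>There are \<open>2 * (n + 1)\<close> side faces; the inner factor bounds the
  contribution of one of them in an ambient space of dimension \<open>d\<close>.\<close>

definition sweep_bound :: "nat \<Rightarrow> nat \<Rightarrow> real \<Rightarrow> real" where
  "sweep_bound d n R = 2 * real (Suc n) * (real d ^ Suc n * ((2 * R) ^ n * (pi\<^sup>2 * real (Suc n))))"

text \<open>For odd \<open>k\<close> the last pair of faces carries the sign
  \<open>(-1) ^ (k + 1) = 1\<close>. The top face is minus the upper piece and the bottom face is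
  subtracted, so adding both pieces leaves the side faces alone.\<close>

lemma sweep_boundary:
  fixes \<omega> :: "('k::{finite,linorder}) ambient form"
  assumes \<omega>: "\<omega> \<in> test_forms (Suc CARD('k))" "\<And>x. comass (Suc CARD('k)) (\<omega> x) \<le> 1"
    and R: "1 \<le> R" and odd: "odd CARD('k)"
  shows "\<bar>cube_boundary (Suc CARD('k)) (sweep R) \<omega> +
    (LINT y:cell CARD('k) R 0|lborel_pow (Suc CARD('k)). \<omega> (helicoid y) (\<lambda>i. helicoid_d1 i y)) +
    (LINT y:cell CARD('k) R pi|lborel_pow (Suc CARD('k)). \<omega> (helicoid y) (\<lambda>i. helicoid_d1 i y))\<bar>
    \<le> sweep_bound DIM('k ambient) CARD('k) R"
proof -
  define p where "p i c = param_current (Suc CARD('k)) (open_cube (Suc CARD('k))) (\<lambda>z. sweep R (insert_at i c z)) \<omega>"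
    for i and c :: real
  let ?B = "real (DIM('k ambient)) ^ Suc CARD('k) * ((2 * R) ^ CARD('k) * (pi\<^sup>2 * real (Suc CARD('k))))"
  have R0: "0 < R" using R by simp
  note sf = smooth_form_if_test_form[OF \<omega>(1)]
  have p: "\<bar>p i c\<bar> \<le> ?B" if "i \<le> CARD('k)" "c = 0 \<or> c = 1" for i c
    unfolding p_def by (rule sweep_side_bound[OF \<omega> R that])
  have "cube_boundary (Suc CARD('k)) (sweep R) \<omega> =
      (\<Sum>i<Suc CARD('k). (-1) ^ i * (p i 1 - p i 0)) + (-1) ^ Suc CARD('k) * (p (Suc CARD('k)) 1 - p (Suc CARD('k)) 0)"
    unfolding cube_boundary_def p_def by (rule sum.lessThan_Suc)
  also have "(-1 :: real) ^ Suc CARD('k) = 1"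
    using odd by simp
  finally have "cube_boundary (Suc CARD('k)) (sweep R) \<omega> +
    (LINT y:cell CARD('k) R 0|lborel_pow (Suc CARD('k)). \<omega> (helicoid y) (\<lambda>i. helicoid_d1 i y)) +
    (LINT y:cell CARD('k) R pi|lborel_pow (Suc CARD('k)). \<omega> (helicoid y) (\<lambda>i. helicoid_d1 i y)) =
    (\<Sum>i<Suc CARD('k). (-1) ^ i * (p i 1 - p i 0))"
    unfolding p_def sweep_bottom_current[OF sf R0] sweep_top_current[OF sf R0 odd] by simp
  also have "\<bar>\<dots>\<bar> \<le> (\<Sum>i<Suc CARD('k). 2 * ?B)"
  proof (rule order_trans[OF sum_abs], rule sum_mono)
    fix i assume "i \<in> {..<Suc CARD('k)}"
    then have "\<bar>p i 1\<bar> \<le> ?B" "\<bar>p i 0\<bar> \<le> ?B" using p by auto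
    then show "\<bar>(-1) ^ i * (p i 1 - p i 0)\<bar> \<le> 2 * ?B"
      by (simp add: abs_mult power_abs)
  qed
  also have "\<dots> = sweep_bound DIM('k ambient) CARD('k) R"
    by (simp add: sweep_bound_def)
  finally show ?thesis .
qed

section \<open>Comparison of areas\<close>

lemma cell_subset_helicoid_ball:
  assumes "0 < R" "h = 0 \<or> h = pi"
  shows "cell CARD('k) R h \<subseteq> helicoid_ball TYPE('k::{finite,linorder}) (real CARD('k) * R + 2 * pi + 1)"
proof
  fix y assume y: "y \<in> cell CARD('k) R h"
  then have comp: "y i \<in> (if i < CARD('k) then {- R<..<R} else {h<..<h + pi})" if "i < Suc CARD('k)" for i
    using that unfolding cell_def by (blast intro: PiE_mem)
  have "norm (coord_vec y :: real^('k::{finite,linorder})) \<le> real CARD('k) * R"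
  proof (rule norm_affine_vec_le)
    fix i assume "i < CARD('k)"
    then show "\<bar>0 + 1 * y i\<bar> \<le> R" using comp[of i] by auto
  qed
  moreover have "\<bar>y CARD('k)\<bar> \<le> 2 * pi"
    using comp[of "CARD('k)"] assms(2) by auto
  ultimately have "norm (helicoid y :: 'k ambient) \<le> real CARD('k) * R + 2 * pi"
    using norm_moving_helicoid_le[where 'k = 'k, of "\<lambda>_. 0" "\<lambda>_. 1" 0 y] by simp
  moreover have "y \<in> space (lborel_pow (Suc CARD('k)))"
    using y by (auto simp: cell_def space_PiM PiE_def)
  ultimately show "y \<in> helicoid_ball TYPE('k) (real CARD('k) * R + 2 * pi + 1)"
    by (simp add: helicoid_ball_def)
qed

text \<open>The density is at least the absolute value of any single coordinate of \<open>u\<close>.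
  Where the first one exceeds \<open>R / 2\<close>, which is a quarter of the cell, the density
  exceeds \<open>R / 2\<close>; this accounts for the factor \<open>1 / 8\<close>.\<close>

lemma cell_area_ge:
  assumes "0 < R"
  shows "(2 * R) ^ CARD('k) * pi * R / 8 \<le>
    (LINT y:cell CARD('k) R 0|lborel_pow (Suc CARD('k)). helicoid_density TYPE('k::{finite,linorder}) y)"
proof -
  let ?n = "CARD('k)"
  let ?L = "lborel_pow (Suc ?n)"
  define lo where "lo i = (if i = 0 then R / 2 else if i < ?n then - R else 0)" for i
  define hi where "hi i = (if i < ?n then R else pi)" for i
  define Q where "Q = Pi\<^sub>E {..<Suc ?n} (\<lambda>i. {lo i<..<hi i})"
  have n: "0 < ?n" by simp
  have le: "lo i \<le> hi i" for i
    using assms n by (auto simp: lo_def hi_def)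
  have Q_sets: "Q \<in> sets ?L"
    unfolding Q_def by (intro sets_lborel_pow_PiE) auto
  have sub: "Q \<subseteq> cell ?n R 0"
    unfolding Q_def cell_def using assms n by (intro PiE_mono) (auto simp: lo_def hi_def split: if_splits)
  have "emeasure ?L Q = (\<Prod>i<Suc ?n. ennreal (hi i - lo i))"
    unfolding Q_def by (subst lborel_pow.measure_times) (auto simp: le)
  also have "\<dots> = ennreal (\<Prod>i<Suc ?n. hi i - lo i)"
    using le by (intro prod_ennreal) simp
  finally have "measure ?L Q = (\<Prod>i<Suc ?n. hi i - lo i)"
    using le by (simp add: measure_def enn2real_ennreal prod_nonneg del: prod.lessThan_Suc)
  also have "\<dots> = (\<Prod>i<?n. hi i - lo i) * pi"
    using n by (simp add: lo_def hi_def)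
  also have "(\<Prod>i<?n. hi i - lo i) = (2 * R) ^ ?n / 4"
  proof -
    obtain l where l: "?n = Suc l" using n gr0_conv_Suc by auto
    have "(\<Prod>i<l. hi (Suc i) - lo (Suc i)) = (2 * R) ^ l"
      by (simp add: lo_def hi_def l)
    then show ?thesis
      unfolding l prod.lessThan_Suc_shift using l by (simp add: lo_def hi_def)
  qed
  finally have measure_Q: "measure ?L Q = (2 * R) ^ ?n / 4 * pi" .
  have fin: "emeasure ?L Q < \<infinity>"
    by (rule emeasure_box_finite[OF order_trans[OF sub order_trans[OF
          cell_subset_helicoid_ball[where 'k = 'k, OF assms disjI1[OF refl]] helicoid_ball_subset_box]]])
  have "(2 * R) ^ ?n * pi * R / 8 = (LINT y|?L. indicat_real Q y * (R / 2))"
    using Q_sets fin by (simp add: measure_Q)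
  also have "\<dots> \<le> (LINT y|?L. indicat_real (cell ?n R 0) y * helicoid_density TYPE('k) y)"
  proof (rule integral_mono)
    show "integrable ?L (\<lambda>y. indicat_real Q y * (R / 2))"
      using Q_sets fin by (intro integrable_mult_left integrable_real_indicator)
    show "integrable ?L (\<lambda>y. indicat_real (cell ?n R 0) y * helicoid_density TYPE('k) y)"
      using set_integrable_helicoid_density[OF cell_sets cell_subset_helicoid_ball[where 'k = 'k, OF assms disjI1[OF refl]]]
      by (simp add: set_integrable_def)
    fix y
    show "indicat_real Q y * (R / 2) \<le> indicat_real (cell ?n R 0) y * helicoid_density TYPE('k) y"
    proof (cases "y \<in> Q")
      case True
      then have "y 0 \<in> {lo 0<..<hi 0}" unfolding Q_def by (rule PiE_mem) simp
      then have "R / 2 < y 0" by (simp add: lo_def)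
      also have "y 0 = (coord_vec y :: real^('k::{finite,linorder})) $ at_position 0"
        using n by (simp add: affine_vec_def)
      also have "\<dots> \<le> norm (coord_vec y :: real^('k::{finite,linorder}))"
        using component_le_norm_cart[of "coord_vec y :: real^('k::{finite,linorder})" "at_position 0"] by linarith
      also have "\<dots> \<le> helicoid_density TYPE('k) y"
        unfolding helicoid_density_def by (rule real_le_rsqrt) simp
      finally show ?thesis using True sub by auto
    qed (use helicoid_density_pos[where 'k = 'k, of y] in \<open>simp add: less_imp_le\<close>)
  qed
  finally show ?thesis by (simp add: set_lebesgue_integral_def)
qed

text \<open>The part of the helicoid outside the two pieces is bounded by its area and everything
  else by the side faces. The area of the upper piece is saved as well, but is simply discarded as
  nonnegative.\<close>

theorem mass_competitor_le:
  assumes R: "1 \<le> R" and odd: "odd CARD('k::{finite,linorder})" and r: "r = real CARD('k) * R + 2 * pi + 1"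
  shows "mass (Suc CARD('k)) (restrict_current (\<lambda>\<omega>. (helicoid_current :: 'k ambient current) \<omega> +
      cube_boundary (Suc CARD('k)) (sweep R) \<omega>) (ball 0 r)) \<le>
    ennreal ((LINT y:helicoid_ball TYPE('k) r|lborel_pow (Suc CARD('k)). helicoid_density TYPE('k) y) -
      (LINT y:cell CARD('k) R 0|lborel_pow (Suc CARD('k)). helicoid_density TYPE('k) y) +
      sweep_bound DIM('k ambient) CARD('k) R)"
  unfolding mass_def
proof (rule SUP_least, rule ennreal_leI)
  let ?L = "lborel_pow (Suc CARD('k))" and ?A = "helicoid_ball TYPE('k) r" and ?J = "helicoid_density TYPE('k)"
  let ?P0 = "cell CARD('k) R 0" and ?P1 = "cell CARD('k) R pi"
  fix \<omega> :: "'k ambient form"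
  assume "\<omega> \<in> {\<omega> \<in> test_forms (Suc CARD('k)). \<forall>x. comass (Suc CARD('k)) (\<omega> x) \<le> 1}"
  then have \<omega>: "\<omega> \<in> test_forms (Suc CARD('k))" "comass (Suc CARD('k)) (\<omega> x) \<le> 1" for x
    by blast+
  let ?g = "\<lambda>y. \<omega> (helicoid y) (\<lambda>i. helicoid_d1 i y)"
  note sf = smooth_form_if_test_form[OF \<omega>(1)]
  have R0: "0 < R" using R by simp
  then have r0: "0 < r" unfolding r by (simp add: add_pos_nonneg)
  have image: "(sweep R :: _ \<Rightarrow> 'k ambient) ` ({..<Suc (Suc CARD('k))} \<rightarrow>\<^sub>E {0..1}) \<subseteq> ball 0 r"
  proof (rule image_subsetI)
    fix y :: "nat \<Rightarrow> real" assume "y \<in> {..<Suc (Suc CARD('k))} \<rightarrow>\<^sub>E {0..1}"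
    from sweep_cell_bounds(2)[where 'k = 'k, OF this R0] show "(sweep R y :: 'k ambient) \<in> ball 0 r"
      by (simp add: r)
  qed
  \<comment> \<open>The cells are open, so their boundaries belong to \<open>C\<close> and the
    decomposition of the ball is exact.\<close>
  define C where "C = ?A - (?P0 \<union> ?P1)"
  have sub: "?P0 \<subseteq> ?A" "?P1 \<subseteq> ?A" "C \<subseteq> ?A"
    using cell_subset_helicoid_ball[where 'k = 'k, OF R0] by (auto simp: r C_def)
  have sets: "?P0 \<in> sets ?L" "?P1 \<in> sets ?L" "C \<in> sets ?L"
    by (auto simp: C_def intro: helicoid_ball_sets)
  have disj: "?P0 \<inter> ?P1 = {}" "C \<inter> (?P0 \<union> ?P1) = {}"
  proof -
    have "y \<notin> ?P1" if "y \<in> ?P0" for y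
    proof
      assume "y \<in> ?P1"
      then have "y CARD('k) \<in> (if CARD('k) < CARD('k) then {- R<..<R} else {pi<..<pi + pi})"
        unfolding cell_def by (rule PiE_mem) simp
      moreover have "y CARD('k) \<in> (if CARD('k) < CARD('k) then {- R<..<R} else {0<..<0 + pi})"
        using that unfolding cell_def by (rule PiE_mem) simp
      ultimately show False by simp
    qed
    then show "?P0 \<inter> ?P1 = {}" by blast
  qed (auto simp: C_def)
  have split: "(LINT y:?A|?L. f y) = (LINT y:C|?L. f y) + ((LINT y:?P0|?L. f y) + (LINT y:?P1|?L. f y))"
    if f: "continuous_on UNIV f" for f :: "(nat \<Rightarrow> real) \<Rightarrow> real"
  proof -
    have int: "set_integrable ?L B f" if "B \<in> sets ?L" "B \<subseteq> ?A" for B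
      by (rule set_integrable_continuous_box[OF f that(1) order_trans[OF that(2) helicoid_ball_subset_box]])
    have "?A = C \<union> (?P0 \<union> ?P1)" using sub by (auto simp: C_def)
    then have "(LINT y:?A|?L. f y) = (LINT y:C \<union> (?P0 \<union> ?P1)|?L. f y)" by simp
    also have "\<dots> = (LINT y:C|?L. f y) + (LINT y:?P0 \<union> ?P1|?L. f y)"
      using disj sets sub by (intro set_integral_Un int) auto
    also have "(LINT y:?P0 \<union> ?P1|?L. f y) = (LINT y:?P0|?L. f y) + (LINT y:?P1|?L. f y)"
      using disj sets sub by (intro set_integral_Un int) auto
    finally show ?thesis .
  qed
  have cg: "continuous_on UNIV ?g" by (rule continuous_on_C2_pullback[OF C2_map_helicoid sf])
  have "\<bar>LINT y:C|?L. ?g y\<bar> \<le> (LINT y:C|?L. ?J y)"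
  proof -
    have ig: "integrable ?L (\<lambda>y. indicat_real C y * ?g y)"
      using set_integrable_continuous_box[OF cg sets(3) order_trans[OF sub(3) helicoid_ball_subset_box]]
      by (simp add: set_integrable_def)
    have "\<bar>LINT y|?L. indicat_real C y * ?g y\<bar> \<le> (LINT y|?L. \<bar>indicat_real C y * ?g y\<bar>)"
      by (rule integral_abs_bound)
    also have "\<dots> \<le> (LINT y|?L. indicat_real C y * ?J y)"
    proof (rule integral_mono)
      show "integrable ?L (\<lambda>y. \<bar>indicat_real C y * ?g y\<bar>)" using ig by (rule integrable_abs)
      show "integrable ?L (\<lambda>y. indicat_real C y * ?J y)"
        using set_integrable_helicoid_density[OF sets(3) sub(3)] by (simp add: set_integrable_def)
      show "\<bar>indicat_real C y * ?g y\<bar> \<le> indicat_real C y * ?J y" for y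
        using comass_bound_helicoid[OF smooth_formD(1)[OF sf] \<omega>(2)] by (simp add: indicator_def)
    qed
    finally show ?thesis by (simp add: set_lebesgue_integral_def)
  qed
  moreover have "0 \<le> (LINT y:?P1|?L. ?J y)"
    unfolding set_lebesgue_integral_def
    by (rule Bochner_Integration.integral_nonneg) (simp add: less_imp_le[OF helicoid_density_pos])
  moreover have "restrict_current (\<lambda>\<omega>. helicoid_current \<omega> + cube_boundary (Suc CARD('k)) (sweep R) \<omega>) (ball 0 r) \<omega> =
      (LINT y:?A|?L. ?g y) + cube_boundary (Suc CARD('k)) (sweep R) \<omega>"
    by (rule restrict_helicoid_current_plus[OF r0 \<omega>(1) C2_map_moving_helicoid image])
  ultimately show "\<bar>restrict_current (\<lambda>\<omega>. helicoid_current \<omega> + cube_boundary (Suc CARD('k)) (sweep R) \<omega>) (ball 0 r) \<omega>\<bar> \<le>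
      (LINT y:?A|?L. ?J y) - (LINT y:?P0|?L. ?J y) + sweep_bound DIM('k ambient) CARD('k) R"
    using sweep_boundary[OF \<omega> R odd] split[OF cg] split[OF continuous_on_helicoid_density[where 'k = 'k]]
    by linarith
qed

theorem theorem6p1:
  assumes "odd CARD('k::{finite,linorder})"
  shows "\<not> area_minimizing (CARD('k) + 1)
           (helicoid_current :: ((real^('k::{finite,linorder})) \<times> (real^('k::{finite,linorder})) \<times> real) current)"
proof
  assume min: "area_minimizing (CARD('k) + 1) (helicoid_current :: 'k ambient current)"
  let ?n = "CARD('k)"
  define d where "d = DIM('k ambient)"
  \<comment> \<open>Chosen so that \<open>sweep_bound d ?n R\<close> equals
    \<open>(2 * R) ^ ?n * pi * (R - 1) / 8\<close>, just below the lower bound of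
    \<open>cell_area_ge\<close>.\<close>
  define R where "R = 16 * (real (Suc ?n) * (real d ^ Suc ?n * (pi * real (Suc ?n)))) + 1"
  \<comment> \<open>The swept cube lies in the closed ball of radius \<open>?n * R + 2 * pi\<close>;
    the summand 1 puts it into an open ball.\<close>
  define r where "r = real ?n * R + 2 * pi + 1"
  define S where "S = cube_boundary (Suc ?n) (sweep R :: _ \<Rightarrow> 'k ambient)"
  have R1: "1 \<le> R" by (simp add: R_def)
  then have R0: "0 < R" by simp
  have r0: "0 < r" using R0 by (simp add: r_def add_pos_nonneg)
  let ?K = "cball 0 (real ?n * R + 2 * pi) :: 'k ambient set"
  have image: "(sweep R :: _ \<Rightarrow> 'k ambient) ` ({..<Suc (Suc ?n)} \<rightarrow>\<^sub>E {0..1}) \<subseteq> ?K"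
  proof (rule image_subsetI)
    fix y :: "nat \<Rightarrow> real" assume "y \<in> {..<Suc (Suc ?n)} \<rightarrow>\<^sub>E {0..1}"
    from sweep_cell_bounds(2)[where 'k = 'k, OF this R0] show "(sweep R y :: 'k ambient) \<in> ?K"
      by simp
  qed
  have supp: "current_support (Suc ?n) S \<subseteq> ?K"
    unfolding S_def by (rule current_support_cube_boundary[OF closed_cball image])
  have "integral_current (Suc ?n) S"
    unfolding S_def by (rule integral_current_cube_boundary[OF C2_map_moving_helicoid compact_cball image])
  moreover have "compact (current_support (Suc ?n) S)"
    by (rule compact_current_support[OF compact_cball supp])
  moreover have "\<forall>\<omega>\<in>test_forms (Suc ?n - 1). boundary (Suc ?n) S \<omega> = 0"
    unfolding S_def boundary_def
    by (simp add: cube_boundary_ext_deriv[OF smooth_form_if_test_form C2_map_moving_helicoid])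
  moreover have "current_support (Suc ?n) S \<subseteq> ball 0 r"
    using supp by (force simp: r_def)
  ultimately have "mass (Suc ?n) (restrict_current (helicoid_current :: 'k ambient current) (ball 0 r)) \<le>
      mass (Suc ?n) (restrict_current (\<lambda>\<omega>. helicoid_current \<omega> + S \<omega>) (ball 0 r))"
    using r0 by (intro min[unfolded area_minimizing_def Suc_eq_plus1[symmetric], rule_format] conjI)
  let ?I = "\<lambda>A. LINT y:A|lborel_pow (Suc ?n). helicoid_density TYPE('k) y"
  let ?A = "helicoid_ball TYPE('k) r" and ?P0 = "cell ?n R 0"
  have "ennreal (?I ?A) \<le> mass (Suc ?n) (restrict_current (helicoid_current :: 'k ambient current) (ball 0 r))"
    by (rule mass_restrict_helicoid_ge[OF r0])
  also note \<open>mass (Suc ?n) (restrict_current (helicoid_current :: 'k ambient current) (ball 0 r)) \<le> _\<close>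
  also have "mass (Suc ?n) (restrict_current (\<lambda>\<omega>. helicoid_current \<omega> + S \<omega>) (ball 0 r)) \<le>
      ennreal (?I ?A - ?I ?P0 + sweep_bound d ?n R)"
    unfolding S_def d_def by (rule mass_competitor_le[OF R1 assms r_def])
  finally have le: "ennreal (?I ?A) \<le> ennreal (?I ?A - ?I ?P0 + sweep_bound d ?n R)" .
  have "sweep_bound d ?n R = (2 * R) ^ ?n * pi * (R - 1) / 8"
    by (simp add: sweep_bound_def R_def power2_eq_square field_simps)
  also have "\<dots> < (2 * R) ^ ?n * pi * R / 8"
    using R0 by simp
  also have "\<dots> \<le> ?I ?P0"
    by (rule cell_area_ge[OF R0])
  finally have "sweep_bound d ?n R < ?I ?P0" .
  \<comment> \<open>\<open>ennreal\<close> sends negative numbers to 0, so a strict inequality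
    between reals contradicts \<open>le\<close> only when the larger side is positive.\<close>
  moreover have "0 < ?I ?A"
  proof -
    have "0 < (2 * R) ^ ?n * pi * R / 8" using R0 by simp
    also have "\<dots> \<le> ?I ?P0" by (rule cell_area_ge[OF R0])
    also have "\<dots> \<le> ?I ?A"
      unfolding set_lebesgue_integral_def
    proof (rule integral_mono)
      have sub: "?P0 \<subseteq> ?A"
        unfolding r_def by (rule cell_subset_helicoid_ball[OF R0 disjI1[OF refl]])
      show "integrable (lborel_pow (Suc ?n)) (\<lambda>y. indicat_real ?P0 y *\<^sub>R helicoid_density TYPE('k) y)"
        using set_integrable_helicoid_density[OF cell_sets sub] by (simp add: set_integrable_def)
      show "integrable (lborel_pow (Suc ?n)) (\<lambda>y. indicat_real ?A y *\<^sub>R helicoid_density TYPE('k) y)"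
        using set_integrable_helicoid_density[OF helicoid_ball_sets order_refl] by (simp add: set_integrable_def)
      show "indicat_real ?P0 y *\<^sub>R helicoid_density TYPE('k) y \<le> indicat_real ?A y *\<^sub>R helicoid_density TYPE('k) y" for y
        using sub helicoid_density_pos[where 'k = 'k, of y] by (auto simp: indicator_def less_imp_le)
    qed
    finally show ?thesis .
  qed
  ultimately show False
    using le by (smt (verit) ennreal_le_iff2)
qed

end
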